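(* Let $\Omega \subset \mathbb{R}^N$ be a bounded Lipschitz domain which satisfies a uniform exterior sphere condition, let $f \in L^\infty(\Omega)$, and let $u \in \mathbb{H}(\Omega) \cap L^\infty(\mathbb{R}^N)$ be a weak solution of the Poisson problem $$L_\Delta u=f \ \text{ in } \Omega,\qquad u=0\ \text{ in } \mathbb{R}^N\setminus\Omega.$$ Then $u \in C(\overline \Omega)$, and, with $\rho(x):=\mathrm{dist}(x,\partial\Omega)$, for every $\tau \in (0,\frac12)$, $$|u(x)|= O\Bigl(\bigl(\log \tfrac1{\rho(x)}\bigr)^{-\tau}\Bigr) \qquad \text{as } \rho(x) \to 0,\ x\in\Omega.$$
   Context: $N\ge1$; $c_N= \pi^{-N/2}\Gamma(N/2)$, $\rho_N=2 \log 2 + \psi(\frac{N}{2}) -\gamma$, with $\psi=\Gamma'/\Gamma$ and $\gamma=-\Gamma'(1)$. Functions are identified if equal a.e. $\mathbb{H}(\Omega)$ is the space of measurable $u:\mathbb{R}^N\to\mathbb{R}$ with $u\equiv0$ on $\mathbb{R}^N\setminus\Omega$ and $\iint_{|x-y|\le1}\frac{(u(x)-u(y))^2}{|x-y|^N}\,dx\,dy<\infty$ (it is contained in $L^2(\Omega)$), and on $\mathbb{H}(\Omega)$ the form of the logarithmic Laplacian $L_\Delta$ is $$\mathcal{E}_L(u,w)=\frac{c_N}{2}\iint_{|x-y|\le1}\frac{(u(x)-u(y))(w(x)-w(y))}{|x-y|^N}\,dx\,dy-c_N\iint_{|x-y|\ge1}\frac{u(x)w(y)}{|x-y|^N}\,dx\,dy+\rho_N\int_{\mathbb{R}^N}uw\,dx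 .$$ $u\in\mathbb{H}(\Omega)$ is a weak solution of the Poisson problem if $\mathcal{E}_L(u,\phi)=\int_\Omega f\phi\,dx$ for every $\phi\in\mathbb{H}(\Omega)$. Uniform exterior sphere condition: there is a radius $R_0>0$ such that for every $x_*\in\partial\Omega$ there is a ball of radius $R_0$ contained in $\mathbb{R}^N\setminus\overline\Omega$ and tangent to $\partial\Omega$ at $x_*$ (i.e. whose boundary contains $x_*$). *)

theory Defs
  imports "HOL-Analysis.Analysis" "HOL-Library.Landau_Symbols"
begin

text \<open>
  The ambient space \<open>\<real>\<^sup>N\<close> is an arbitrary Euclidean space \<open>'a\<close> with
  \<open>N = DIM('a)\<close>. Classes of functions modulo equality almost everywhere are
  represented by functions, and all measurability and integrals are with respect to
  the (complete) Lebesgue measure.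
\<close>

definition c_const :: "nat \<Rightarrow> real" where
  "c_const N = pi powr (- (real N / 2)) * Gamma (real N / 2)"

definition rho_const :: "nat \<Rightarrow> real" where
  "rho_const N = 2 * ln 2 + Digamma (real N / 2) - euler_mascheroni"

definition ess_bounded :: "'a measure \<Rightarrow> ('a \<Rightarrow> real) \<Rightarrow> bool" where
  "ess_bounded M f \<longleftrightarrow> f \<in> borel_measurable M \<and> (\<exists>C. AE x in M. \<bar>f x\<bar> \<le> C)"

text \<open>
  Vanishing outside \<open>\<Omega>\<close> is required almost everywhere, so that membership respects
  the identification of functions that are equal almost everywhere.
\<close>

definition log_space :: "'a::euclidean_space set \<Rightarrow> ('a \<Rightarrow> real) set" where
  "log_space \<Omega> = {u. u \<in> borel_measurable lebesgue \<and>
     (AE x in lebesgue. x \<notin> \<Omega> \<longrightarrow> u x = 0) \<and>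
     (\<integral>\<^sup>+ z\<in>{(x, y). norm (x - y) \<le> 1}.
        (case z of (x, y) \<Rightarrow> ennreal ((u x - u y)\<^sup>2 / norm (x - y) ^ DIM('a))) \<partial>lebesgue) < \<infinity>}"

definition log_form :: "('a::euclidean_space \<Rightarrow> real) \<Rightarrow> ('a \<Rightarrow> real) \<Rightarrow> real" where
  "log_form u w =
     c_const DIM('a) / 2 *
       (LINT (x, y):{(x, y). norm (x - y) \<le> 1}|lebesgue.
          (u x - u y) * (w x - w y) / norm (x - y) ^ DIM('a))
     - c_const DIM('a) *
       (LINT (x, y):{(x, y). norm (x - y) \<ge> 1}|lebesgue.
          u x * w y / norm (x - y) ^ DIM('a))
     + rho_const DIM('a) * (LINT x|lebesgue. u x * w x)"

definition weak_solution ::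
  "'a::euclidean_space set \<Rightarrow> ('a \<Rightarrow> real) \<Rightarrow> ('a \<Rightarrow> real) \<Rightarrow> bool" where
  "weak_solution \<Omega> f u \<longleftrightarrow> u \<in> log_space \<Omega> \<and>
     (\<forall>\<phi>\<in>log_space \<Omega>. log_form u \<phi> = (LINT x:\<Omega>|lebesgue. f x * \<phi> x))"

text \<open>
  Near each boundary point, \<open>\<Omega>\<close> is the region above the graph of a Lipschitz function \<open>g\<close>
  in rotated coordinates: the unit vector \<open>e\<close> is the vertical direction,
  and \<open>x - (x \<bullet> e) *\<^sub>R e\<close> is the projection of \<open>x\<close> to the hyperplane orthogonal to \<open>e\<close>.
\<close>

definition Lipschitz_domain :: "'a::euclidean_space set \<Rightarrow> bool" where
  "Lipschitz_domain \<Omega> \<longleftrightarrow> open \<Omega> \<and> connected \<Omega> \<and> \<Omega> \<noteq> {} \<and>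
     (\<forall>p\<in>frontier \<Omega>. \<exists>e r L g. norm e = 1 \<and> r > 0 \<and> L-lipschitz_on {y. y \<bullet> e = 0} g \<and>
        \<Omega> \<inter> ball p r = {x \<in> ball p r. (g (x - (x \<bullet> e) *\<^sub>R e) :: real) < x \<bullet> e})"

definition uniform_exterior_sphere :: "'a::euclidean_space set \<Rightarrow> bool" where
  "uniform_exterior_sphere \<Omega> \<longleftrightarrow>
     (\<exists>R0>0. \<forall>p\<in>frontier \<Omega>. \<exists>z. ball z R0 \<subseteq> - closure \<Omega> \<and> p \<in> sphere z R0)"

definition bdist :: "'a::euclidean_space set \<Rightarrow> 'a \<Rightarrow> real" where
  "bdist \<Omega> x = infdist x (frontier \<Omega>)"

text \<open>The limit \<open>bdist \<Omega> x \<rightarrow> 0\<close> with \<open>x \<in> \<Omega>\<close>.\<close>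

definition to_boundary :: "'a::euclidean_space set \<Rightarrow> 'a filter" where
  "to_boundary \<Omega> = inf (filtercomap (bdist \<Omega>) (nhds 0)) (principal \<Omega>)"

end

theory Submission
  imports Defs
begin

text \<open>
  Truncating the kernel near the origin splits the form into a nonnegative singular part and
  convolution with an integrable kernel \<open>\<kappa>\<close>, which adds the zero-order term \<open>a u\<close> with
  \<open>a = \<integral> \<kappa>\<close>. Since \<open>norm h powr (- N)\<close> is not integrable at the origin, \<open>a\<close> can be made
  arbitrarily large.

  Interior continuity: the difference \<open>v x = u (x + d) - u x\<close> solves a problem whose right-hand
  side is bounded, uniformly in small \<open>d\<close> for fixed \<open>\<kappa>\<close>, by a constant independent of
  \<open>\<kappa>\<close>. Testing with the positive part of \<open>v - W\<close>, where \<open>W\<close> equals \<open>m\<close> near a given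
  point and grows linearly away from it, gives \<open>v \<le> m\<close> there as soon as \<open>a m\<close> exceeds
  the constant. No pointwise evaluation of the operator at \<open>u\<close> is needed.

  Boundary decay: \<open>u\<close> is compared with a multiple of \<open>W y = (- ln t) powr (- \<tau>)\<close>,
  \<open>t = norm (y - z) - R'\<close>, around a slightly shrunken exterior ball. Almost half of the
  directions at a point lead into the ball, where \<open>W = 0\<close>, and in the others \<open>W\<close> is at most
  its radial majorant. With \<open>s = - ln t\<close>, the operator applied to \<open>W\<close> is therefore at least a
  multiple of \<open>s powr (1 - \<tau>) * (1 - 1 / (2 * (1 - \<tau>)))\<close> up to bounded terms, which is where
  \<open>\<tau> < 1 / 2\<close> enters.
\<close>

section \<open>Radial integrals over cones\<close>

text \<open>The operator has order zero: \<open>norm h * trunc_riesz h\<close> is integrable, so on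
  a Lipschitz barrier the singular part is an absolutely convergent integral, bounded independently
  of \<kappa>. About \<open>u\<close> only boundedness and finite energy are known, so the barrier
  carries all the regularity: on the support of the excess, monotonicity of \<open>max 0\<close>
  lets the barrier replace \<open>u\<close> inside the form. Two different far kernels occur.
  Continuity needs a continuous family of unbounded mass, whose convolution with \<open>u\<close>
  hardly moves under a small shift. Decay needs one fixed sharp cutoff, confining the near part to
  scales at which a ball looks like a half-space. The factor in \<tau> compares two logarithmic
  integrals with weight dr/r from scale t on: up to bounded terms, the gain
  \<open>s powr (- \<tau>)\<close> in all directions adds up to \<open>s powr (1 - \<tau>)\<close>,
  and the loss \<open>(- ln r) powr (- \<tau>)\<close> in half of them to half of
  \<open>s powr (1 - \<tau>) / (1 - \<tau>)\<close>. The profile is not Lipschitz at the sphere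
  itself; this forces the shrinking of the ball, and all constants must survive it.\<close>

lemma distr_lborel_reflect:
  fixes x :: "'a::euclidean_space"
  shows "distr lborel borel (\<lambda>y. x - y) = lborel"
  by (subst (2) lborel_affine[of "-1" x]) (auto simp: density_1)

lemma
  fixes f :: "'a::euclidean_space \<Rightarrow> real"
  assumes [measurable]: "f \<in> borel_measurable borel"
  shows integrable_reflect_iff: "integrable lborel (\<lambda>y. f (x - y)) \<longleftrightarrow> integrable lborel f"
    and integral_reflect: "(\<integral>y. f (x - y) \<partial>lborel) = (\<integral>y. f y \<partial>lborel)"
  using integrable_distr_eq[of "\<lambda>y. x - y" lborel borel f]
        integral_distr[of "\<lambda>y. x - y" lborel borel f]
  by (simp_all add: distr_lborel_reflect)

lemma
  fixes f :: "'a::euclidean_space \<Rightarrow> real"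
  assumes [measurable]: "f \<in> borel_measurable borel"
  shows integrable_translate_iff: "integrable lborel (\<lambda>y. f (y + x)) \<longleftrightarrow> integrable lborel f"
    and integral_translate: "(\<integral>y. f (y + x) \<partial>lborel) = (\<integral>y. f y \<partial>lborel)"
  using integrable_distr_eq[of "\<lambda>y. x + y" lborel borel f]
        integral_distr[of "\<lambda>y. x + y" lborel borel f]
  by (simp_all only: lborel_distr_plus) (simp_all add: add.commute)

lemma AE_lborel_translate:
  fixes x :: "'a::euclidean_space"
  assumes "AE y in lborel. P (y + x)"
  shows "AE y in lborel. P y"
proof -
  have "AE y in distr lborel borel (\<lambda>y. x + y). P y"
  proof -
    obtain N where N: "{y \<in> space lborel. \<not> P (y + x)} \<subseteq> N" "N \<in> null_sets lborel"
      using assms unfolding eventually_ae_filter by blast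
    have "(\<lambda>y. y - x) -` N \<in> null_sets lborel"
    proof -
      have "emeasure lborel ((\<lambda>y. y - x) -` N) = emeasure (distr lborel borel (\<lambda>y. - x + y)) N"
        using N by (subst emeasure_distr) (auto intro!: arg_cong[of _ _ "emeasure lborel"])
      moreover have "(\<lambda>y. y - x) -` N \<in> sets borel"
        using N by (intro measurable_sets_borel[of _ borel]) auto
      ultimately show ?thesis
        using N by (simp only: lborel_distr_plus) (simp add: null_sets_def)
    qed
    then show ?thesis
      by (intro AE_I'[where N="(\<lambda>y. y - x) -` N"]) (use N in \<open>auto simp: lborel_distr_plus subset_eq intro!: spec[of _ "_ - x", THEN mp]\<close>)
  qed
  then show ?thesis by (simp only: lborel_distr_plus)
qed

definition riesz :: "'a::euclidean_space \<Rightarrow> real" where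
  "riesz h = 1 / norm h ^ DIM('a)"

lemma riesz_measurable [measurable]: "riesz \<in> borel_measurable borel"
  unfolding riesz_def by measurable

lemma riesz_nonneg: "0 \<le> riesz h"
  by (simp add: riesz_def)

lemma riesz_minus [simp]: "riesz (- h) = riesz h"
  by (simp add: riesz_def)

lemma emeasure_cone_cball:
  fixes S :: "'a::euclidean_space set"
  assumes S[measurable]: "S \<in> sets borel" and cone: "\<And>c h. 0 < c \<Longrightarrow> c *\<^sub>R h \<in> S \<longleftrightarrow> h \<in> S"
    and r: "0 < r"
  shows "emeasure lborel (S \<inter> cball 0 r) = ennreal (r ^ DIM('a) * measure lborel (S \<inter> cball 0 1))"
proof -
  have "S \<inter> cball 0 r = (\<lambda>h. r *\<^sub>R h + 0) ` (S \<inter> cball 0 1)"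
  proof (safe)
    fix h assume h: "h \<in> S" "h \<in> cball 0 r"
    then have "(1 / r) *\<^sub>R h \<in> S \<inter> cball 0 1"
      using cone[of "1/r" h] r by (auto simp: field_simps)
    then show "h \<in> (\<lambda>h. r *\<^sub>R h + 0) ` (S \<inter> cball 0 1)"
      using r by (intro image_eqI[of _ _ "(1 / r) *\<^sub>R h"]) auto
  qed (use r cone in \<open>auto\<close>)
  moreover have "S \<inter> cball 0 r \<in> sets borel" "S \<inter> cball 0 1 \<in> sets borel" by auto
  moreover have "emeasure lborel (S \<inter> cball 0 1) = ennreal (measure lborel (S \<inter> cball 0 1))"
    by (rule emeasure_eq_ennreal_measure)
      (metis bounded_cball bounded_subset emeasure_bounded_finite inf_le2 less_irrefl infinity_ennreal_def)
  ultimately show ?thesis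
    using emeasure_lebesgue_affine[of r 0 "S \<inter> cball 0 1"] r
    by (simp add: ennreal_mult'' flip: ennreal_power)
qed

text \<open>Polar coordinates without surface measure: by \<open>emeasure_cone_cball\<close> the
  part of the cone in a ball of radius r has volume \<open>v * r ^ DIM('a)\<close>, and
  differentiating gives the density. Two measures on the line that agree and are finite on all
  \<open>{x<..}\<close> are equal.\<close>

lemma cone_radial_measure:
  fixes S :: "'a::euclidean_space set" and v :: real
  assumes S[measurable]: "S \<in> sets borel" and cone: "\<And>c h. 0 < c \<Longrightarrow> c *\<^sub>R h \<in> S \<longleftrightarrow> h \<in> S"
  defines "v \<equiv> measure lborel (S \<inter> cball 0 1)"
  shows "distr (density lborel (indicator (S \<inter> cball 0 1))) borel norm =
    density lborel (\<lambda>r. ennreal (indicator {0..1} r * (DIM('a) * v * r ^ (DIM('a) - 1))))"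
    (is "?L = ?R")
proof (rule measure_eqI_lessThan)
  have ball: "emeasure lborel (S \<inter> cball 0 r) = ennreal (r ^ DIM('a) * v)" if "0 < r" for r
    unfolding v_def by (rule emeasure_cone_cball[OF S cone that])
  have v: "0 \<le> v" by (simp add: v_def)
  have fin: "emeasure lborel (S \<inter> cball 0 r \<inter> X) < \<infinity>" for r X
    by (rule emeasure_bounded_finite, rule bounded_subset[OF bounded_cball[of 0 r]]) auto
  have [measurable]: "Measurable.pred borel (\<lambda>h::'a. h \<in> S)" by simp
  fix x :: real
  have L: "emeasure ?L {x<..} = emeasure lborel (S \<inter> cball 0 1 \<inter> {h. x < norm h})"
  proof -
    have "emeasure ?L {x<..} = emeasure (density lborel (indicator (S \<inter> cball 0 1))) {h. x < norm h}"
      by (subst emeasure_distr) (simp_all add: vimage_def)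
    also have "\<dots> = (\<integral>\<^sup>+h. indicator (S \<inter> cball 0 1) h * indicator {h. x < norm h} h \<partial>lborel)"
      by (rule emeasure_density) (simp_all add: borel_measurable_indicator)
    also have "\<dots> = (\<integral>\<^sup>+h. indicator (S \<inter> cball 0 1 \<inter> {h. x < norm h}) h \<partial>lborel)"
      by (rule nn_integral_cong) (simp add: indicator_def)
    also have "\<dots> = emeasure lborel (S \<inter> cball 0 1 \<inter> {h. x < norm h})"
      by (subst nn_integral_indicator) measurable
    finally show ?thesis .
  qed
  show "emeasure ?L {x<..} < \<infinity>"
    unfolding L by (rule fin)
  let ?d = "\<lambda>r. DIM('a) * v * r ^ (DIM('a) - 1)"
  have R: "emeasure ?R {x<..} = ennreal (v * (1 - m ^ DIM('a)))"
    if m: "m = max x 0" "m \<le> 1" for m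
  proof -
    have "emeasure ?R {x<..} = (\<integral>\<^sup>+r. ennreal (indicator {0..1} r * ?d r) * indicator {x<..} r \<partial>lborel)"
      by (subst emeasure_density) auto
    also have "\<dots> = (\<integral>\<^sup>+r. ennreal (?d r) * indicator {m..1} r \<partial>lborel)"
    proof (rule nn_integral_cong_AE)
      have "AE r in lborel. r \<noteq> x" by (rule AE_lborel_singleton)
      then show "AE r in lborel. ennreal (indicator {0..1} r * ?d r) * indicator {x<..} r =
        ennreal (?d r) * indicator {m..1} r"
        by eventually_elim (use m in \<open>auto simp: indicator_def max_def\<close>)
    qed
    also have "\<dots> = ennreal (v * 1 ^ DIM('a) - v * m ^ DIM('a))"
      using m v by (intro nn_integral_FTC_Icc) (auto intro!: derivative_eq_intros)
    finally show ?thesis by (simp add: algebra_simps)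
  qed
  have z: "(0::real) ^ DIM('a) = 0" by (rule zero_power) simp
  consider "x < 0" | "x = 0" | "0 < x" "x \<le> 1" | "1 < x" by linarith
  then show "emeasure ?L {x<..} = emeasure ?R {x<..}"
  proof cases
    case 1
    then have *: "S \<inter> cball 0 1 \<inter> {h. x < norm h} = S \<inter> cball 0 1"
      by (auto intro: less_le_trans[OF _ norm_ge_zero])
    have "emeasure ?R {x<..} = ennreal v" using R[of 0] 1 z by simp
    moreover have "emeasure lborel (S \<inter> cball 0 1) = ennreal v" using ball[of 1] by simp
    ultimately show ?thesis unfolding L * by (simp only:)
  next
    case 2
    \<comment> \<open>At \<open>x = 0\<close> the tail set drops only the origin, a null
      set.\<close>
    have "emeasure lborel (S \<inter> cball 0 1 \<inter> {h. x < norm h}) = emeasure lborel (S \<inter> cball 0 1 - {0})"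
      using 2 by (auto intro!: arg_cong[of _ _ "emeasure lborel"])
    also have "\<dots> = emeasure lborel (S \<inter> cball 0 1)"
      by (rule emeasure_Diff_null_set) auto
    also have "\<dots> = ennreal v" using ball[of 1] by simp
    finally have "emeasure lborel (S \<inter> cball 0 1 \<inter> {h. x < norm h}) = ennreal v" .
    moreover have "emeasure ?R {x<..} = ennreal v" using R[of 0] 2 z by simp
    ultimately show ?thesis unfolding L by (simp only:)
  next
    case 3
    have "S \<inter> cball 0 1 \<inter> {h. x < norm h} = (S \<inter> cball 0 1) - (S \<inter> cball 0 x)" by auto
    moreover have "S \<inter> cball 0 x \<subseteq> S \<inter> cball 0 1" using 3 by auto
    moreover have "emeasure lborel (S \<inter> cball 0 x) \<noteq> \<infinity>" using fin[of x UNIV] by simp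
    ultimately have "emeasure lborel (S \<inter> cball 0 1 \<inter> {h. x < norm h}) =
        emeasure lborel (S \<inter> cball 0 1) - emeasure lborel (S \<inter> cball 0 x)"
      by (simp add: emeasure_Diff)
    also have "\<dots> = ennreal (v - x ^ DIM('a) * v)"
      using ball[of 1] ball[of x] 3 v by (simp add: ennreal_minus)
    finally show ?thesis unfolding L using 3 R[of x] by (simp add: algebra_simps)
  next
    case 4
    then have *: "S \<inter> cball 0 1 \<inter> {h. x < norm h} = {}" by auto
    have "emeasure ?R {x<..} = (\<integral>\<^sup>+r. 0 \<partial>(lborel::real measure))"
      by (subst emeasure_density, simp, simp, rule nn_integral_cong)
        (use 4 in \<open>auto simp: indicator_def\<close>)
    then show ?thesis unfolding L * by simp
  qed
qed auto

text \<open>The factor \<open>norm h * riesz h\<close> is \<open>norm h\<close> to the power 1 - N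
  and cancels the Jacobian of \<open>cone_radial_measure\<close>; what remains is the
  one-dimensional integral of \<open>p\<close>. The radial integrals below, with \<open>p\<close>
  constant, 1 / r or logarithmic, are all instances. \<open>b \<le> 1\<close> because the radial law
  was computed in the unit ball.\<close>

lemma has_bochner_integral_cone_radial:
  fixes S :: "'a::euclidean_space set" and p P :: "real \<Rightarrow> real"
  assumes S[measurable]: "S \<in> sets borel" and cone: "\<And>c h. 0 < c \<Longrightarrow> c *\<^sub>R h \<in> S \<longleftrightarrow> h \<in> S"
    and p[measurable]: "p \<in> borel_measurable borel"
    and ab: "0 \<le> a" "a \<le> b" "b \<le> 1"
    and P: "\<And>r. a \<le> r \<Longrightarrow> r \<le> b \<Longrightarrow> (P has_real_derivative p r) (at r)"
    and pos: "\<And>r. a \<le> r \<Longrightarrow> r \<le> b \<Longrightarrow> 0 \<le> p r"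
  shows "has_bochner_integral lborel
    (\<lambda>h. indicator S h * (indicator {a..b} (norm h) * (p (norm h) * (norm h * riesz h))))
    (DIM('a) * measure lborel (S \<inter> cball 0 1) * (P b - P a))"
proof (rule has_bochner_integral_nn_integral)
  let ?v = "measure lborel (S \<inter> cball 0 1)"
  let ?q = "\<lambda>r. indicator {a..b} r * (p r * (r / r ^ DIM('a)))"
  have Pab: "P a \<le> P b"
    using P pos ab by (intro DERIV_nonneg_imp_nondecreasing[of a b P]) auto
  show "0 \<le> DIM('a) * ?v * (P b - P a)" using Pab by simp
  show "AE h in lborel. 0 \<le> indicator S h * (indicator {a..b} (norm h) * (p (norm h) * (norm h * riesz h)))"
    using pos by (intro AE_I2) (simp add: indicator_def riesz_nonneg)
  have "(\<integral>\<^sup>+h. ennreal (indicator S h * (indicator {a..b} (norm h) * (p (norm h) * (norm h * riesz h)))) \<partial>lborel)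
    = (\<integral>\<^sup>+h. ennreal (?q (norm h)) \<partial>density lborel (indicator (S \<inter> cball 0 1)))"
  proof (subst nn_integral_density)
    show "indicator (S \<inter> cball 0 1) \<in> borel_measurable lborel"
      by (simp add: borel_measurable_indicator)
    show "(\<integral>\<^sup>+h. ennreal (indicator S h * (indicator {a..b} (norm h) * (p (norm h) * (norm h * riesz h)))) \<partial>lborel)
      = (\<integral>\<^sup>+h. indicator (S \<inter> cball 0 1) h * ennreal (?q (norm h)) \<partial>lborel)"
      using ab by (intro nn_integral_cong) (simp add: indicator_def riesz_def)
  qed measurable
  also have "\<dots> = (\<integral>\<^sup>+r. ennreal (?q r) \<partial>distr (density lborel (indicator (S \<inter> cball 0 1))) borel norm)"
    by (subst nn_integral_distr) simp_all
  also have "\<dots> = (\<integral>\<^sup>+r. ennreal (indicator {0..1} r * (DIM('a) * ?v * r ^ (DIM('a) - 1))) * ennreal (?q r) \<partial>lborel)"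
    by (subst cone_radial_measure[OF S cone], simp, subst nn_integral_density) simp_all
  also have "\<dots> = (\<integral>\<^sup>+r. ennreal (DIM('a) * ?v * p r) * indicator {a..b} r \<partial>lborel)"
  proof (rule nn_integral_cong_AE)
    have "AE r in lborel. r \<noteq> (0::real)" by (rule AE_lborel_singleton)
    then show "AE r in lborel. ennreal (indicator {0..1} r * (DIM('a) * ?v * r ^ (DIM('a) - 1))) * ennreal (?q r)
      = ennreal (DIM('a) * ?v * p r) * indicator {a..b} r"
    proof eventually_elim
      case (elim r)
      have "r ^ (DIM('a) - 1) * (r / r ^ DIM('a)) = 1"
        using elim by (cases "DIM('a)") simp_all
      then have "indicator {0..1} r * (DIM('a) * ?v * r ^ (DIM('a) - 1)) * (p r * (r / r ^ DIM('a))) = DIM('a) * ?v * p r"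
        if "r \<in> {a..b}"
        using that ab by (simp add: indicator_def algebra_simps)
      then show ?case using ab
        using pos by (auto simp: indicator_def simp flip: ennreal_mult'')
    qed
  qed
  also have "\<dots> = ennreal (DIM('a) * ?v * P b - DIM('a) * ?v * P a)"
    using ab pos P by (intro nn_integral_FTC_Icc) (auto intro!: derivative_eq_intros)
  finally show "(\<integral>\<^sup>+h. ennreal (indicator S h * (indicator {a..b} (norm h) * (p (norm h) * (norm h * riesz h)))) \<partial>lborel)
    = ennreal (DIM('a) * ?v * (P b - P a))" by (simp add: algebra_simps)
qed (simp)

section \<open>The nonlocal form and truncation\<close>

definition trunc_riesz :: "'a::euclidean_space \<Rightarrow> real" where
  "trunc_riesz h = (if norm h \<le> 1 then riesz h else 0)"

lemma trunc_riesz_measurable [measurable]: "trunc_riesz \<in> borel_measurable borel"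
  unfolding trunc_riesz_def by measurable

lemma trunc_riesz_nonneg [simp]: "0 \<le> trunc_riesz h"
  by (simp add: trunc_riesz_def riesz_nonneg)

lemma trunc_riesz_minus: "trunc_riesz (- h) = trunc_riesz h"
  by (simp add: trunc_riesz_def)

text \<open>Here the order zero of the operator enters: one factor \<open>norm h\<close> from a
  Lipschitz difference makes the kernel integrable.\<close>

lemma has_bochner_integral_norm_trunc_riesz:
  "has_bochner_integral lborel (\<lambda>h::'a::euclidean_space. norm h * trunc_riesz h)
    (DIM('a) * measure lborel (cball (0::'a) 1))"
proof -
  have "has_bochner_integral lborel
    (\<lambda>h::'a. indicator UNIV h * (indicator {0..1} (norm h) * ((\<lambda>_. 1) (norm h) * (norm h * riesz h))))
    (DIM('a) * measure lborel (UNIV \<inter> cball (0::'a) 1) * (1 - 0))"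
    by (rule has_bochner_integral_cone_radial[where P="\<lambda>r. r"]) (auto intro!: derivative_eq_intros)
  also have "(\<lambda>h::'a. indicator UNIV h * (indicator {0..1} (norm h) * ((\<lambda>_. 1) (norm h) * (norm h * riesz h))))
      = (\<lambda>h. norm h * trunc_riesz h)"
    by (auto simp: fun_eq_iff trunc_riesz_def indicator_def)
  finally show ?thesis by simp
qed

text \<open>The condition at \<open>h = 0\<close> is omitted, since the kernel of the form has the junk value
  \<open>1 / 0 = 0\<close> there and the diagonal is a null set.\<close>

definition far_kernel :: "('a::euclidean_space \<Rightarrow> real) \<Rightarrow> bool" where
  "far_kernel \<kappa> \<longleftrightarrow> \<kappa> \<in> borel_measurable borel \<and> (\<forall>h. 0 \<le> \<kappa> h) \<and> (\<forall>h. \<kappa> (- h) = \<kappa> h) \<and>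
     (\<forall>h. h \<noteq> 0 \<longrightarrow> \<kappa> h \<le> trunc_riesz h) \<and> (\<exists>B. \<forall>h. \<kappa> h \<le> B)"

text \<open>The value 0 at the origin keeps the kernel nonnegative: there \<open>trunc_riesz\<close>
  is 0 while \<kappa> may be positive.\<close>

definition near_kernel :: "('a::euclidean_space \<Rightarrow> real) \<Rightarrow> 'a \<Rightarrow> real" where
  "near_kernel \<kappa> h = (if h = 0 then 0 else trunc_riesz h - \<kappa> h)"

text \<open>Without a factor 1/2 each pair is counted twice, which is the origin of the 2 in
  \<open>dbl_form_excess_ge\<close>.\<close>

definition dbl_form :: "('a::euclidean_space \<Rightarrow> real) \<Rightarrow> ('a \<Rightarrow> real) \<Rightarrow> ('a \<Rightarrow> real) \<Rightarrow> real" where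
  "dbl_form J u w = (\<integral>z. (u (fst z) - u (snd z)) * (w (fst z) - w (snd z)) * J (fst z - snd z)
     \<partial>(lborel \<Otimes>\<^sub>M lborel))"

definition finite_energy :: "('a::euclidean_space \<Rightarrow> real) \<Rightarrow> bool" where
  "finite_energy u \<longleftrightarrow> integrable (lborel \<Otimes>\<^sub>M lborel)
     (\<lambda>z. (u (fst z) - u (snd z))\<^sup>2 * trunc_riesz (fst z - snd z))"

lemma far_kernelD:
  assumes "far_kernel \<kappa>"
  shows "\<kappa> \<in> borel_measurable borel" "0 \<le> \<kappa> h" "\<kappa> (- h) = \<kappa> h" "h \<noteq> 0 \<Longrightarrow> \<kappa> h \<le> trunc_riesz h"
    "1 < norm h \<Longrightarrow> \<kappa> h = 0" "\<exists>B. \<forall>h. \<kappa> h \<le> B"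
proof -
  show "\<kappa> h = 0" if "1 < norm h"
  proof -
    have "h \<noteq> 0" using that by auto
    then have "\<kappa> h \<le> 0" using assms that by (force simp: far_kernel_def trunc_riesz_def)
    then show ?thesis using assms by (simp add: far_kernel_def antisym)
  qed
qed (use assms in \<open>auto simp: far_kernel_def\<close>)

lemma near_kernel:
  assumes "far_kernel \<kappa>"
  shows near_kernel_measurable: "near_kernel \<kappa> \<in> borel_measurable borel"
    and near_kernel_nonneg: "0 \<le> near_kernel \<kappa> h"
    and near_kernel_le: "near_kernel \<kappa> h \<le> trunc_riesz h"
    and near_kernel_minus: "near_kernel \<kappa> (- h) = near_kernel \<kappa> h"
proof -
  have [measurable]: "\<kappa> \<in> borel_measurable borel" by (rule far_kernelD[OF assms])
  show "near_kernel \<kappa> \<in> borel_measurable borel" unfolding near_kernel_def by measurable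
qed (use assms far_kernelD[OF assms] in \<open>auto simp: near_kernel_def trunc_riesz_minus\<close>)

lemma integrable_indicator_bounded:
  fixes f :: "'a::euclidean_space \<Rightarrow> real"
  assumes [measurable]: "f \<in> borel_measurable borel" and "bounded S" "\<And>x. x \<notin> S \<Longrightarrow> f x = 0"
    and "\<And>x. \<bar>f x\<bar> \<le> B"
  shows "integrable lborel f"
proof -
  obtain r where r: "S \<subseteq> cball 0 r" using assms(2) by (auto simp: bounded_iff subset_eq)
  show ?thesis
  proof (rule Bochner_Integration.integrable_bound)
    show "integrable lborel (\<lambda>x::'a. B * indicator (cball 0 r) x :: real)"
      using emeasure_lborel_cball_finite[of "0::'a" r] by (intro integrable_mult_right integrable_real_indicator) auto
    show "AE x in lborel. norm (f x) \<le> norm (B * indicator (cball 0 r) x :: real)"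
      using assms(3,4) r by (intro AE_I2) (auto simp: indicator_def subset_eq intro: order_trans[OF _ abs_ge_self])
  qed simp
qed

lemma far_kernel_integrable:
  assumes "far_kernel \<kappa>"
  shows "integrable lborel \<kappa>"
proof -
  obtain B where "\<And>h. \<kappa> h \<le> B" using far_kernelD(6)[OF assms] by auto
  then show ?thesis
    using far_kernelD[OF assms]
    by (intro integrable_indicator_bounded[where S="cball 0 1" and B=B]) auto
qed

text \<open>Domination of convolution type: the integral of \<open>b (x - y)\<close> over y does not
  depend on x, so the double integral of the bound factorizes.\<close>

lemma integrable_kernel_bound:
  fixes f :: "'a::euclidean_space \<times> 'a \<Rightarrow> real"
  assumes [measurable]: "f \<in> borel_measurable (lborel \<Otimes>\<^sub>M lborel)"
    and a: "integrable lborel a" and b: "integrable lborel b"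
    and bd: "\<And>x y. \<bar>f (x, y)\<bar> \<le> a x * b (x - y)"
  shows "integrable (lborel \<Otimes>\<^sub>M lborel) f"
proof -
  have [measurable]: "a \<in> borel_measurable borel" "b \<in> borel_measurable borel"
    using a b borel_measurable_integrable by fastforce+
  have int: "integrable lborel (\<lambda>y. c * b (x - y))" for c x
    using integrable_reflect_iff[of b x] b by simp
  have "integrable (lborel \<Otimes>\<^sub>M lborel) (\<lambda>z. a (fst z) * b (fst z - snd z))"
  proof (rule lborel_pair.Fubini_integrable)
    have "integrable lborel (\<lambda>x. \<bar>a x\<bar> * (\<integral>y. \<bar>b y\<bar> \<partial>lborel))"
      using a by (intro integrable_mult_left) auto
    moreover have "(\<integral>y. \<bar>b (x - y)\<bar> \<partial>lborel) = (\<integral>y. \<bar>b y\<bar> \<partial>lborel)" for x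
      by (rule integral_reflect) measurable
    ultimately show "integrable lborel (\<lambda>x. \<integral>y. norm (a (fst (x, y)) * b (fst (x, y) - snd (x, y))) \<partial>lborel)"
      by (simp add: abs_mult)
  qed (use int in auto)
  then show ?thesis
    by (rule Bochner_Integration.integrable_bound)
      (use bd in \<open>auto intro!: AE_I2 intro: order_trans[OF _ abs_ge_self]\<close>)
qed

text \<open>Cauchy-Schwarz in pointwise form:
  \<open>\<bar>a * b\<bar> \<le> a\<^sup>2 + b\<^sup>2\<close> under the kernel.\<close>

lemma integrable_dbl_form:
  assumes u: "finite_energy u" and w: "finite_energy w"
    and [measurable]: "u \<in> borel_measurable borel" "w \<in> borel_measurable borel" "J \<in> borel_measurable borel"
    and J: "\<And>h. 0 \<le> J h" "\<And>h. J h \<le> trunc_riesz h"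
  shows "integrable (lborel \<Otimes>\<^sub>M lborel)
    (\<lambda>z. (u (fst z) - u (snd z)) * (w (fst z) - w (snd z)) * J (fst z - snd z))"
proof (rule Bochner_Integration.integrable_bound)
  show "integrable (lborel \<Otimes>\<^sub>M lborel) (\<lambda>z. (u (fst z) - u (snd z))\<^sup>2 * trunc_riesz (fst z - snd z)
    + (w (fst z) - w (snd z))\<^sup>2 * trunc_riesz (fst z - snd z))"
    using u w unfolding finite_energy_def by (rule Bochner_Integration.integrable_add)
  have "\<bar>a * b * j\<bar> \<le> a\<^sup>2 * k + b\<^sup>2 * k" if "0 \<le> j" "j \<le> k" for a b j k :: real
  proof -
    have "0 \<le> (\<bar>a\<bar> - \<bar>b\<bar>)\<^sup>2" by simp
    then have "2 * (\<bar>a\<bar> * \<bar>b\<bar>) \<le> a\<^sup>2 + b\<^sup>2" by (simp add: power2_diff)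
    then have "\<bar>a\<bar> * \<bar>b\<bar> \<le> a\<^sup>2 + b\<^sup>2" using mult_nonneg_nonneg[of "\<bar>a\<bar>" "\<bar>b\<bar>"] by linarith
    then have "\<bar>a\<bar> * \<bar>b\<bar> * j \<le> (a\<^sup>2 + b\<^sup>2) * k" using that by (intro mult_mono) auto
    then show ?thesis using that by (simp add: abs_mult algebra_simps)
  qed
  then show "AE z in lborel \<Otimes>\<^sub>M lborel. norm ((u (fst z) - u (snd z)) * (w (fst z) - w (snd z)) * J (fst z - snd z))
     \<le> norm ((u (fst z) - u (snd z))\<^sup>2 * trunc_riesz (fst z - snd z)
    + (w (fst z) - w (snd z))\<^sup>2 * trunc_riesz (fst z - snd z))"
    using J by (intro AE_I2) (auto intro: order_trans[OF _ abs_ge_self])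
qed simp

lemma pair_swap:
  fixes f :: "'a::euclidean_space \<times> 'a \<Rightarrow> real"
  assumes "integrable (lborel \<Otimes>\<^sub>M lborel) f"
  shows pair_swap_integrable: "integrable (lborel \<Otimes>\<^sub>M lborel) (\<lambda>z. f (snd z, fst z))"
    and pair_swap_integral: "(\<integral>z. f (snd z, fst z) \<partial>(lborel \<Otimes>\<^sub>M lborel)) = (\<integral>z. f z \<partial>(lborel \<Otimes>\<^sub>M lborel))"
proof -
  have eq: "(\<lambda>z. f (snd z, fst z)) = (\<lambda>(x, y). f (y, x))" by auto
  show "integrable (lborel \<Otimes>\<^sub>M lborel) (\<lambda>z. f (snd z, fst z))"
    unfolding eq using lborel_pair.integrable_product_swap_iff assms by blast
  show "(\<integral>z. f (snd z, fst z) \<partial>(lborel \<Otimes>\<^sub>M lborel)) = (\<integral>z. f z \<partial>(lborel \<Otimes>\<^sub>M lborel))"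
    unfolding eq using assms by (intro lborel_pair.integral_product_swap) auto
qed

section \<open>Excess of a bounded function over a Lipschitz barrier\<close>

context
  fixes v W :: "'a::euclidean_space \<Rightarrow> real" and S :: "'a set" and L M :: real
  assumes [measurable]: "v \<in> borel_measurable borel" "W \<in> borel_measurable borel"
    and energy: "finite_energy v" and S [measurable]: "S \<in> sets borel" and bdd: "bounded S"
    and Lip: "\<And>x y. x \<in> S \<Longrightarrow> \<bar>W x - W y\<bar> \<le> L * norm (x - y)" and L: "0 \<le> L"
    and supp: "\<And>x. x \<notin> S \<Longrightarrow> v x \<le> W x" and W: "\<And>x. 0 \<le> W x" and v: "\<And>x. \<bar>v x\<bar> \<le> M"
begin

lemma Lip_symmetric: "x \<in> S \<or> y \<in> S \<Longrightarrow> \<bar>W x - W y\<bar> \<le> L * norm (x - y)"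
  using Lip[of x y] Lip[of y x] by (auto simp: abs_minus_commute norm_minus_commute)

lemma integrable_indicator_S: "integrable lborel (\<lambda>x. c * indicator S x :: real)"
  using bdd by (intro integrable_indicator_bounded[where S=S and B="\<bar>c\<bar>"]) (auto simp: indicator_def)

text \<open>\<open>max 0\<close> contracts differences, so a pair meeting \<open>S\<close> costs at
  most a multiple of the energy density of \<open>v\<close> plus
  \<open>L\<^sup>2 * (norm (x - y))\<^sup>2\<close> against the kernel, and a pair outside
  \<open>S\<close> costs nothing. The global energy of \<open>W\<close>, infinite for a growing
  barrier, therefore never enters.\<close>

lemma finite_energy_excess: "finite_energy (\<lambda>x. max 0 (v x - W x))"
  unfolding finite_energy_def
proof (rule Bochner_Integration.integrable_bound)
  let ?b = "\<lambda>h::'a. norm h * trunc_riesz h"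
  let ?f = "\<lambda>z. 2 * L\<^sup>2 * indicator S (fst z) * ?b (fst z - snd z)"
  have f: "integrable (lborel \<Otimes>\<^sub>M lborel) ?f"
    by (rule integrable_kernel_bound[where a="\<lambda>x. 2 * L\<^sup>2 * indicator S x" and b="?b"])
      (use integrable_indicator_S has_bochner_integral_norm_trunc_riesz in \<open>auto simp: has_bochner_integral_iff abs_mult\<close>)
  show "integrable (lborel \<Otimes>\<^sub>M lborel) (\<lambda>z. 2 * ((v (fst z) - v (snd z))\<^sup>2 * trunc_riesz (fst z - snd z))
     + (?f z + ?f (snd z, fst z)))"
    using energy f pair_swap_integrable[OF f] unfolding finite_energy_def by auto
  have "(max 0 (v x - W x) - max 0 (v y - W y))\<^sup>2 * trunc_riesz (x - y) \<le>
    2 * ((v x - v y)\<^sup>2 * trunc_riesz (x - y)) + (?f (x, y) + ?f (y, x))" for x y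
  proof (cases "x \<in> S \<or> y \<in> S")
    case True
    have "\<bar>max 0 (v x - W x) - max 0 (v y - W y)\<bar> \<le> \<bar>(v x - v y) - (W x - W y)\<bar>" by linarith
    then have "(max 0 (v x - W x) - max 0 (v y - W y))\<^sup>2 \<le> ((v x - v y) - (W x - W y))\<^sup>2"
      by (rule power2_le_iff_abs_le[THEN iffD2, OF abs_ge_zero, simplified] | simp only: abs_le_square_iff)
    also have "\<dots> \<le> 2 * (v x - v y)\<^sup>2 + 2 * (W x - W y)\<^sup>2"
      using sum_squares_ge_zero[of "(v x - v y) + (W x - W y)" 0] by (simp add: power2_eq_square algebra_simps)
    also have "(W x - W y)\<^sup>2 \<le> (L * norm (x - y))\<^sup>2"
      using Lip_symmetric[OF True] by (metis abs_le_square_iff abs_mult abs_norm_cancel abs_of_nonneg L)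
    finally have "(max 0 (v x - W x) - max 0 (v y - W y))\<^sup>2 * trunc_riesz (x - y)
      \<le> (2 * (v x - v y)\<^sup>2 + 2 * (L * norm (x - y))\<^sup>2) * trunc_riesz (x - y)"
      by (intro mult_right_mono) auto
    also have "\<dots> = 2 * ((v x - v y)\<^sup>2 * trunc_riesz (x - y)) + 2 * L\<^sup>2 * (norm (x - y) * ?b (x - y))"
      by (simp add: algebra_simps power2_eq_square)
    also have "norm (x - y) * ?b (x - y) \<le> ?b (x - y)"
    proof (cases "norm (x - y) \<le> 1")
      case True then show ?thesis by (intro mult_left_le_one_le) auto
    qed (simp add: trunc_riesz_def)
    \<comment> \<open>One of the two points lies in \<open>S\<close>, so one of the indicators is 1;
      this is why the majorant contains \<open>?f\<close> in both orders of the pair.\<close>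
    also have "2 * L\<^sup>2 * ?b (x - y) \<le> ?f (x, y) + ?f (y, x)"
      using True trunc_riesz_minus[of "x - y"] by (auto simp: indicator_def norm_minus_commute)
    finally show ?thesis by (simp add: mult_left_mono)
  next
    case False
    then have "max 0 (v x - W x) = 0" "max 0 (v y - W y) = 0" using supp[of x] supp[of y] by auto
    then show ?thesis by (simp del: max.absorb1 max.absorb2)
  qed
  then show "AE z in lborel \<Otimes>\<^sub>M lborel. norm ((max 0 (v (fst z) - W (fst z)) - max 0 (v (snd z) - W (snd z)))\<^sup>2
      * trunc_riesz (fst z - snd z)) \<le> norm (2 * ((v (fst z) - v (snd z))\<^sup>2 * trunc_riesz (fst z - snd z))
     + (?f z + ?f (snd z, fst z)))"
    by (intro AE_I2) (auto simp: abs_mult intro!: order_trans[OF _ abs_ge_self])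
qed measurable

lemma excess_bounds: "0 \<le> max 0 (v x - W x)" "max 0 (v x - W x) \<le> M * indicator S x"
  using v[of x] W[of x] supp[of x] by (auto simp: indicator_def)

lemma integrable_excess: "integrable lborel (\<lambda>x. max 0 (v x - W x))"
proof (rule integrable_indicator_bounded[where S=S and B=M])
  fix x
  show "\<bar>max 0 (v x - W x)\<bar> \<le> M" using v[of x] W[of x] by auto
qed (use bdd supp in \<open>auto simp: max_def intro: antisym\<close>)

text \<open>With \<phi> the excess, monotonicity of \<open>max 0\<close> gives \<open>(W x - W y) *
  (\<phi> x - \<phi> y) \<le> (v x - v y) * (\<phi> x - \<phi> y)\<close>, so the form is bounded
  below by the one with \<open>W\<close> in place of \<open>v\<close>. That integrand splits into
  \<open>?R\<close> and its mirror image, each contributing at least k times the integral of \<phi>.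
  The Lipschitz bound on \<open>W\<close> makes each half integrable separately; for
  \<open>v\<close> no such splitting is available.\<close>

lemma dbl_form_excess_ge:
  assumes \<kappa>: "far_kernel \<kappa>"
    and super: "\<And>x. x \<in> S \<Longrightarrow> W x < v x \<Longrightarrow> k \<le> (\<integral>y. (W x - W y) * near_kernel \<kappa> (x - y) \<partial>lborel)"
  shows "2 * k * (\<integral>x. max 0 (v x - W x) \<partial>lborel) \<le> dbl_form (near_kernel \<kappa>) v (\<lambda>x. max 0 (v x - W x))"
proof -
  note [measurable] = near_kernel_measurable[OF \<kappa>]
  define \<phi> where "\<phi> x = max 0 (v x - W x)" for x
  have [measurable]: "\<phi> \<in> borel_measurable borel" unfolding \<phi>_def by measurable
  let ?J = "near_kernel \<kappa>"
  let ?b = "\<lambda>h::'a. norm h * trunc_riesz h"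
  let ?R = "\<lambda>z. \<phi> (fst z) * ((W (fst z) - W (snd z)) * ?J (fst z - snd z))"
  have \<phi>: "0 \<le> \<phi> x" "\<phi> x \<le> M * indicator S x" for x using excess_bounds[of x] by (simp_all add: \<phi>_def)
  have \<phi>_int: "integrable lborel \<phi>" using integrable_excess by (simp add: \<phi>_def[abs_def])
  have R: "integrable (lborel \<Otimes>\<^sub>M lborel) ?R"
  proof (rule integrable_kernel_bound[where a="\<lambda>x. M * L * indicator S x" and b="?b"])
    fix x y
    show "\<bar>?R (x, y)\<bar> \<le> M * L * indicator S x * (norm (x - y) * trunc_riesz (x - y))"
    proof (cases "x \<in> S")
      case True
      have "\<phi> x * (\<bar>W x - W y\<bar> * ?J (x - y)) \<le> M * ((L * norm (x - y)) * trunc_riesz (x - y))"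
        using Lip[OF True, of y] \<phi>[of x] True near_kernel_le[OF \<kappa>] near_kernel_nonneg[OF \<kappa>] L v[of x]
        by (intro mult_mono mult_nonneg_nonneg) auto
      moreover have "\<bar>?R (x, y)\<bar> = \<phi> x * (\<bar>W x - W y\<bar> * ?J (x - y))"
        using \<phi>(1)[of x] near_kernel_nonneg[OF \<kappa>, of "x - y"] by (simp add: abs_mult)
      ultimately show ?thesis using True by (simp add: algebra_simps)
    next
      case False
      then have "\<phi> x = 0" using \<phi>[of x] by auto
      then show ?thesis using False by simp
    qed
  qed (use integrable_indicator_S has_bochner_integral_norm_trunc_riesz in \<open>auto simp: has_bochner_integral_iff\<close>)
  have "k * \<phi> x \<le> (\<integral>y. ?R (x, y) \<partial>lborel)" for x
  proof (cases "\<phi> x = 0")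
    case False
    then have "x \<in> S" "W x < v x" using supp[of x] by (auto simp: \<phi>_def max_def not_le split: if_splits)
    from super[OF this] have "\<phi> x * k \<le> \<phi> x * (\<integral>y. (W x - W y) * ?J (x - y) \<partial>lborel)"
      using \<phi>(1) by (intro mult_left_mono)
    then show ?thesis by (simp add: mult.commute)
  qed simp
  then have "(\<integral>x. k * \<phi> x \<partial>lborel) \<le> (\<integral>x. (\<integral>y. ?R (x, y) \<partial>lborel) \<partial>lborel)"
    using lborel_pair.integrable_fst'[OF R] \<phi>_int by (intro integral_mono) auto
  also have "\<dots> = (\<integral>z. ?R z \<partial>(lborel \<Otimes>\<^sub>M lborel))"
    by (rule lborel_pair.integral_fst'[OF R])
  finally have "2 * k * (\<integral>x. \<phi> x \<partial>lborel) \<le> (\<integral>z. ?R z \<partial>(lborel \<Otimes>\<^sub>M lborel)) + (\<integral>z. ?R (snd z, fst z) \<partial>(lborel \<Otimes>\<^sub>M lborel))"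
    using pair_swap_integral[OF R] by simp
  also have "\<dots> = (\<integral>z. ?R z + ?R (snd z, fst z) \<partial>(lborel \<Otimes>\<^sub>M lborel))"
    using R pair_swap_integrable[OF R] by (rule Bochner_Integration.integral_add[symmetric])
  also have "\<dots> \<le> dbl_form ?J v \<phi>"
    unfolding dbl_form_def
  proof (rule integral_mono)
    show "integrable (lborel \<Otimes>\<^sub>M lborel) (\<lambda>z. (v (fst z) - v (snd z)) * (\<phi> (fst z) - \<phi> (snd z)) * ?J (fst z - snd z))"
      using finite_energy_excess energy near_kernel_le[OF \<kappa>] near_kernel_nonneg[OF \<kappa>]
      by (intro integrable_dbl_form) (auto simp: \<phi>_def[abs_def])
    fix z :: "'a \<times> 'a"
    have "(W (fst z) - W (snd z)) * (\<phi> (fst z) - \<phi> (snd z)) \<le> (v (fst z) - v (snd z)) * (\<phi> (fst z) - \<phi> (snd z))"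
    proof -
      have "0 \<le> (a - b) * (max 0 a - max 0 b)" for a b :: real
        by (cases "a \<le> b") (auto intro: mult_nonneg_nonneg mult_nonpos_nonpos)
      from this[of "v (fst z) - W (fst z)" "v (snd z) - W (snd z)"] show ?thesis
        unfolding \<phi>_def by (simp add: algebra_simps)
    qed
    then have "(W (fst z) - W (snd z)) * (\<phi> (fst z) - \<phi> (snd z)) * ?J (fst z - snd z)
      \<le> (v (fst z) - v (snd z)) * (\<phi> (fst z) - \<phi> (snd z)) * ?J (fst z - snd z)"
      using near_kernel_nonneg[OF \<kappa>] by (rule mult_right_mono)
    moreover have "?J (snd z - fst z) = ?J (fst z - snd z)"
      using near_kernel_minus[OF \<kappa>, of "fst z - snd z"] by simp
    ultimately show "?R z + ?R (snd z, fst z)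
      \<le> (v (fst z) - v (snd z)) * (\<phi> (fst z) - \<phi> (snd z)) * ?J (fst z - snd z)"
      by (simp add: algebra_simps)
  qed (use R pair_swap_integrable[OF R] in auto)
  finally show ?thesis by (simp add: \<phi>_def[abs_def])
qed

end

section \<open>The weak problem\<close>

lemma pair_translate:
  fixes f :: "'a::euclidean_space \<times> 'a \<Rightarrow> real"
  assumes "f \<in> borel_measurable (lborel \<Otimes>\<^sub>M lborel)"
  shows pair_translate_integrable:
      "integrable (lborel \<Otimes>\<^sub>M lborel) (\<lambda>z. f (fst z + d, snd z + d)) \<longleftrightarrow> integrable (lborel \<Otimes>\<^sub>M lborel) f"
    and pair_translate_integral:
      "(\<integral>z. f (fst z + d, snd z + d) \<partial>(lborel \<Otimes>\<^sub>M lborel)) = (\<integral>z. f z \<partial>(lborel \<Otimes>\<^sub>M lborel))"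
proof -
  have f: "f \<in> borel_measurable borel" using assms by (simp add: lborel_prod)
  have eq: "(\<lambda>z. f (fst z + d, snd z + d)) = (\<lambda>z. f (z + (d, d)))" by (simp add: fun_eq_iff plus_prod_def)
  show "integrable (lborel \<Otimes>\<^sub>M lborel) (\<lambda>z. f (fst z + d, snd z + d)) \<longleftrightarrow> integrable (lborel \<Otimes>\<^sub>M lborel) f"
    unfolding eq lborel_prod by (rule integrable_translate_iff[OF f])
  show "(\<integral>z. f (fst z + d, snd z + d) \<partial>(lborel \<Otimes>\<^sub>M lborel)) = (\<integral>z. f z \<partial>(lborel \<Otimes>\<^sub>M lborel))"
    unfolding eq lborel_prod by (rule integral_translate[OF f])
qed

lemma finite_energy_translate:
  assumes [measurable]: "u \<in> borel_measurable borel" and "finite_energy u"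
  shows "finite_energy (\<lambda>x. u (x + d))"
  using assms(2) pair_translate_integrable[of "\<lambda>z. (u (fst z) - u (snd z))\<^sup>2 * trunc_riesz (fst z - snd z)" d]
  by (simp add: finite_energy_def)

lemma dbl_form_translate:
  assumes [measurable]: "u \<in> borel_measurable borel" "w \<in> borel_measurable borel" "J \<in> borel_measurable borel"
  shows "dbl_form J u (\<lambda>x. w (x - d)) = dbl_form J (\<lambda>x. u (x + d)) w"
  using pair_translate_integral[of "\<lambda>z. (u (fst z) - u (snd z)) * (w (fst z - d) - w (snd z - d)) * J (fst z - snd z)" d]
  by (simp add: dbl_form_def)

lemma finite_energy_diff:
  assumes [measurable]: "u \<in> borel_measurable borel" "w \<in> borel_measurable borel"
    and u: "finite_energy u" and w: "finite_energy w"
  shows "finite_energy (\<lambda>x. u x - w x)"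
  unfolding finite_energy_def
proof (rule Bochner_Integration.integrable_bound)
  show "integrable (lborel \<Otimes>\<^sub>M lborel) (\<lambda>z. 2 * ((u (fst z) - u (snd z))\<^sup>2 * trunc_riesz (fst z - snd z))
    + 2 * ((w (fst z) - w (snd z))\<^sup>2 * trunc_riesz (fst z - snd z)))"
    using u w unfolding finite_energy_def by auto
  have "(a - b)\<^sup>2 * k \<le> 2 * (a\<^sup>2 * k) + 2 * (b\<^sup>2 * k)" if "0 \<le> k" for a b k :: real
  proof -
    have "(a - b)\<^sup>2 \<le> 2 * a\<^sup>2 + 2 * b\<^sup>2" using sum_squares_ge_zero[of "a + b" 0] by (simp add: power2_eq_square algebra_simps)
    from mult_right_mono[OF this that] show ?thesis by (simp add: algebra_simps)
  qed
  from this[OF trunc_riesz_nonneg, of "u x - u y" "w x - w y" "x - y" for x y]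
  show "AE z in lborel \<Otimes>\<^sub>M lborel. norm ((u (fst z) - w (fst z) - (u (snd z) - w (snd z)))\<^sup>2 * trunc_riesz (fst z - snd z))
    \<le> norm (2 * ((u (fst z) - u (snd z))\<^sup>2 * trunc_riesz (fst z - snd z))
    + 2 * ((w (fst z) - w (snd z))\<^sup>2 * trunc_riesz (fst z - snd z)))"
    by (intro AE_I2) (simp add: abs_mult algebra_simps)
qed measurable

lemma dbl_form_diff:
  assumes "finite_energy u" "finite_energy v" "finite_energy w"
    and "u \<in> borel_measurable borel" "v \<in> borel_measurable borel" "w \<in> borel_measurable borel" "J \<in> borel_measurable borel"
    and "\<And>h. 0 \<le> J h" "\<And>h. J h \<le> trunc_riesz h"
  shows "dbl_form J (\<lambda>x. u x - v x) w = dbl_form J u w - dbl_form J v w"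
  unfolding dbl_form_def
    Bochner_Integration.integral_diff[OF integrable_dbl_form integrable_dbl_form,
      OF assms(1,3,4,6,7,8,9) assms(2,3,5,6,7,8,9), symmetric]
  by (rule Bochner_Integration.integral_cong) (auto simp: algebra_simps)

lemma finite_energy_minus: "finite_energy (\<lambda>x. - u x) = finite_energy u"
  by (simp add: finite_energy_def power2_commute)

lemma dbl_form_minus: "dbl_form J (\<lambda>x. - u x) w = - dbl_form J u w"
proof -
  have "dbl_form J (\<lambda>x. - u x) w = (\<integral>z. - ((u (fst z) - u (snd z)) * (w (fst z) - w (snd z)) * J (fst z - snd z))
     \<partial>(lborel \<Otimes>\<^sub>M lborel))"
    unfolding dbl_form_def by (rule Bochner_Integration.integral_cong) (auto simp: algebra_simps)
  then show ?thesis by (simp add: dbl_form_def)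
qed

text \<open>A bounded Borel member of \<open>log_space\<close> that vanishes at every point off
  \<Omega>, so that later arguments carry no exceptional null sets.\<close>

definition test_function :: "'a::euclidean_space set \<Rightarrow> ('a \<Rightarrow> real) \<Rightarrow> bool" where
  "test_function \<Omega> \<phi> \<longleftrightarrow> \<phi> \<in> borel_measurable borel \<and> (\<exists>B. \<forall>x. \<bar>\<phi> x\<bar> \<le> B) \<and>
     (\<forall>x. x \<notin> \<Omega> \<longrightarrow> \<phi> x = 0) \<and> finite_energy \<phi>"

text \<open>All terms of the Poisson problem except the singular part of the form are collected
  in the bounded right-hand side \<open>g\<close>.\<close>

locale weak_problem =
  fixes \<Omega> :: "'a::euclidean_space set" and u g :: "'a \<Rightarrow> real" and c G M :: real
  assumes open_domain: "open \<Omega>" and bounded_domain: "bounded \<Omega>"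
    and u_measurable [measurable]: "u \<in> borel_measurable borel"
    and g_measurable [measurable]: "g \<in> borel_measurable borel"
    and u_bound: "\<And>x. \<bar>u x\<bar> \<le> M" and g_bound: "\<And>x. \<bar>g x\<bar> \<le> G"
    and u_outside: "\<And>x. x \<notin> \<Omega> \<Longrightarrow> u x = 0" and u_energy: "finite_energy u"
    and c_pos: "0 < c"
    and weak: "\<And>\<phi>. test_function \<Omega> \<phi> \<Longrightarrow> c / 2 * dbl_form trunc_riesz u \<phi> = (\<integral>x. g x * \<phi> x \<partial>lborel)"

text \<open>Linearity: every one-sided estimate for \<open>u\<close> also applies to
  \<open>- u\<close>.\<close>

lemma weak_problem_minus:
  assumes "weak_problem \<Omega> u g c G M"
  shows "weak_problem \<Omega> (\<lambda>x. - u x) (\<lambda>x. - g x) c G M"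
proof -
  interpret weak_problem \<Omega> u g c G M by fact
  show ?thesis
    using u_bound g_bound open_domain bounded_domain u_energy c_pos u_outside weak
    by unfold_locales (auto simp: finite_energy_minus dbl_form_minus)
qed

context weak_problem
begin

lemma M_nonneg: "0 \<le> M" using u_bound[of 0] by linarith

lemma domain_borel [measurable]: "\<Omega> \<in> sets borel" using open_domain by simp

lemma integrable_mult_test:
  assumes \<phi>: "test_function \<Omega> \<phi>" and [measurable]: "F \<in> borel_measurable borel" and F: "\<And>x. \<bar>F x\<bar> \<le> B"
  shows "integrable lborel (\<lambda>x. F x * \<phi> x)"
proof -
  obtain B' where B': "\<And>x. \<bar>\<phi> x\<bar> \<le> B'" using \<phi> by (auto simp: test_function_def)
  have [measurable]: "\<phi> \<in> borel_measurable borel" using \<phi> by (simp add: test_function_def)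
  show ?thesis
  proof (rule integrable_indicator_bounded[OF _ bounded_domain, where B="B * B'"])
    show "\<bar>F x * \<phi> x\<bar> \<le> B * B'" for x
      using F[of x] B'[of x] by (simp add: abs_mult mult_mono')
  qed (use \<phi> in \<open>auto simp: test_function_def\<close>)
qed

text \<open>The far part of the form is twice the pairing of the test function with the bracket
  multiplied by \<open>c\<close> here; that 2 cancels the 1/2 in front of the form.\<close>

definition rhs :: "('a \<Rightarrow> real) \<Rightarrow> 'a \<Rightarrow> real" where
  "rhs \<kappa> x = g x - c * ((\<integral>h. \<kappa> h \<partial>lborel) * u x - (\<integral>y. \<kappa> (x - y) * u y \<partial>lborel))"

lemma kernel_u_integrable:
  assumes "far_kernel \<kappa>"
  shows "integrable lborel (\<lambda>y. \<kappa> (x - y) * u (y + d))"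
proof -
  note [measurable] = far_kernelD(1)[OF assms]
  show ?thesis
  proof (rule Bochner_Integration.integrable_bound)
    show "integrable lborel (\<lambda>y. M * \<kappa> (x - y))"
      using far_kernel_integrable[OF assms] integrable_reflect_iff[of \<kappa> x] by simp
    show "AE y in lborel. norm (\<kappa> (x - y) * u (y + d)) \<le> norm (M * \<kappa> (x - y))"
    proof (rule AE_I2)
      fix y
      have "\<bar>\<kappa> (x - y)\<bar> * \<bar>u (y + d)\<bar> \<le> \<bar>\<kappa> (x - y)\<bar> * M" by (intro mult_left_mono u_bound) auto
      then show "norm (\<kappa> (x - y) * u (y + d)) \<le> norm (M * \<kappa> (x - y))"
        using M_nonneg by (simp add: abs_mult mult.commute)
    qed
  qed measurable
qed

lemma rhs_measurable [measurable]:
  assumes "far_kernel \<kappa>" shows "rhs \<kappa> \<in> borel_measurable borel"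
proof -
  note [measurable] = far_kernelD(1)[OF assms]
  show ?thesis unfolding rhs_def by measurable
qed

text \<open>The bound grows with the mass of \<kappa>. Its size matters only for the boundary
  barrier, where the kernel is fixed; in \<open>shift_le\<close> it serves integrability.\<close>

lemma rhs_bound:
  assumes "far_kernel \<kappa>"
  shows "\<exists>B. \<forall>x. \<bar>rhs \<kappa> x\<bar> \<le> B"
proof (intro exI allI)
  fix x
  note [measurable] = far_kernelD(1)[OF assms]
  let ?a = "\<integral>h. \<kappa> h \<partial>lborel"
  have a: "0 \<le> ?a" using far_kernelD(2)[OF assms] by (intro Bochner_Integration.integral_nonneg) auto
  have "\<bar>\<integral>y. \<kappa> (x - y) * u y \<partial>lborel\<bar> \<le> (\<integral>y. \<bar>\<kappa> (x - y) * u y\<bar> \<partial>lborel)"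
    using integral_norm_bound[of lborel "\<lambda>y. \<kappa> (x - y) * u y"] by simp
  also have "\<dots> \<le> (\<integral>y. \<kappa> (x - y) * M \<partial>lborel)"
    using kernel_u_integrable[OF assms, of x 0] far_kernel_integrable[OF assms] integrable_reflect_iff[of \<kappa> x]
      u_bound far_kernelD(2)[OF assms]
    by (intro integral_mono integrable_abs) (auto simp: abs_mult intro!: mult_left_mono)
  also have "\<dots> = ?a * M" using integral_reflect[of \<kappa> x] by simp
  finally have 1: "\<bar>\<integral>y. \<kappa> (x - y) * u y \<partial>lborel\<bar> \<le> ?a * M" .
  have 2: "\<bar>?a * u x\<bar> \<le> ?a * M" using a u_bound by (simp add: abs_mult mult_left_mono)
  have "\<bar>c * (?a * u x - (\<integral>y. \<kappa> (x - y) * u y \<partial>lborel))\<bar> \<le> c * (?a * M + ?a * M)"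
    unfolding abs_mult using c_pos
    by (simp only: abs_of_pos) (intro mult_left_mono order_trans[OF abs_triangle_ineq4] add_mono 1 2, auto)
  then show "\<bar>rhs \<kappa> x\<bar> \<le> G + c * (?a * M + ?a * M)"
    unfolding rhs_def using g_bound[of x] by linarith
qed

text \<open>Since \<kappa> is integrable and \<open>u\<close> and \<phi> are bounded, the far part
  may be multiplied out into two terms of type \<open>?A\<close> and two mixed terms of type
  \<open>?B\<close>, equal in pairs by the swap of variables.\<close>

lemma weak_near:
  assumes \<kappa>: "far_kernel \<kappa>" and \<phi>: "test_function \<Omega> \<phi>"
  shows "c / 2 * dbl_form (near_kernel \<kappa>) u \<phi> = (\<integral>x. rhs \<kappa> x * \<phi> x \<partial>lborel)"
proof -
  note [measurable] = far_kernelD(1)[OF \<kappa>] near_kernel_measurable[OF \<kappa>]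
  have [measurable]: "\<phi> \<in> borel_measurable borel" and \<phi>0: "\<And>x. x \<notin> \<Omega> \<Longrightarrow> \<phi> x = 0" and \<phi>e: "finite_energy \<phi>"
    using \<phi> by (auto simp: test_function_def)
  obtain B where B: "\<And>x. \<bar>\<phi> x\<bar> \<le> B" using \<phi> by (auto simp: test_function_def)
  let ?A = "\<lambda>z. \<phi> (fst z) * (u (fst z) * \<kappa> (fst z - snd z))"
  let ?B = "\<lambda>z. \<phi> (fst z) * (\<kappa> (fst z - snd z) * u (snd z))"
  let ?a = "\<integral>h. \<kappa> h \<partial>lborel"
  have bd: "\<bar>\<phi> x\<bar> * (\<bar>u y\<bar> * \<kappa> h) \<le> (B * M * indicator \<Omega> x) * \<kappa> h" for x y h
  proof (cases "x \<in> \<Omega>")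
    case True
    have "\<bar>\<phi> x\<bar> * (\<bar>u y\<bar> * \<kappa> h) \<le> B * (M * \<kappa> h)"
      using B[of x] u_bound[of y] M_nonneg far_kernelD(2)[OF \<kappa>, of h] by (intro mult_mono mult_nonneg_nonneg) auto
    then show ?thesis using True by simp
  qed (simp add: \<phi>0)
  have ind: "integrable lborel (\<lambda>x. B * M * indicator \<Omega> x :: real)"
    using bounded_domain by (intro integrable_indicator_bounded[where S=\<Omega> and B="\<bar>B * M\<bar>"]) (auto simp: indicator_def)
  have A: "integrable (lborel \<Otimes>\<^sub>M lborel) ?A"
    by (rule integrable_kernel_bound[OF _ ind far_kernel_integrable[OF \<kappa>]])
      (use bd far_kernelD(2)[OF \<kappa>] in \<open>auto simp: abs_mult\<close>)
  have B: "integrable (lborel \<Otimes>\<^sub>M lborel) ?B"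
    by (rule integrable_kernel_bound[OF _ ind far_kernel_integrable[OF \<kappa>]])
      (use bd far_kernelD(2)[OF \<kappa>] in \<open>auto simp: abs_mult mult.commute[of "\<kappa> _" "\<bar>u _\<bar>"]\<close>)
  have near: "integrable (lborel \<Otimes>\<^sub>M lborel) (\<lambda>z. (u (fst z) - u (snd z)) * (\<phi> (fst z) - \<phi> (snd z)) * near_kernel \<kappa> (fst z - snd z))"
    using u_energy \<phi>e near_kernel_le[OF \<kappa>] near_kernel_nonneg[OF \<kappa>] by (intro integrable_dbl_form) auto
  have "dbl_form trunc_riesz u \<phi> = (\<integral>z. (u (fst z) - u (snd z)) * (\<phi> (fst z) - \<phi> (snd z)) * near_kernel \<kappa> (fst z - snd z)
     + ((?A z + ?A (snd z, fst z)) - (?B z + ?B (snd z, fst z))) \<partial>(lborel \<Otimes>\<^sub>M lborel))"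
    unfolding dbl_form_def
  proof (rule Bochner_Integration.integral_cong[OF refl])
    fix z :: "'a \<times> 'a"
    have "\<kappa> (snd z - fst z) = \<kappa> (fst z - snd z)" using far_kernelD(3)[OF \<kappa>, of "fst z - snd z"] by simp
    then show "(u (fst z) - u (snd z)) * (\<phi> (fst z) - \<phi> (snd z)) * trunc_riesz (fst z - snd z) =
      (u (fst z) - u (snd z)) * (\<phi> (fst z) - \<phi> (snd z)) * near_kernel \<kappa> (fst z - snd z)
     + ((?A z + ?A (snd z, fst z)) - (?B z + ?B (snd z, fst z)))"
      \<comment> \<open>On the diagonal \<open>near_kernel \<kappa>\<close> and \<kappa> need not
        add up to \<open>trunc_riesz\<close>, but there all differences vanish.\<close>
      by (cases "fst z = snd z") (simp_all add: near_kernel_def algebra_simps)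
  qed
  also have "\<dots> = dbl_form (near_kernel \<kappa>) u \<phi> + (((\<integral>z. ?A z \<partial>(lborel \<Otimes>\<^sub>M lborel)) + (\<integral>z. ?A z \<partial>(lborel \<Otimes>\<^sub>M lborel)))
      - ((\<integral>z. ?B z \<partial>(lborel \<Otimes>\<^sub>M lborel)) + (\<integral>z. ?B z \<partial>(lborel \<Otimes>\<^sub>M lborel))))"
  proof -
    note sw = pair_swap_integrable[OF A] pair_swap_integrable[OF B]
    note AA = Bochner_Integration.integrable_add[OF A sw(1)]
    note BB = Bochner_Integration.integrable_add[OF B sw(2)]
    show ?thesis
      unfolding dbl_form_def
      unfolding Bochner_Integration.integral_add[OF near Bochner_Integration.integrable_diff[OF AA BB]]
        Bochner_Integration.integral_diff[OF AA BB]
        Bochner_Integration.integral_add[OF A sw(1)] Bochner_Integration.integral_add[OF B sw(2)]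
        pair_swap_integral[OF A] pair_swap_integral[OF B] ..
  qed
  also have "(\<integral>z. ?A z \<partial>(lborel \<Otimes>\<^sub>M lborel)) = (\<integral>x. (?a * u x) * \<phi> x \<partial>lborel)"
  proof -
    have "(\<integral>z. ?A z \<partial>(lborel \<Otimes>\<^sub>M lborel)) = (\<integral>x. (\<integral>y. ?A (x, y) \<partial>lborel) \<partial>lborel)"
      by (rule lborel_pair.integral_fst'[OF A, symmetric])
    moreover have "(\<integral>y. \<kappa> (x - y) \<partial>lborel) = ?a" for x by (rule integral_reflect) simp
    ultimately show ?thesis by (simp add: ac_simps)
  qed
  also have "(\<integral>z. ?B z \<partial>(lborel \<Otimes>\<^sub>M lborel)) = (\<integral>x. (\<integral>y. \<kappa> (x - y) * u y \<partial>lborel) * \<phi> x \<partial>lborel)"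
  proof -
    have "(\<integral>z. ?B z \<partial>(lborel \<Otimes>\<^sub>M lborel)) = (\<integral>x. (\<integral>y. ?B (x, y) \<partial>lborel) \<partial>lborel)"
      by (rule lborel_pair.integral_fst'[OF B, symmetric])
    then show ?thesis by (simp add: mult.commute)
  qed
  finally have eq: "dbl_form trunc_riesz u \<phi> = dbl_form (near_kernel \<kappa>) u \<phi> +
    (2 * (\<integral>x. (?a * u x) * \<phi> x \<partial>lborel) - 2 * (\<integral>x. (\<integral>y. \<kappa> (x - y) * u y \<partial>lborel) * \<phi> x \<partial>lborel))"
    by simp
  have i1: "integrable lborel (\<lambda>x. g x * \<phi> x)" by (rule integrable_mult_test[OF \<phi> _ g_bound]) simp
  have i2: "integrable lborel (\<lambda>x. (?a * u x) * \<phi> x)"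
    using integrable_mult_test[OF \<phi> _ u_bound] by (simp add: mult.assoc)
  have i3: "integrable lborel (\<lambda>x. (\<integral>y. \<kappa> (x - y) * u y \<partial>lborel) * \<phi> x)"
    using lborel_pair.integrable_fst'[OF B] by (simp add: mult.commute)
  have "(\<integral>x. rhs \<kappa> x * \<phi> x \<partial>lborel) = (\<integral>x. g x * \<phi> x - (c * ((?a * u x) * \<phi> x) - c * ((\<integral>y. \<kappa> (x - y) * u y \<partial>lborel) * \<phi> x)) \<partial>lborel)"
    unfolding rhs_def by (intro Bochner_Integration.integral_cong) (auto simp: algebra_simps)
  also have "\<dots> = (\<integral>x. g x * \<phi> x \<partial>lborel) - (c * (\<integral>x. (?a * u x) * \<phi> x \<partial>lborel) - c * (\<integral>x. (\<integral>y. \<kappa> (x - y) * u y \<partial>lborel) * \<phi> x \<partial>lborel))"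
    using i1 i2 i3
    by (simp only: Bochner_Integration.integral_diff integrable_mult_right Bochner_Integration.integrable_diff
        integral_mult_right_zero)
  finally show ?thesis using weak[OF \<phi>] eq by (simp add: algebra_simps)
qed

text \<open>Testing with the excess bounds \<open>c * k\<close> times its integral by
  \<open>B\<close> times its integral, so \<open>B < c * k\<close> forces the excess to vanish. The
  supersolution inequality is demanded only where \<open>W < u\<close>; a large multiple of a
  barrier then needs it only close to the exterior ball.\<close>

lemma barrier_comparison:
  assumes [measurable]: "W \<in> borel_measurable borel" and W: "\<And>x. 0 \<le> W x"
    and Lip: "\<And>x y. x \<in> \<Omega> \<Longrightarrow> \<bar>W x - W y\<bar> \<le> L * norm (x - y)" and L: "0 \<le> L"
    and \<kappa>: "far_kernel \<kappa>" and B: "\<And>x. \<bar>rhs \<kappa> x\<bar> \<le> B" and k: "B < c * k"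
    and super: "\<And>x. x \<in> \<Omega> \<Longrightarrow> W x < u x \<Longrightarrow> k \<le> (\<integral>y. (W x - W y) * near_kernel \<kappa> (x - y) \<partial>lborel)"
  shows "AE x in lborel. u x \<le> W x"
proof -
  let ?\<phi> = "\<lambda>x. max 0 (u x - W x)"
  have supp: "x \<notin> \<Omega> \<Longrightarrow> u x \<le> W x" for x using u_outside[of x] W[of x] by simp
  note ctx = u_measurable assms(1) u_energy domain_borel bounded_domain Lip L supp W u_bound
  have "\<bar>?\<phi> x\<bar> \<le> M" for x using u_bound[of x] W[of x] by auto
  then have \<phi>: "test_function \<Omega> ?\<phi>"
    using finite_energy_excess[OF ctx] supp unfolding test_function_def
    by (intro conjI exI[of _ M]) auto
  have "c / 2 * (2 * k * (\<integral>x. ?\<phi> x \<partial>lborel)) \<le> c / 2 * dbl_form (near_kernel \<kappa>) u ?\<phi>"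
    using dbl_form_excess_ge[OF ctx \<kappa> super] c_pos by (intro mult_left_mono) auto
  also have "\<dots> = (\<integral>x. rhs \<kappa> x * ?\<phi> x \<partial>lborel)" by (rule weak_near[OF \<kappa> \<phi>])
  also have "\<dots> \<le> (\<integral>x. B * ?\<phi> x \<partial>lborel)"
  proof (rule integral_mono)
    show "integrable lborel (\<lambda>x. rhs \<kappa> x * ?\<phi> x)" by (rule integrable_mult_test[OF \<phi> rhs_measurable[OF \<kappa>] B])
    show "integrable lborel (\<lambda>x. B * ?\<phi> x)" using integrable_excess[OF ctx] by simp
    show "rhs \<kappa> x * ?\<phi> x \<le> B * ?\<phi> x" for x using B[of x] by (intro mult_right_mono) auto
  qed
  finally have "(c * k - B) * (\<integral>x. ?\<phi> x \<partial>lborel) \<le> 0" by (simp add: algebra_simps)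
  then have "(\<integral>x. ?\<phi> x \<partial>lborel) \<le> 0" using k by (simp add: mult_le_0_iff)
  moreover have "0 \<le> (\<integral>x. ?\<phi> x \<partial>lborel)" by (intro Bochner_Integration.integral_nonneg) simp
  ultimately have "AE x in lborel. ?\<phi> x = 0"
    using integrable_excess[OF ctx] by (subst integral_nonneg_eq_0_iff_AE[symmetric]) auto
  then show ?thesis by eventually_elim (auto simp: max_def split: if_splits)
qed

end

section \<open>Differences of translates\<close>

text \<open>This is \<open>riesz\<close> with the radius clamped to the interval from \<delta> to 1;
  subtracting 1 makes it reach 0 continuously at radius 1. Continuity matters because the
  convolution with \<open>u\<close> must be stable under small shifts.\<close>

definition cap_kernel :: "real \<Rightarrow> 'a::euclidean_space \<Rightarrow> real" where
  "cap_kernel \<delta> h = 1 / (min 1 (max (norm h) \<delta>)) ^ DIM('a) - 1"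

lemma far_kernel_cap_kernel:
  assumes "0 < \<delta>" "\<delta> \<le> 1"
  shows "far_kernel (cap_kernel \<delta> :: 'a::euclidean_space \<Rightarrow> real)"
  unfolding far_kernel_def
proof (intro conjI allI impI exI)
  show "(cap_kernel \<delta> :: 'a \<Rightarrow> real) \<in> borel_measurable borel" unfolding cap_kernel_def by measurable
  fix h :: 'a
  let ?m = "min 1 (max (norm h) \<delta>)"
  have m: "0 < ?m" "?m \<le> 1" "\<delta> \<le> ?m" using assms by auto
  show "0 \<le> cap_kernel \<delta> h" using m by (simp add: cap_kernel_def power_le_one)
  show "cap_kernel \<delta> (- h) = cap_kernel \<delta> h" by (simp add: cap_kernel_def)
  have "1 / ?m ^ DIM('a) \<le> 1 / \<delta> ^ DIM('a)" using m assms by (intro divide_left_mono power_mono) auto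
  then show "cap_kernel \<delta> h \<le> 1 / \<delta> ^ DIM('a)" by (simp add: cap_kernel_def)
  assume "h \<noteq> 0"
  show "cap_kernel \<delta> h \<le> trunc_riesz h"
  proof (cases "norm h \<le> 1")
    case True
    then have "1 / ?m ^ DIM('a) \<le> 1 / norm h ^ DIM('a)"
      using m \<open>h \<noteq> 0\<close> by (intro divide_left_mono power_mono) auto
    then show ?thesis using True by (simp add: cap_kernel_def trunc_riesz_def riesz_def)
  qed (simp add: cap_kernel_def trunc_riesz_def)
qed

text \<open>Between the radii \<delta> and 1 the kernel is \<open>riesz\<close> minus 1: the first
  part contributes the logarithm, the second costs at most the volume of the unit ball. So the mass
  diverges as \<delta> tends to 0.\<close>

lemma integral_cap_kernel_ge:
  assumes "0 < \<delta>" "\<delta> \<le> 1"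
  shows "DIM('a) * measure lborel (cball (0::'a::euclidean_space) 1) * ln (1 / \<delta>) - measure lborel (cball (0::'a) 1)
    \<le> (LINT h|lborel. cap_kernel \<delta> (h::'a))"
proof -
  let ?f = "\<lambda>h::'a. indicator UNIV h * (indicator {\<delta>..1} (norm h) * (1 / norm h * (norm h * riesz h)))"
  have f: "has_bochner_integral lborel ?f (DIM('a) * measure lborel (UNIV \<inter> cball (0::'a) 1) * (ln 1 - ln \<delta>))"
    by (rule has_bochner_integral_cone_radial[where p="\<lambda>r. 1 / r"])
      (use assms in \<open>auto intro!: derivative_eq_intros\<close>)
  have i: "integrable lborel (indicator (cball (0::'a) 1) :: 'a \<Rightarrow> real)"
    using emeasure_lborel_cball_finite[of "0::'a" 1] by (intro integrable_real_indicator) auto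
  have "(\<integral>h. ?f h - indicator (cball 0 1) h \<partial>lborel) \<le> (LINT h|lborel. cap_kernel \<delta> (h::'a))"
  proof (rule integral_mono)
    show "integrable lborel (\<lambda>h. ?f h - indicator (cball 0 1) h)"
      using f i by (auto simp: has_bochner_integral_iff)
    show "integrable lborel (cap_kernel \<delta> :: 'a \<Rightarrow> real)"
      by (rule far_kernel_integrable[OF far_kernel_cap_kernel[OF assms]])
    show "?f h - indicator (cball 0 1) h \<le> cap_kernel \<delta> h" for h
    proof (cases "norm h \<in> {\<delta>..1}")
      case True
      then show ?thesis using assms by (auto simp: cap_kernel_def riesz_def min_def max_def indicator_def)
    next
      case False
      have "- indicator (cball 0 1) h \<le> (0::real)" by simp
      also have "0 \<le> cap_kernel \<delta> h" by (rule far_kernelD(2)[OF far_kernel_cap_kernel[OF assms]])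
      finally show ?thesis using False by simp
    qed
  qed
  also have "(\<integral>h. ?f h - indicator (cball 0 1) h \<partial>lborel) = (\<integral>h. ?f h \<partial>lborel) - measure lborel (cball (0::'a) 1)"
    using f i by (subst Bochner_Integration.integral_diff) (auto simp: has_bochner_integral_iff)
  also have "(\<integral>h. ?f h \<partial>lborel) = DIM('a) * measure lborel (cball (0::'a) 1) * ln (1 / \<delta>)"
    using f assms by (simp add: has_bochner_integral_iff ln_div)
  finally show ?thesis by simp
qed

text \<open>The clamped radius is 1-Lipschitz in \<open>h\<close> and ranges over a compact interval
  away from 0.\<close>

lemma cap_kernel_uniformly_continuous:
  assumes "0 < \<delta>" "\<delta> \<le> 1" "0 < \<epsilon>"
  shows "\<exists>\<eta>>0. \<forall>h d::'a::euclidean_space. norm d < \<eta> \<longrightarrow> \<bar>cap_kernel \<delta> (h + d) - cap_kernel \<delta> h\<bar> < \<epsilon>"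
proof -
  have "uniformly_continuous_on {\<delta>..1} (\<lambda>t::real. 1 / t ^ DIM('a))"
    by (rule compact_uniformly_continuous) (use assms in \<open>auto intro!: continuous_intros\<close>)
  then obtain \<eta> where \<eta>: "0 < \<eta>"
    "\<And>s t. s \<in> {\<delta>..1} \<Longrightarrow> t \<in> {\<delta>..1} \<Longrightarrow> \<bar>s - t\<bar> < \<eta> \<Longrightarrow> \<bar>1 / s ^ DIM('a) - 1 / t ^ DIM('a)\<bar> < \<epsilon>"
    using assms(3) unfolding uniformly_continuous_on_def dist_real_def by meson
  have "\<bar>cap_kernel \<delta> (h + d) - cap_kernel \<delta> h\<bar> < \<epsilon>" if "norm d < \<eta>" for h d :: 'a
  proof -
    have "\<bar>norm (h + d) - norm h\<bar> \<le> norm d" using norm_triangle_ineq3[of "h + d" h] by simp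
    then have "\<bar>min 1 (max (norm (h + d)) \<delta>) - min 1 (max (norm h) \<delta>)\<bar> \<le> norm d" by linarith
    then have "\<bar>1 / (min 1 (max (norm (h + d)) \<delta>)) ^ DIM('a) - 1 / (min 1 (max (norm h) \<delta>)) ^ DIM('a)\<bar> < \<epsilon>"
      using assms that by (intro \<eta>(2)) auto
    then show ?thesis by (simp add: cap_kernel_def)
  qed
  then show ?thesis using \<eta>(1) by auto
qed

context weak_problem
begin

text \<open>Order of choices: the slope of the barrier depends on \<open>M\<close> and
  \<open>r\<close> only; then \<kappa> gets a mass large enough for the given \<open>m\<close>; only
  then \<eta> comes from the continuity of \<kappa>. The shift is moved from the equation onto the
  test function, whose translate must stay supported in \<Omega>, hence the room of radius
  \<open>4 * r\<close>.\<close>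

lemma shift_le:
  assumes ball: "ball x0 (4 * r) \<subseteq> \<Omega>" and r: "0 < r" and m: "0 < m"
  shows "\<exists>\<eta>>0. \<forall>d. norm d < \<eta> \<longrightarrow> (AE x in lborel. x \<in> ball x0 r \<longrightarrow> u (x + d) - u x \<le> m)"
proof -
  define \<omega> where "\<omega> = DIM('a) * measure lborel (cball (0::'a) 1)"
  \<comment> \<open>Slope of a barrier that climbs by \<open>2 * M\<close> between the radii
    \<open>r\<close> and \<open>2 * r\<close>.\<close>
  define L where "L = 2 * M / r"
  \<comment> \<open>Mass needed to beat all other terms: \<open>2 * G\<close> from two values of
    \<open>g\<close>, \<open>c\<close> from the shifted convolution,
    \<open>c * (L * \<omega>)\<close> from the barrier.\<close>
  define A where "A = (2 * G + c + c * (L * \<omega>)) / (c * m)"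
  have V: "0 < measure lborel (cball (0::'a) 1)" by (rule content_cball_pos) simp
  then have \<omega>: "0 < \<omega>" by (simp add: \<omega>_def)
  have L: "0 \<le> L" using M_nonneg r by (simp add: L_def)
  obtain \<delta> where \<delta>: "0 < \<delta>" "\<delta> \<le> 1" "A < (LINT h|lborel. cap_kernel \<delta> (h::'a))"
  proof
    \<comment> \<open>With \<delta> = \<open>exp (- t)\<close> the lower bound for the mass becomes
      exactly \<open>\<bar>A\<bar> + 1\<close>.\<close>
    define t where "t = (\<bar>A\<bar> + 1 + measure lborel (cball (0::'a) 1)) / \<omega>"
    have t: "0 \<le> t" using \<omega> by (simp add: t_def)
    show "0 < exp (- t)" "exp (- t) \<le> 1" using t by auto
    have "A < \<omega> * t - measure lborel (cball (0::'a) 1)" using \<omega> by (simp add: t_def)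
    also have "\<dots> \<le> (LINT h|lborel. cap_kernel (exp (- t)) (h::'a))"
      using integral_cap_kernel_ge[where 'a='a, of "exp (- t)"] t by (simp add: \<omega>_def ln_div)
    finally show "A < (LINT h|lborel. cap_kernel (exp (- t)) (h::'a))" .
  qed
  define \<kappa> :: "'a \<Rightarrow> real" where "\<kappa> = cap_kernel \<delta>"
  define a where "a = (\<integral>h. \<kappa> h \<partial>lborel)"
  have \<kappa>: "far_kernel \<kappa>" unfolding \<kappa>_def by (rule far_kernel_cap_kernel[OF \<delta>(1,2)])
  note [measurable] = far_kernelD(1)[OF \<kappa>] near_kernel_measurable[OF \<kappa>] rhs_measurable[OF \<kappa>]
  have aA: "2 * G + c + c * (L * \<omega>) < c * a * m"
    using \<delta>(3) c_pos m by (simp add: a_def \<kappa>_def A_def field_simps)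
  \<comment> \<open>Makes the shifted convolution change by at most 1; the summand 1 in the
    denominator guards against a zero.\<close>
  define \<epsilon> where "\<epsilon> = 1 / (M * measure lborel \<Omega> + 1)"
  have \<epsilon>: "0 < \<epsilon>" "\<epsilon> * M * measure lborel \<Omega> \<le> 1"
  proof -
    have "0 \<le> M * measure lborel \<Omega>" using M_nonneg by simp
    then show "0 < \<epsilon>" "\<epsilon> * M * measure lborel \<Omega> \<le> 1" by (auto simp: \<epsilon>_def field_simps add_pos_nonneg)
  qed
  obtain \<eta> where \<eta>: "0 < \<eta>" "\<And>h d. norm d < \<eta> \<Longrightarrow> \<bar>\<kappa> (h + d) - \<kappa> h\<bar> < \<epsilon>"
    using cap_kernel_uniformly_continuous[OF \<delta>(1,2) \<epsilon>(1), where 'a='a] unfolding \<kappa>_def by blast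
  have conv: "\<bar>(\<integral>y. \<kappa> (x + d - y) * u y \<partial>lborel) - (\<integral>y. \<kappa> (x - y) * u y \<partial>lborel)\<bar> \<le> 1"
    if d: "norm d < \<eta>" for x d
  proof -
    have int: "integrable lborel (\<lambda>y. \<kappa> (z - y) * u y)" for z using kernel_u_integrable[OF \<kappa>, of z 0] by simp
    have fin: "integrable lborel (indicator \<Omega> :: 'a \<Rightarrow> real)"
      using emeasure_bounded_finite[OF bounded_domain] by (intro integrable_real_indicator) auto
    have "\<bar>(\<integral>y. \<kappa> (x + d - y) * u y \<partial>lborel) - (\<integral>y. \<kappa> (x - y) * u y \<partial>lborel)\<bar>
      = \<bar>\<integral>y. \<kappa> (x + d - y) * u y - \<kappa> (x - y) * u y \<partial>lborel\<bar>"
      using int by (subst Bochner_Integration.integral_diff) auto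
    also have "\<dots> \<le> (\<integral>y. \<epsilon> * M * indicator \<Omega> y \<partial>lborel)"
    proof (rule integral_abs_bound_integral)
      fix y
      have "\<bar>\<kappa> (x - y + d) - \<kappa> (x - y)\<bar> * \<bar>u y\<bar> \<le> \<epsilon> * M"
        using \<eta>(2)[OF d, of "x - y"] u_bound[of y] \<epsilon>(1) by (intro mult_mono) auto
      moreover have "\<kappa> (x + d - y) * u y - \<kappa> (x - y) * u y = (\<kappa> (x - y + d) - \<kappa> (x - y)) * u y"
        by (simp add: algebra_simps)
      ultimately show "\<bar>\<kappa> (x + d - y) * u y - \<kappa> (x - y) * u y\<bar> \<le> \<epsilon> * M * indicator \<Omega> y"
        using u_outside[of y] by (cases "y \<in> \<Omega>") (simp_all add: abs_mult)
    qed (use int fin in auto)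
    also have "\<dots> \<le> 1" using \<epsilon>(2) by simp
    finally show ?thesis .
  qed
  show ?thesis
  proof (intro exI[of _ "min \<eta> r"] conjI allI impI)
    show "0 < min \<eta> r" using \<eta> r by simp
    fix d :: 'a assume d: "norm d < min \<eta> r"
    define ud where "ud x = u (x + d)" for x
    have [measurable]: "ud \<in> borel_measurable borel" unfolding ud_def by measurable
    define v where "v x = ud x - u x" for x
    have [measurable]: "v \<in> borel_measurable borel" unfolding v_def by measurable
    \<comment> \<open>Equals \<open>m\<close> on \<open>ball x0 r\<close> and is at least
      \<open>m + 2 * M\<close> outside \<open>?S\<close>, while \<open>v\<close> is bounded by
      \<open>2 * M\<close>; so the excess is supported in \<open>?S\<close>.\<close>
    define W where "W x = m + 2 * M * max 0 (norm (x - x0) / r - 1)" for x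
    have [measurable]: "W \<in> borel_measurable borel" unfolding W_def by measurable
    let ?S = "ball x0 (2 * r)"
    let ?\<phi> = "\<lambda>x. max 0 (v x - W x)"
    have ud_energy: "finite_energy ud" unfolding ud_def by (rule finite_energy_translate) (auto simp: u_energy)
    have v_energy: "finite_energy v" unfolding v_def using ud_energy u_energy by (intro finite_energy_diff) auto
    have v_bound: "\<bar>v x\<bar> \<le> 2 * M" for x using u_bound[of x] u_bound[of "x + d"] by (simp add: v_def ud_def)
    have Wm: "m \<le> W x" for x using M_nonneg by (simp add: W_def)
    have W0: "0 \<le> W x" for x using Wm[of x] m by simp
    have Lip: "\<bar>W x - W y\<bar> \<le> L * norm (x - y)" for x y
    proof -
      have "\<bar>norm (x - x0) - norm (y - x0)\<bar> \<le> norm (x - y)" using norm_triangle_ineq3[of "x - x0" "y - x0"] by simp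
      then have "\<bar>norm (x - x0) / r - norm (y - x0) / r\<bar> \<le> norm (x - y) / r"
        using r by (simp add: diff_divide_distrib[symmetric] divide_right_mono)
      then have "\<bar>max 0 (norm (x - x0) / r - 1) - max 0 (norm (y - x0) / r - 1)\<bar> \<le> norm (x - y) / r" by linarith
      then have "2 * M * \<bar>max 0 (norm (x - x0) / r - 1) - max 0 (norm (y - x0) / r - 1)\<bar> \<le> 2 * M * (norm (x - y) / r)"
        using M_nonneg by (intro mult_left_mono) auto
      moreover have "\<bar>W x - W y\<bar> = 2 * M * \<bar>max 0 (norm (x - x0) / r - 1) - max 0 (norm (y - x0) / r - 1)\<bar>"
        unfolding W_def using M_nonneg by (simp add: abs_mult right_diff_distrib[symmetric])
      ultimately show ?thesis by (simp add: L_def)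
    qed
    have supp: "v x \<le> W x" if "x \<notin> ?S" for x
    proof -
      have "1 \<le> norm (x - x0) / r - 1" using that r by (simp add: dist_norm norm_minus_commute field_simps)
      then have "2 * M * 1 \<le> 2 * M * max 0 (norm (x - x0) / r - 1)" using M_nonneg by (intro mult_left_mono) auto
      then show ?thesis using v_bound[of x] m by (simp add: W_def)
    qed
    have S: "?S \<in> sets borel" "bounded ?S" by auto
    note ctx = \<open>v \<in> borel_measurable borel\<close> \<open>W \<in> borel_measurable borel\<close> v_energy S Lip L supp W0 v_bound
    have \<phi>_energy: "finite_energy ?\<phi>" by (rule finite_energy_excess[OF ctx])
    have \<phi>_bound: "\<bar>?\<phi> x\<bar> \<le> 2 * M" for x using v_bound[of x] W0[of x] by auto
    have in_\<Omega>: "x \<in> \<Omega>" if "norm (x - x0) < 4 * r" for x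
      using that ball by (auto simp: dist_norm norm_minus_commute subset_eq)
    have test: "test_function \<Omega> ?\<phi>"
      unfolding test_function_def
    proof (intro conjI exI[of _ "2 * M"] allI impI)
      fix x assume "x \<notin> \<Omega>"
      then have "x \<notin> ?S" using in_\<Omega>[of x] r by (auto simp: dist_norm norm_minus_commute)
      from supp[OF this] show "?\<phi> x = 0" by simp
    qed (use \<phi>_energy \<phi>_bound in auto)
    have test': "test_function \<Omega> (\<lambda>x. ?\<phi> (x - d))"
      unfolding test_function_def
    proof (intro conjI exI[of _ "2 * M"] allI impI)
      fix x assume x: "x \<notin> \<Omega>"
      \<comment> \<open>The excess lives within \<open>2 * r\<close> of \<open>x0\<close> and the
        shift is shorter than \<open>r\<close>, so its translate stays within
        \<open>3 * r\<close>.\<close>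
      have "norm (x - x0) \<le> norm (x - d - x0) + norm d" using norm_triangle_ineq[of "x - d - x0" d] by simp
      then have "x - d \<notin> ?S" using in_\<Omega>[of x] x r d by (force simp: dist_norm norm_minus_commute)
      from supp[OF this] show "?\<phi> (x - d) = 0" by simp
    next
      show "finite_energy (\<lambda>x. ?\<phi> (x - d))"
        using finite_energy_translate[OF _ \<phi>_energy, of "- d"] by simp
    qed (use \<phi>_bound in auto)
    \<comment> \<open>Bounding \<open>near_kernel \<kappa>\<close> by \<open>trunc_riesz\<close>
      keeps this estimate independent of \<kappa>.\<close>
    have super: "- (L * \<omega>) \<le> (\<integral>y. (W x - W y) * near_kernel \<kappa> (x - y) \<partial>lborel)" for x
    proof -
      have b: "has_bochner_integral lborel (\<lambda>h::'a. L * (norm h * trunc_riesz h)) (L * \<omega>)"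
        unfolding \<omega>_def using has_bochner_integral_norm_trunc_riesz by (rule has_bochner_integral_mult_right)
      then have bi: "integrable lborel (\<lambda>h::'a. L * (norm h * trunc_riesz h))"
        and be: "(LINT h|lborel. L * (norm (h::'a) * trunc_riesz h)) = L * \<omega>"
        unfolding has_bochner_integral_iff by auto
      have "\<bar>\<integral>y. (W x - W y) * near_kernel \<kappa> (x - y) \<partial>lborel\<bar> \<le> (\<integral>y. L * (norm (x - y) * trunc_riesz (x - y)) \<partial>lborel)"
      proof (rule integral_abs_bound_integral)
        show i: "integrable lborel (\<lambda>y. L * (norm (x - y) * trunc_riesz (x - y)))"
          using integrable_reflect_iff[of "\<lambda>h. L * (norm h * trunc_riesz h)" x] bi by simp
        have bd: "\<bar>(W x - W y) * near_kernel \<kappa> (x - y)\<bar> \<le> L * (norm (x - y) * trunc_riesz (x - y))" for y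
        proof -
          have "\<bar>W x - W y\<bar> * near_kernel \<kappa> (x - y) \<le> (L * norm (x - y)) * trunc_riesz (x - y)"
            using Lip near_kernel_le[OF \<kappa>] near_kernel_nonneg[OF \<kappa>] L by (intro mult_mono) auto
          then show ?thesis using near_kernel_nonneg[OF \<kappa>, of "x - y"] by (simp add: abs_mult mult.assoc)
        qed
        then show "\<bar>(W x - W y) * near_kernel \<kappa> (x - y)\<bar> \<le> L * (norm (x - y) * trunc_riesz (x - y))" for y .
        show "integrable lborel (\<lambda>y. (W x - W y) * near_kernel \<kappa> (x - y))"
          by (rule Bochner_Integration.integrable_bound[OF i])
            (use bd in \<open>auto intro!: AE_I2 intro: order_trans[OF _ abs_ge_self]\<close>)
      qed
      also have "\<dots> = (LINT h|lborel. L * (norm (h::'a) * trunc_riesz h))"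
        by (rule integral_reflect[of "\<lambda>h. L * (norm h * trunc_riesz h)"]) measurable
      also note be
      finally show ?thesis by linarith
    qed
    obtain B where B: "\<And>x. \<bar>rhs \<kappa> x\<bar> \<le> B" using rhs_bound[OF \<kappa>] by auto
    have shifted: "c / 2 * dbl_form (near_kernel \<kappa>) ud ?\<phi> = (\<integral>x. rhs \<kappa> (x + d) * ?\<phi> x \<partial>lborel)"
    proof -
      have "c / 2 * dbl_form (near_kernel \<kappa>) ud ?\<phi> = c / 2 * dbl_form (near_kernel \<kappa>) u (\<lambda>x. ?\<phi> (x - d))"
        unfolding ud_def by (subst dbl_form_translate) auto
      also have "\<dots> = (\<integral>x. rhs \<kappa> x * ?\<phi> (x - d) \<partial>lborel)" by (rule weak_near[OF \<kappa> test'])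
      also have "\<dots> = (\<integral>x. rhs \<kappa> (x + d) * ?\<phi> x \<partial>lborel)"
        using integral_translate[of "\<lambda>x. rhs \<kappa> x * ?\<phi> (x - d)" d] by simp
      finally show ?thesis .
    qed
    have i1: "integrable lborel (\<lambda>x. rhs \<kappa> (x + d) * ?\<phi> x)"
      by (rule integrable_mult_test[OF test _ B]) measurable
    have i2: "integrable lborel (\<lambda>x. rhs \<kappa> x * ?\<phi> x)"
      by (rule integrable_mult_test[OF test _ B]) measurable
    have "c / 2 * (2 * (- (L * \<omega>)) * (\<integral>x. ?\<phi> x \<partial>lborel)) \<le> c / 2 * dbl_form (near_kernel \<kappa>) v ?\<phi>"
      using dbl_form_excess_ge[OF ctx \<kappa> super] c_pos by (intro mult_left_mono) auto
    also have "\<dots> = (\<integral>x. rhs \<kappa> (x + d) * ?\<phi> x \<partial>lborel) - (\<integral>x. rhs \<kappa> x * ?\<phi> x \<partial>lborel)"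
    proof -
      have "dbl_form (near_kernel \<kappa>) v ?\<phi> = dbl_form (near_kernel \<kappa>) ud ?\<phi> - dbl_form (near_kernel \<kappa>) u ?\<phi>"
        using dbl_form_diff[OF ud_energy u_energy \<phi>_energy _ _ _ near_kernel_measurable[OF \<kappa>]
            near_kernel_nonneg[OF \<kappa>] near_kernel_le[OF \<kappa>]]
        unfolding v_def[symmetric] by simp
      then show ?thesis using shifted weak_near[OF \<kappa> test] by (simp add: right_diff_distrib)
    qed
    also have "\<dots> = (\<integral>x. rhs \<kappa> (x + d) * ?\<phi> x - rhs \<kappa> x * ?\<phi> x \<partial>lborel)"
      using i1 i2 by (rule Bochner_Integration.integral_diff[symmetric])
    also have "\<dots> \<le> (\<integral>x. (2 * G + c - c * a * m) * ?\<phi> x \<partial>lborel)"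
    proof (rule integral_mono)
      show "integrable lborel (\<lambda>x. rhs \<kappa> (x + d) * ?\<phi> x - rhs \<kappa> x * ?\<phi> x)"
        using i1 i2 by (rule Bochner_Integration.integrable_diff)
      show "integrable lborel (\<lambda>x. (2 * G + c - c * a * m) * ?\<phi> x)"
        using integrable_excess[OF ctx] by simp
      fix x
      show "rhs \<kappa> (x + d) * ?\<phi> x - rhs \<kappa> x * ?\<phi> x \<le> (2 * G + c - c * a * m) * ?\<phi> x"
      proof (cases "W x < v x")
        case True
        have a: "0 \<le> a" unfolding a_def using far_kernelD(2)[OF \<kappa>] by (intro Bochner_Integration.integral_nonneg) auto
        let ?D = "(\<integral>y. \<kappa> (x + d - y) * u y \<partial>lborel) - (\<integral>y. \<kappa> (x - y) * u y \<partial>lborel)"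
        \<comment> \<open>The zero-order terms combine to \<open>- c * (a * v x)\<close>, the only
          term that grows with the mass; where \<open>v\<close> exceeds \<open>W\<close> its sign is
          favourable.\<close>
        have "rhs \<kappa> (x + d) - rhs \<kappa> x = (g (x + d) - g x) + c * ?D - c * (a * v x)"
          unfolding rhs_def a_def v_def ud_def by (simp add: algebra_simps)
        moreover have "c * ?D \<le> c * 1" using conv[of d x] d c_pos by (intro mult_left_mono) auto
        moreover have "c * (a * m) \<le> c * (a * v x)"
          using True Wm[of x] c_pos a by (intro mult_left_mono) auto
        ultimately have "rhs \<kappa> (x + d) - rhs \<kappa> x \<le> 2 * G + c - c * a * m"
          using g_bound[of x] g_bound[of "x + d"] unfolding mult.assoc by linarith
        then have "(rhs \<kappa> (x + d) - rhs \<kappa> x) * ?\<phi> x \<le> (2 * G + c - c * a * m) * ?\<phi> x"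
          by (rule mult_right_mono) simp
        then show ?thesis by (simp only: left_diff_distrib)
      qed simp
    qed
    also have "\<dots> = (2 * G + c - c * a * m) * (\<integral>x. ?\<phi> x \<partial>lborel)" by (rule integral_mult_right_zero)
    finally have "(c * a * m - (2 * G + c + c * (L * \<omega>))) * (\<integral>x. ?\<phi> x \<partial>lborel) \<le> 0"
      by (simp add: algebra_simps)
    then have "(\<integral>x. ?\<phi> x \<partial>lborel) \<le> 0" using aA by (simp add: mult_le_0_iff)
    moreover have "0 \<le> (\<integral>x. ?\<phi> x \<partial>lborel)" by (intro Bochner_Integration.integral_nonneg) simp
    ultimately have "AE x in lborel. ?\<phi> x = 0"
      using integrable_excess[OF ctx] by (subst integral_nonneg_eq_0_iff_AE[symmetric]) auto
    then show "AE x in lborel. x \<in> ball x0 r \<longrightarrow> u (x + d) - u x \<le> m"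
    proof eventually_elim
      case (elim x)
      show ?case
      proof
        assume "x \<in> ball x0 r"
        then have "W x = m" using r by (simp add: W_def dist_norm norm_minus_commute)
        then show "u (x + d) - u x \<le> m" using elim by (simp add: v_def ud_def max_def split: if_splits)
      qed
    qed
  qed
qed

end

section \<open>The logarithmic barrier\<close>

text \<open>The slab has \<open>n\<close> disjoint translates inside the ball of radius 2, so its measure is small
  uniformly in the direction; no rotation invariance is needed.\<close>

lemma slab_measure_le:
  fixes \<nu> :: "'a::euclidean_space"
  assumes \<nu>: "norm \<nu> = 1" and n: "0 < n"
  defines "S \<equiv> {h \<in> cball 0 1. 0 \<le> h \<bullet> \<nu> \<and> h \<bullet> \<nu> \<le> 1 / (2 * real n)}"
  shows "real n * measure lborel S \<le> measure lborel (cball (0::'a) 2)"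
proof -
  have \<nu>\<nu>: "\<nu> \<bullet> \<nu> = 1" using \<nu> by (simp add: dot_square_norm)
  \<comment> \<open>Slabs of height \<open>1 / (2 * n)\<close> at spacing \<open>1 / n\<close>: the
    gaps keep the closed slabs disjoint.\<close>
  define T where "T j = (+) ((real j / real n) *\<^sub>R \<nu>) ` S" for j :: nat
  have T_eq: "T j = {h. h - (real j / real n) *\<^sub>R \<nu> \<in> S}" for j
  proof safe
    fix h assume "h - (real j / real n) *\<^sub>R \<nu> \<in> S"
    then show "h \<in> T j" unfolding T_def by (intro image_eqI[of _ _ "h - (real j / real n) *\<^sub>R \<nu>"]) auto
  qed (auto simp: T_def)
  have S [measurable]: "S \<in> sets borel" unfolding S_def by measurable
  have T_meas: "T j \<in> sets borel" for j unfolding T_eq by measurable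
  have T_measure: "measure lborel (T j) = measure lborel S" for j
    using measure_translation[of "(real j / real n) *\<^sub>R \<nu>" S] T_meas[of j] S
    by (simp add: T_def)
  have T_dot: "real j / real n \<le> h \<bullet> \<nu>" "h \<bullet> \<nu> < (real j + 1) / real n" if "h \<in> T j" for h j
  proof -
    have "0 \<le> h \<bullet> \<nu> - real j / real n" "h \<bullet> \<nu> - real j / real n \<le> 1 / (2 * real n)"
      using that \<nu>\<nu> by (auto simp: T_eq S_def inner_diff_left)
    moreover have "1 / (2 * real n) < 1 / real n" using n by (simp add: field_simps)
    ultimately show "real j / real n \<le> h \<bullet> \<nu>" "h \<bullet> \<nu> < (real j + 1) / real n"
      by (auto simp: add_divide_distrib)
  qed
  have disj: "disjoint_family_on T {..<n}"
    unfolding disjoint_family_on_def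
  proof (intro ballI impI)
    fix i j assume "i \<in> {..<n}" "j \<in> {..<n}" "i \<noteq> j"
    show "T i \<inter> T j = {}"
    proof (rule ccontr)
      assume "T i \<inter> T j \<noteq> {}"
      then obtain h where "h \<in> T i" "h \<in> T j" by auto
      then have "real i / real n < (real j + 1) / real n" "real j / real n < (real i + 1) / real n"
        using T_dot by (meson le_less_trans)+
      then show False using n \<open>i \<noteq> j\<close> by (simp add: divide_less_cancel)
    qed
  qed
  have sub: "T j \<subseteq> cball 0 2" if "j < n" for j
  proof
    fix h assume "h \<in> T j"
    then have "norm (h - (real j / real n) *\<^sub>R \<nu>) \<le> 1" by (auto simp: T_eq S_def)
    moreover have "norm ((real j / real n) *\<^sub>R \<nu>) \<le> 1" using \<nu> that by simp
    moreover have "norm h \<le> norm (h - (real j / real n) *\<^sub>R \<nu>) + norm ((real j / real n) *\<^sub>R \<nu>)"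
      using norm_triangle_ineq[of "h - (real j / real n) *\<^sub>R \<nu>" "(real j / real n) *\<^sub>R \<nu>"] by simp
    ultimately show "h \<in> cball 0 2" by simp
  qed
  have fin: "emeasure lborel (T j) \<noteq> \<infinity>" if "j < n" for j
    using emeasure_bounded_finite[OF bounded_subset[OF bounded_cball sub[OF that]]] by simp
  have "real n * measure lborel S = (\<Sum>j<n. measure lborel (T j))" by (simp add: T_measure)
  also have "\<dots> = measure lborel (\<Union>j<n. T j)"
    using disj T_meas fin by (intro measure_finite_Union[symmetric]) auto
  also have "\<dots> \<le> measure lborel (cball (0::'a) 2)"
  proof (rule measure_mono_fmeasurable)
    show "(\<Union>j<n. T j) \<in> sets lborel" using T_meas by auto
    show "cball (0::'a) 2 \<in> fmeasurable lborel"
      using emeasure_lborel_cball_finite[of "0::'a" 2] by (intro fmeasurableI) auto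
  qed (use sub in auto)
  finally show ?thesis .
qed

text \<open>In the unit ball the cone lies in the open half-ball opposite to \<nu> together with a
  slab of height \<epsilon>. By reflection the half-ball has at most half the volume, and
  \<open>slab_measure_le\<close> makes the slab small with \<epsilon> independent of \<nu>.\<close>

lemma wide_cone_measure:
  assumes \<sigma>: "0 < \<sigma>"
  shows "\<exists>\<epsilon>>0. \<epsilon> \<le> 1 \<and> (\<forall>\<nu>::'a::euclidean_space. norm \<nu> = 1 \<longrightarrow>
    measure lborel ({h. h \<bullet> \<nu> \<le> \<epsilon> * norm h} \<inter> cball 0 1) \<le> measure lborel (cball (0::'a) 1) / 2 + \<sigma>)"
proof -
  obtain n :: nat where n: "measure lborel (cball (0::'a) 2) / \<sigma> < n" using reals_Archimedean2 by blast
  then have n0: "0 < n" using \<sigma> by (metis gr0I measure_nonneg divide_nonneg_pos not_less of_nat_0)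
  let ?\<epsilon> = "1 / (2 * real n)"
  have fm: "X \<inter> cball 0 1 \<in> fmeasurable lborel" if "X \<in> sets borel" for X :: "'a set"
    using emeasure_bounded_finite[of "X \<inter> cball 0 1"] that
    by (intro fmeasurableI) (auto simp: bounded_Int)
  have "measure lborel ({h. h \<bullet> \<nu> \<le> ?\<epsilon> * norm h} \<inter> cball 0 1) \<le> measure lborel (cball (0::'a) 1) / 2 + \<sigma>"
    if \<nu>: "norm \<nu> = 1" for \<nu> :: 'a
  proof -
    let ?N = "{h. h \<bullet> \<nu> < 0} \<inter> cball 0 1" and ?P = "{h. 0 < h \<bullet> \<nu>} \<inter> cball 0 1"
    let ?S = "{h \<in> cball 0 1. 0 \<le> h \<bullet> \<nu> \<and> h \<bullet> \<nu> \<le> ?\<epsilon>}"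
    have meas: "{h. h \<bullet> \<nu> < 0} \<in> sets borel" "{h. 0 < h \<bullet> \<nu>} \<in> sets borel"
      "{h. 0 \<le> h \<bullet> \<nu> \<and> h \<bullet> \<nu> \<le> ?\<epsilon>} \<in> sets borel" by measurable
    have S_eq: "?S = {h. 0 \<le> h \<bullet> \<nu> \<and> h \<bullet> \<nu> \<le> ?\<epsilon>} \<inter> cball 0 1" by auto
    have "?P = (\<lambda>h. (-1) *\<^sub>R h + 0) ` ?N"
    proof safe
      fix h assume "h \<in> cball 0 1" "0 < h \<bullet> \<nu>"
      then show "h \<in> (\<lambda>h. (-1) *\<^sub>R h + 0) ` ?N" by (intro image_eqI[of _ _ "- h"]) auto
    qed auto
    then have "measure lebesgue ?P = measure lebesgue ?N"
      using measure_lebesgue_affine[of "-1" 0 ?N] by simp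
    then have PN: "measure lborel ?P = measure lborel ?N" using fm[OF meas(1)] fm[OF meas(2)] by (simp add: fmeasurableD)
    have "measure lborel ?N + measure lborel ?P = measure lborel (?N \<union> ?P)"
      using fm[OF meas(1)] fm[OF meas(2)] by (intro measure_Union[symmetric]) (auto simp: fmeasurable_def)
    also have "\<dots> \<le> measure lborel (cball (0::'a) 1)"
      using fm[OF meas(1)] fm[OF meas(2)] fm[of UNIV] by (intro measure_mono_fmeasurable) (auto simp: fmeasurableD)
    finally have half: "measure lborel ?N \<le> measure lborel (cball (0::'a) 1) / 2" using PN by simp
    have "measure lborel ({h. h \<bullet> \<nu> \<le> ?\<epsilon> * norm h} \<inter> cball 0 1) \<le> measure lborel (?N \<union> ?S)"
    proof (rule measure_mono_fmeasurable)
      show "{h. h \<bullet> \<nu> \<le> ?\<epsilon> * norm h} \<inter> cball 0 1 \<subseteq> ?N \<union> ?S"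
      proof
        fix h assume h: "h \<in> {h. h \<bullet> \<nu> \<le> ?\<epsilon> * norm h} \<inter> cball 0 1"
        then have "?\<epsilon> * norm h \<le> ?\<epsilon> * 1" by (intro mult_left_mono) auto
        then show "h \<in> ?N \<union> ?S" using h by auto
      qed
      show "?N \<union> ?S \<in> fmeasurable lborel" unfolding S_eq using fm[OF meas(1)] fm[OF meas(3)] by auto
    qed measurable
    also have "\<dots> \<le> measure lborel ?N + measure lborel ?S"
      unfolding S_eq using fm[OF meas(1)] fm[OF meas(3)] by (intro measure_Un_le) (auto simp: fmeasurableD)
    also have "measure lborel ?S \<le> \<sigma>"
    proof -
      have "real n * measure lborel ?S \<le> measure lborel (cball (0::'a) 2)" by (rule slab_measure_le[OF \<nu> n0])
      also have "\<dots> < real n * \<sigma>" using n \<sigma> by (simp add: field_simps)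
      finally show ?thesis using n0 by simp
    qed
    finally show ?thesis using half by simp
  qed
  then show ?thesis using n0 by (intro exI[of _ ?\<epsilon>]) auto
qed

text \<open>Freezing the logarithm at 2 makes the profile constant beyond \<open>exp (- 2)\<close>,
  which keeps it monotone and away from the singularity of \<open>(- ln t) powr (- \<tau>)\<close>
  at \<open>t = 1\<close>. Nonpositive t corresponds to points of the closed exterior ball.\<close>

definition log_profile :: "real \<Rightarrow> real \<Rightarrow> real" where
  "log_profile \<tau> t = (if 0 < t then max 2 (- ln t) powr (- \<tau>) else 0)"

lemma log_profile_measurable [measurable]: "log_profile \<tau> \<in> borel_measurable borel"
  unfolding log_profile_def by measurable

lemma log_profile_nonneg: "0 \<le> log_profile \<tau> t"
  by (simp add: log_profile_def)

lemma log_profile_le_1: "0 \<le> \<tau> \<Longrightarrow> log_profile \<tau> t \<le> 1"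
proof -
  assume "0 \<le> \<tau>"
  then have "max 2 (- ln t) powr (- \<tau>) \<le> max 2 (- ln t) powr 0" by (intro powr_mono) auto
  moreover have "max 2 (- ln t) powr 0 = 1" by (subst powr_zero_eq_one) auto
  ultimately show ?thesis by (auto simp: log_profile_def)
qed

lemma log_profile_mono: "0 \<le> \<tau> \<Longrightarrow> s \<le> t \<Longrightarrow> log_profile \<tau> s \<le> log_profile \<tau> t"
  by (auto simp: log_profile_def intro!: powr_mono2' max.mono)

text \<open>On arguments at least 2 the map sending p to \<open>p powr (- \<tau>) + p\<close> is
  nondecreasing, so the profile changes by no more than the logarithm, and
  \<open>ln (t / s) \<le> t / s - 1\<close>.\<close>

lemma log_profile_diff_le:
  assumes \<tau>: "0 < \<tau>" "\<tau> < 1" and st: "0 < s" "s \<le> t"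
  shows "log_profile \<tau> t - log_profile \<tau> s \<le> (t - s) / s"
proof -
  define p q where "p = max 2 (- ln t)" and "q = max 2 (- ln s)"
  have "ln s \<le> ln t" using st by simp
  then have pq: "2 \<le> p" "p \<le> q" unfolding p_def q_def by auto
  have "p powr (- \<tau>) + p \<le> q powr (- \<tau>) + q"
  proof (rule DERIV_nonneg_imp_nondecreasing[OF pq(2)])
    fix x assume x: "p \<le> x" "x \<le> q"
    have "((\<lambda>x. x powr (- \<tau>) + x) has_real_derivative (- \<tau> * x powr (- \<tau> - 1) + 1)) (at x)"
      using x pq by (auto intro!: derivative_eq_intros)
    moreover have "x powr (- \<tau> - 1) \<le> x powr 0" using x pq \<tau> by (intro powr_mono) auto
    then have "\<tau> * x powr (- \<tau> - 1) \<le> 1 * 1" using \<tau> x pq by (intro mult_mono) auto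
    ultimately show "\<exists>y. ((\<lambda>x. x powr (- \<tau>) + x) has_real_derivative y) (at x) \<and> 0 \<le> y" by force
  qed
  then have "p powr (- \<tau>) - q powr (- \<tau>) \<le> q - p" by simp
  also have "\<dots> \<le> ln t - ln s" unfolding p_def q_def using \<open>ln s \<le> ln t\<close> by auto
  also have "\<dots> = ln (t / s)" using st by (simp add: ln_div)
  also have "\<dots> \<le> t / s - 1" using st by (intro ln_le_minus_one) auto
  finally show ?thesis using st by (simp add: log_profile_def p_def q_def field_simps)
qed

text \<open>Valid also for \<open>s \<le> 0\<close>. For \<open>s \<ge> t / 2\<close> the one-sided
  estimate loses at most a factor 2; for smaller s the right-hand side exceeds 1, which bounds the
  profile.\<close>

lemma log_profile_Lipschitz:
  assumes \<tau>: "0 < \<tau>" "\<tau> < 1" and t: "0 < t"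
  shows "\<bar>log_profile \<tau> t - log_profile \<tau> s\<bar> \<le> 2 / t * \<bar>t - s\<bar>"
proof -
  consider "t \<le> s" | "t / 2 \<le> s" "s \<le> t" | "s < t / 2" by linarith
  then show ?thesis
  proof cases
    case 1
    have "(s - t) / t \<le> 2 * (s - t) / t" using 1 t by (intro divide_right_mono) auto
    then show ?thesis
      using log_profile_diff_le[OF \<tau> t 1] log_profile_mono[of \<tau> t s] \<tau> 1 by simp
  next
    case 2
    have "(t - s) / s \<le> (t - s) / (t / 2)" using 2 t by (intro divide_left_mono) auto
    then show ?thesis
      using log_profile_diff_le[OF \<tau> _ 2(2)] log_profile_mono[of \<tau> s t] \<tau> 2 t by (simp add: mult.commute)
  next
    case 3
    have "\<bar>log_profile \<tau> t - log_profile \<tau> s\<bar> \<le> 1"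
      using log_profile_nonneg[of \<tau> t] log_profile_nonneg[of \<tau> s] log_profile_le_1[of \<tau> t] log_profile_le_1[of \<tau> s] \<tau>
      by auto
    also have "1 \<le> 2 / t * \<bar>t - s\<bar>" using 3 t by (simp add: field_simps)
    finally show ?thesis .
  qed
qed

text \<open>For \<open>r \<le> 1\<close> this sharp cutoff leaves exactly \<open>riesz\<close> on
  \<open>cball 0 r\<close> as near kernel, so a barrier is tested only at scales where the curvature
  of the sphere is under control.\<close>

definition shell_kernel :: "real \<Rightarrow> 'a::euclidean_space \<Rightarrow> real" where
  "shell_kernel r h = (if r < norm h then trunc_riesz h else 0)"

lemma far_kernel_shell_kernel:
  assumes "0 < r"
  shows "far_kernel (shell_kernel r :: 'a::euclidean_space \<Rightarrow> real)"
  unfolding far_kernel_def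
proof (intro conjI allI impI exI)
  show "(shell_kernel r :: 'a \<Rightarrow> real) \<in> borel_measurable borel" unfolding shell_kernel_def by measurable
  fix h :: 'a
  have "riesz h \<le> 1 / r ^ DIM('a)" if "r < norm h"
    unfolding riesz_def using that assms by (intro divide_left_mono power_mono mult_pos_pos zero_less_power) auto
  then show "shell_kernel r h \<le> 1 / r ^ DIM('a)"
    using assms by (auto simp: shell_kernel_def trunc_riesz_def)
qed (auto simp: shell_kernel_def trunc_riesz_minus)

lemma near_kernel_shell_kernel:
  "r \<le> 1 \<Longrightarrow> near_kernel (shell_kernel r) h = (if norm h \<le> r then riesz h else 0)"
  by (auto simp: near_kernel_def shell_kernel_def trunc_riesz_def riesz_def)

text \<open>Quadratic contact of a sphere with its tangent plane. With \<open>?p\<close> the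
  component of \<open>h\<close> along \<open>y\<close> and \<open>?q\<close> the quadratic term, the
  square of the right-hand side exceeds that of the left by \<open>(?q - ?p)\<^sup>2\<close>;
  \<open>norm h \<le> norm y\<close> makes the right-hand side nonnegative.\<close>

lemma norm_diff_le_tangent:
  fixes y h :: "'a::euclidean_space"
  assumes "norm h \<le> norm y" "y \<noteq> 0"
  shows "norm (y - h) \<le> norm y - h \<bullet> (y /\<^sub>R norm y) + (norm h)\<^sup>2 / (2 * norm y)"
proof (rule power2_le_imp_le)
  let ?\<rho> = "norm y" let ?p = "h \<bullet> (y /\<^sub>R ?\<rho>)" let ?q = "(norm h)\<^sup>2 / (2 * ?\<rho>)"
  have \<rho>: "0 < ?\<rho>" using assms by simp
  have py: "?\<rho> * ?p = h \<bullet> y" using \<rho> by simp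
  have "(norm (y - h))\<^sup>2 = ?\<rho>\<^sup>2 - 2 * (h \<bullet> y) + (norm h)\<^sup>2"
    by (simp add: power2_norm_eq_inner inner_diff_left inner_diff_right inner_commute)
  also have "\<dots> = ?\<rho>\<^sup>2 - 2 * (?\<rho> * ?p) + 2 * ?\<rho> * ?q" using \<rho> py by simp
  also have "\<dots> \<le> ?\<rho>\<^sup>2 - 2 * (?\<rho> * ?p) + 2 * ?\<rho> * ?q + (?q - ?p)\<^sup>2" by simp
  also have "\<dots> = (?\<rho> - ?p + ?q)\<^sup>2" by (simp add: power2_eq_square algebra_simps)
  finally show "(norm (y - h))\<^sup>2 \<le> (?\<rho> - ?p + ?q)\<^sup>2" .
  have "?p \<le> norm h * norm (y /\<^sub>R ?\<rho>)" by (rule norm_cauchy_schwarz)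
  then have "?p \<le> ?\<rho>" using assms \<rho> by simp
  then show "0 \<le> ?\<rho> - ?p + ?q" by simp
qed

text \<open>\<open>r0\<close> and \<open>t1\<close> are chosen before z, R' and x and depend only on
  \<tau>, \<open>R\<close> and the dimension, so one pair of constants serves every shrunken
  exterior ball.\<close>

lemma log_profile_barrier:
  assumes \<tau>: "0 < \<tau>" "\<tau> < 1 / 2" and R: "0 < R"
  shows "\<exists>r0 t1. 0 < r0 \<and> r0 \<le> 1 \<and> 0 < t1 \<and>
    (\<forall>(z::'a::euclidean_space) R' x. R \<le> R' \<longrightarrow> 0 < norm (x - z) - R' \<longrightarrow> norm (x - z) - R' < t1 \<longrightarrow>
      1 \<le> (\<integral>y. (log_profile \<tau> (norm (x - z) - R') - log_profile \<tau> (norm (y - z) - R')) *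
              near_kernel (shell_kernel r0) (x - y) \<partial>lborel))"
proof -
  define v where "v = measure lborel (cball (0::'a) 1)"
  have v: "0 < v" unfolding v_def by (rule content_cball_pos) simp
  \<comment> \<open>The share of directions that may fail to lead into the ball: any value strictly
    between 1/2 and 1 - \<tau>, an interval that is nonempty exactly for \<tau> < 1/2.\<close>
  define \<beta> where "\<beta> = (1 / 2 + (1 - \<tau>)) / 2"
  have \<beta>: "1 / 2 < \<beta>" "\<beta> < 1 - \<tau>" using \<tau> by (auto simp: \<beta>_def)
  obtain \<epsilon> where \<epsilon>: "0 < \<epsilon>" "\<epsilon> \<le> 1" and cone: "\<And>\<nu>::'a. norm \<nu> = 1 \<Longrightarrow>
      measure lborel ({h. h \<bullet> \<nu> \<le> \<epsilon> * norm h} \<inter> cball 0 1) \<le> \<beta> * v"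
  proof -
    have "0 < (\<beta> - 1 / 2) * v" using \<beta> v by simp
    from wide_cone_measure[OF this, where 'a='a] obtain \<epsilon> where "0 < \<epsilon>" "\<epsilon> \<le> 1"
      "\<And>\<nu>::'a. norm \<nu> = 1 \<Longrightarrow> measure lborel ({h. h \<bullet> \<nu> \<le> \<epsilon> * norm h} \<inter> cball 0 1) \<le> v / 2 + (\<beta> - 1 / 2) * v"
      unfolding v_def by blast
    then show thesis by (intro that) (auto simp: algebra_simps)
  qed
  \<comment> \<open>In turn: stay within the truncation radius, keep the curvature error below
    \<open>\<epsilon> * norm h / 2\<close>, and keep \<open>2 * r\<close> below
    \<open>exp (- 2)\<close>, where the profile is a pure power of the logarithm.\<close>
  define r0 where "r0 = Min {1, \<epsilon> * R, exp (- 2) / 2}"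
  have r0: "0 < r0" "r0 \<le> 1" "r0 \<le> \<epsilon> * R" "r0 \<le> exp (- 2) / 2" using \<epsilon> R by (auto simp: r0_def)
  define E where "E = ln (2 / \<epsilon>) - ln r0"
  define \<gamma> where "\<gamma> = 1 - \<beta> / (1 - \<tau>)"
  have \<gamma>: "0 < \<gamma>" using \<beta> \<tau> by (simp add: \<gamma>_def)
  have E: "0 \<le> E" using \<epsilon> r0(1,2) by (simp add: E_def ln_div) (smt (verit) ln_ge_zero ln_le_zero_iff ln_less_zero)
  \<comment> \<open>Solves \<open>DIM('a) * v * (\<gamma> * Y - E - 4 / \<epsilon>) = 1\<close>. The
    logarithmic length from \<open>r1\<close> to \<open>r0\<close> will be \<open>s - E\<close>, and
    \<open>4 / \<epsilon>\<close> is the cost of the scales below \<open>r1\<close>.\<close>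
  define Y where "Y = (1 / (DIM('a) * v) + E + 4 / \<epsilon>) / \<gamma>"
  have Y: "0 \<le> Y" using v E \<epsilon> \<gamma> by (simp add: Y_def)
  \<comment> \<open>\<open>s1 \<le> s\<close> yields \<open>Y \<le> s powr (1 - \<tau>)\<close>; the
    bound \<open>\<epsilon> * r0 / 2\<close> on t in the next line yields
    \<open>r1 \<le> r0\<close>.\<close>
  define s1 where "s1 = max 2 (Y powr (1 / (1 - \<tau>)))"
  define t1 where "t1 = min (\<epsilon> * r0 / 2) (exp (- s1))"
  have main: "1 \<le> (\<integral>y. (log_profile \<tau> (norm (x - z) - R') - log_profile \<tau> (norm (y - z) - R')) *
              near_kernel (shell_kernel r0) (x - y) \<partial>lborel)"
    if R': "R \<le> R'" and t_pos: "0 < norm (x - z) - R'" and t_less: "norm (x - z) - R' < t1" for z :: 'a and R' x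
  proof -
    define t where "t = norm (x - z) - R'"
    define s where "s = - ln t"
    have t: "0 < t" "t < exp (- s1)" "t < \<epsilon> * r0 / 2" using t_pos t_less by (auto simp: t_def t1_def)
    have "ln t < - s1" using t by (metis exp_gt_zero ln_exp ln_less_cancel_iff)
    then have s: "2 \<le> s" "Y powr (1 / (1 - \<tau>)) \<le> s" by (auto simp: s_def s1_def)
    let ?F = "log_profile \<tau>"
    define w where "w y = ?F (norm (y - z) - R')" for y
    have [measurable]: "w \<in> borel_measurable borel" unfolding w_def by measurable
    let ?J = "near_kernel (shell_kernel r0) :: 'a \<Rightarrow> real"
    have \<kappa>: "far_kernel (shell_kernel r0 :: 'a \<Rightarrow> real)" by (rule far_kernel_shell_kernel[OF r0(1)])
    note [measurable] = near_kernel_measurable[OF \<kappa>]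
    have J: "?J h = (if norm h \<le> r0 then riesz h else 0)" for h by (rule near_kernel_shell_kernel[OF r0(2)])
    have Ft: "?F t = s powr (- \<tau>)" using t s by (simp add: log_profile_def s_def)
    have wx: "w x = ?F t" by (simp add: w_def t_def)
    \<comment> \<open>From the scale \<open>r1\<close> on, every direction outside \<open>D\<close> leads into the ball; below it the Lipschitz bound
      of the profile costs only a constant.\<close>
    define r1 where "r1 = 2 * t / \<epsilon>"
    have r1: "0 < r1" "r1 \<le> r0" "2 * t \<le> r1" using t \<epsilon> by (auto simp: r1_def field_simps)
    define \<nu> where "\<nu> = (x - z) /\<^sub>R norm (x - z)"
    have xz: "R < norm (x - z)" using t R' by (simp add: t_def)
    have "norm (x - z) \<noteq> 0" using xz R by linarith
    then have \<nu>: "norm \<nu> = 1" by (simp add: \<nu>_def)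
    define D where "D = {h. h \<bullet> \<nu> \<le> \<epsilon> * norm h}"
    have [measurable]: "D \<in> sets borel" unfolding D_def by measurable
    have Dcone: "c *\<^sub>R h \<in> D \<longleftrightarrow> h \<in> D" if "0 < c" for c h
      using that by (simp add: D_def mult.left_commute[of \<epsilon> c])
    let ?p = "\<lambda>r. ?F (2 * r) / r"
    \<comment> \<open>\<open>?A\<close> bounds the loss below \<open>r1\<close>, \<open>?B\<close>
      weighs the gain in all directions, \<open>?C\<close> is the loss inside the cone
      \<open>D\<close>, and \<open>?P\<close> is the antiderivative for \<open>?C\<close>.\<close>
    let ?A = "\<lambda>h::'a. indicator UNIV h * (indicator {0..r1} (norm h) * (2 / t * (norm h * riesz h)))"
    let ?B = "\<lambda>h::'a. indicator UNIV h * (indicator {r1..r0} (norm h) * (1 / norm h * (norm h * riesz h)))"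
    let ?C = "\<lambda>h::'a. indicator D h * (indicator {r1..r0} (norm h) * (?p (norm h) * (norm h * riesz h)))"
    let ?P = "\<lambda>r. - ((- ln (2 * r)) powr (1 - \<tau>) / (1 - \<tau>))"
    have A: "has_bochner_integral lborel ?A (DIM('a) * measure lborel (UNIV \<inter> cball (0::'a) 1) * (2 / t * r1 - 2 / t * 0))"
      by (rule has_bochner_integral_cone_radial[where p="\<lambda>_. 2 / t" and P="\<lambda>r. 2 / t * r"])
        (use r1 r0 t in \<open>auto intro!: derivative_eq_intros\<close>)
    have B: "has_bochner_integral lborel ?B (DIM('a) * measure lborel (UNIV \<inter> cball (0::'a) 1) * (ln r0 - ln r1))"
      by (rule has_bochner_integral_cone_radial[where p="\<lambda>r. 1 / r"])
        (use r1 r0 in \<open>auto intro!: derivative_eq_intros\<close>)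
    have ln2r: "2 \<le> - ln (2 * r)" if "0 < r" "r \<le> r0" for r
    proof -
      have "2 * r \<le> exp (- 2)" using that r0 by simp
      then have "ln (2 * r) \<le> - 2" using that by (metis ln_exp ln_le_cancel_iff exp_gt_zero mult_pos_pos zero_less_numeral)
      then show ?thesis by simp
    qed
    have C: "has_bochner_integral lborel ?C (DIM('a) * measure lborel (D \<inter> cball (0::'a) 1) * (?P r0 - ?P r1))"
    proof (rule has_bochner_integral_cone_radial[where p="?p" and P="?P"])
      fix r assume r: "r1 \<le> r" "r \<le> r0"
      then have r_pos: "0 < r" using r1 by simp
      have "((\<lambda>r. - ln (2 * r)) has_real_derivative - (1 / r)) (at r)"
        using r_pos by (auto intro!: derivative_eq_intros)
      moreover have "((\<lambda>q. q powr (1 - \<tau>)) has_real_derivative (1 - \<tau>) * (- ln (2 * r)) powr (1 - \<tau> - 1)) (at (- ln (2 * r)))"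
        using ln2r[OF r_pos r(2)] by (intro has_real_derivative_powr) auto
      ultimately have "((\<lambda>r. (- ln (2 * r)) powr (1 - \<tau>)) has_real_derivative
          (1 - \<tau>) * (- ln (2 * r)) powr (1 - \<tau> - 1) * - (1 / r)) (at r)"
        by (rule DERIV_chain2[rotated])
      from DERIV_minus[OF DERIV_cdivide[OF this, of "1 - \<tau>"]]
      have "(?P has_real_derivative (- ln (2 * r)) powr (- \<tau>) / r) (at r)" using \<tau> by simp
      then show "(?P has_real_derivative ?p r) (at r)"
        using ln2r[OF r_pos r(2)] r_pos by (simp add: log_profile_def)
      show "0 \<le> ?p r" using r_pos log_profile_nonneg by simp
    qed (use r1 r0 Dcone in auto)
    let ?\<Lambda> = "\<lambda>h. ?F t * ?B h - ?A h - ?C h"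
    have lower: "?\<Lambda> h \<le> (w x - w (x - h)) * ?J h" for h
    proof -
      have riesz0: "0 \<le> riesz h" by (rule riesz_nonneg)
      have C0: "0 \<le> ?C h" using log_profile_nonneg riesz0 by (simp add: indicator_def)
      have A0: "0 \<le> ?A h" using t riesz0 by (simp add: indicator_def)
      consider "r0 < norm h" | "norm h < r1" | "r1 \<le> norm h" "norm h \<le> r0" by linarith
      then show ?thesis
      proof cases
        case 1
        then show ?thesis using C0 A0 by (simp add: J)
      next
        case 2
        have "w (x - h) - w x \<le> \<bar>?F t - ?F (norm (x - h - z) - R')\<bar>" by (simp add: w_def t_def)
        also have "\<dots> \<le> 2 / t * \<bar>t - (norm (x - h - z) - R')\<bar>"
          using \<tau> t by (intro log_profile_Lipschitz) auto
        also have "\<dots> \<le> 2 / t * norm h"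
          using norm_triangle_ineq3[of "x - z" "x - h - z"] t by (intro mult_left_mono) (auto simp: t_def)
        finally have "- (2 / t * norm h) * riesz h \<le> (w x - w (x - h)) * riesz h"
          by (intro mult_right_mono riesz0) simp
        then show ?thesis using 2 r1 C0 by (simp add: J)
      next
        case 3
        have h: "0 < norm h" using 3(1) r1(1) by linarith
        have th: "t \<le> \<epsilon> * norm h / 2" using 3(1) \<epsilon> by (simp add: r1_def field_simps)
        have eh: "norm h \<le> \<epsilon> * R" using 3(2) r0 by simp
        have "\<epsilon> * R \<le> 1 * R" using \<epsilon> R by (intro mult_right_mono) auto
        then have hR: "norm h \<le> R" using eh by linarith
        have "norm (x - z - h) \<le> norm (x - z) - h \<bullet> \<nu> + (norm h)\<^sup>2 / (2 * norm (x - z))"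
          unfolding \<nu>_def using xz hR R by (intro norm_diff_le_tangent) auto
        moreover have "(norm h)\<^sup>2 / (2 * norm (x - z)) \<le> \<epsilon> * norm h / 2"
        proof -
          have "(norm h)\<^sup>2 / (2 * norm (x - z)) \<le> (norm h)\<^sup>2 / (2 * R)"
            using xz R by (intro divide_left_mono mult_pos_pos) (auto simp: less_trans[OF R xz])
          also have "\<dots> \<le> (norm h * (\<epsilon> * R)) / (2 * R)"
            unfolding power2_eq_square using eh R by (intro divide_right_mono mult_left_mono) auto
          also have "\<dots> = \<epsilon> * norm h / 2" using R by simp
          finally show ?thesis .
        qed
        ultimately have tangent: "norm (x - h - z) - R' \<le> t - h \<bullet> \<nu> + \<epsilon> * norm h / 2"
          by (simp add: t_def algebra_simps)
        \<comment> \<open>Follows from \<open>t \<le> norm h\<close>; the same 2 stands in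
          \<open>?p\<close>.\<close>
        have triv: "norm (x - h - z) - R' \<le> 2 * norm h"
        proof -
          have "\<epsilon> * norm h \<le> 1 * norm h" using \<epsilon> by (intro mult_right_mono) auto
          then have "t \<le> norm h" using th h by linarith
          then show ?thesis using norm_triangle_ineq4[of "x - z" h] by (simp add: t_def algebra_simps)
        qed
        have "?F t - indicator D h * ?F (2 * norm h) \<le> w x - w (x - h)"
        proof (cases "h \<in> D")
          case True
          then show ?thesis using log_profile_mono[OF _ triv, of \<tau>] \<tau> by (simp add: wx) (simp add: w_def)
        next
          case False
          \<comment> \<open>Outside \<open>D\<close> the drop \<open>h \<bullet> \<nu>\<close>
            exceeds \<open>\<epsilon> * norm h\<close>, which pays for t and for the curvature
            error, each at most half of it. So \<open>x - h\<close> lies in the closed ball, where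
            the profile is 0.\<close>
          then have "norm (x - h - z) - R' \<le> 0" using tangent th by (simp add: D_def)
          then show ?thesis using False by (simp add: wx) (simp add: w_def log_profile_def)
        qed
        then have "(?F t - indicator D h * ?F (2 * norm h)) * riesz h \<le> (w x - w (x - h)) * riesz h"
          by (rule mult_right_mono) (rule riesz0)
        moreover have "?F t * ?B h - ?C h = (?F t - indicator D h * ?F (2 * norm h)) * riesz h"
          using 3 h by (simp add: algebra_simps)
        moreover have "?J h = riesz h" using 3 by (simp add: J)
        ultimately show ?thesis using A0 by simp
      qed
    qed
    have int: "integrable lborel (\<lambda>h. (w x - w (x - h)) * ?J h)"
    proof (rule Bochner_Integration.integrable_bound)
      show "integrable lborel (\<lambda>h::'a. 2 / t * (norm h * trunc_riesz h))"
        using has_bochner_integral_norm_trunc_riesz[where 'a='a] by (auto simp: has_bochner_integral_iff)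
      show "AE h in lborel. norm ((w x - w (x - h)) * ?J h) \<le> norm (2 / t * (norm h * trunc_riesz h))"
      proof (rule AE_I2)
        fix h
        have "\<bar>w x - w (x - h)\<bar> \<le> 2 / t * \<bar>t - (norm (x - h - z) - R')\<bar>"
          unfolding wx unfolding w_def using \<tau> t by (intro log_profile_Lipschitz) auto
        also have "\<dots> \<le> 2 / t * norm h"
          using norm_triangle_ineq3[of "x - z" "x - h - z"] t by (intro mult_left_mono) (auto simp: t_def)
        finally have "\<bar>w x - w (x - h)\<bar> * ?J h \<le> (2 / t * norm h) * trunc_riesz h"
          using near_kernel_le[OF \<kappa>] near_kernel_nonneg[OF \<kappa>] t by (intro mult_mono) auto
        then show "norm ((w x - w (x - h)) * ?J h) \<le> norm (2 / t * (norm h * trunc_riesz h))"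
          using near_kernel_nonneg[OF \<kappa>, of h] t by (simp add: abs_mult)
      qed
    qed measurable
    have f1: "(\<integral>y. (w x - w y) * ?J (x - y) \<partial>lborel) = (\<integral>h. (w x - w (x - h)) * ?J h \<partial>lborel)"
      using integral_reflect[of "\<lambda>h. (w x - w (x - h)) * ?J h" x] by simp
    have f2: "(\<integral>h. ?\<Lambda> h \<partial>lborel) \<le> (\<integral>h. (w x - w (x - h)) * ?J h \<partial>lborel)"
      using A B C int lower by (intro integral_mono) (auto simp only: has_bochner_integral_iff
        intro!: Bochner_Integration.integrable_diff integrable_mult_right)
    have f3: "(\<integral>h. ?\<Lambda> h \<partial>lborel) = ?F t * (DIM('a) * v * (ln r0 - ln r1)) - DIM('a) * v * (2 / t * r1)
        - DIM('a) * measure lborel (D \<inter> cball (0::'a) 1) * (?P r0 - ?P r1)"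
    proof -
      have "has_bochner_integral lborel ?\<Lambda> (?F t * (DIM('a) * v * (ln r0 - ln r1)) - DIM('a) * v * (2 / t * r1)
        - DIM('a) * measure lborel (D \<inter> cball (0::'a) 1) * (?P r0 - ?P r1))"
        using has_bochner_integral_diff[OF has_bochner_integral_diff[OF has_bochner_integral_mult_right[OF B, of "?F t"] A] C]
        by (simp add: v_def)
      then show ?thesis by (simp only: has_bochner_integral_iff)
    qed
    \<comment> \<open>The term of \<open>?P\<close> at \<open>r0\<close> is dropped by its sign, and
      \<open>t \<le> 2 * r1\<close> bounds the logarithm at \<open>r1\<close> by s.\<close>
    have f4: "DIM('a) * measure lborel (D \<inter> cball (0::'a) 1) * (?P r0 - ?P r1)
        \<le> DIM('a) * (\<beta> * v) * (s powr (1 - \<tau>) / (1 - \<tau>))"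
    proof (intro mult_mono mult_left_mono)
      show "measure lborel (D \<inter> cball (0::'a) 1) \<le> \<beta> * v" unfolding D_def by (rule cone[OF \<nu>])
      have "- ln (2 * r1) \<le> s" unfolding s_def using r1 t by simp
      then have "(- ln (2 * r1)) powr (1 - \<tau>) \<le> s powr (1 - \<tau>)"
        using ln2r[OF r1(1,2)] \<tau> by (intro powr_mono2) auto
      then have "(- ln (2 * r1)) powr (1 - \<tau>) / (1 - \<tau>) \<le> s powr (1 - \<tau>) / (1 - \<tau>)"
        using \<tau> by (intro divide_right_mono) auto
      moreover have "0 \<le> (- ln (2 * r0)) powr (1 - \<tau>) / (1 - \<tau>)" using \<tau> by simp
      ultimately show "?P r0 - ?P r1 \<le> s powr (1 - \<tau>) / (1 - \<tau>)" by simp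
      have "- ln (2 * r0) \<le> - ln (2 * r1)" using r1 by simp
      then have "(- ln (2 * r0)) powr (1 - \<tau>) / (1 - \<tau>) \<le> (- ln (2 * r1)) powr (1 - \<tau>) / (1 - \<tau>)"
        using ln2r[OF r0(1) order_refl] \<tau> by (intro divide_right_mono powr_mono2) auto
      then show "0 \<le> ?P r0 - ?P r1" by simp
    qed (use \<beta> v in auto)
    \<comment> \<open>The defect \<open>E\<close> is multiplied by a profile value, hence by at most
      1.\<close>
    have f5: "?F t * (ln r0 - ln r1) \<ge> s powr (1 - \<tau>) - E"
    proof -
      have "ln r0 - ln r1 = s - E" using t \<epsilon> by (simp add: E_def r1_def s_def ln_div ln_mult)
      moreover have "s powr (- \<tau>) * s = s powr (1 - \<tau>)" using s powr_add[of s "- \<tau>" 1] by simp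
      moreover have "s powr (- \<tau>) * E \<le> 1 * E"
        using E Ft log_profile_le_1[of \<tau> t] \<tau> by (intro mult_right_mono) auto
      ultimately show ?thesis by (simp add: Ft right_diff_distrib)
    qed
    have f6: "DIM('a) * v * (s powr (1 - \<tau>) - E) \<le> DIM('a) * v * (?F t * (ln r0 - ln r1))"
      using v by (intro mult_left_mono f5) auto
    have f7: "DIM('a) * v * (2 / t * r1) = DIM('a) * v * (4 / \<epsilon>)" using t by (simp add: r1_def)
    have f8: "?F t * (DIM('a) * v * (ln r0 - ln r1)) = DIM('a) * v * (?F t * (ln r0 - ln r1))" by simp
    have "(\<integral>y. (w x - w y) * ?J (x - y) \<partial>lborel) \<ge>
       DIM('a) * v * (s powr (1 - \<tau>) - E) - DIM('a) * v * (4 / \<epsilon>) - DIM('a) * (\<beta> * v) * (s powr (1 - \<tau>) / (1 - \<tau>))"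
      using f1 f2 f3 f4 f6 f7 f8 by linarith
    also have "DIM('a) * v * (s powr (1 - \<tau>) - E) - DIM('a) * v * (4 / \<epsilon>) - DIM('a) * (\<beta> * v) * (s powr (1 - \<tau>) / (1 - \<tau>))
       = DIM('a) * v * (\<gamma> * s powr (1 - \<tau>) - E - 4 / \<epsilon>)"
      using \<tau> by (simp add: \<gamma>_def field_simps)
    also have "\<dots> \<ge> DIM('a) * v * (\<gamma> * Y - E - 4 / \<epsilon>)"
    proof -
      have "Y = (Y powr (1 / (1 - \<tau>))) powr (1 - \<tau>)" using Y \<tau> by (simp add: powr_powr)
      also have "\<dots> \<le> s powr (1 - \<tau>)" using s \<tau> by (intro powr_mono2) auto
      finally show ?thesis using v \<gamma> by (intro mult_left_mono) auto
    qed
    moreover have "DIM('a) * v * (\<gamma> * Y - E - 4 / \<epsilon>) = 1" using v \<gamma> by (simp add: Y_def)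
    ultimately show ?thesis by (simp add: w_def)
  qed
  moreover have "0 < t1" using \<epsilon> r0 by (simp add: t1_def)
  ultimately show ?thesis using r0 by blast
qed

section \<open>Essential limits\<close>

lemma AE_lborel_ex_ball:
  fixes x :: "'a::euclidean_space"
  assumes "AE y in lborel. P y" and r: "0 < r"
  shows "\<exists>y\<in>ball x r. P y"
proof (rule ccontr)
  assume neg: "\<not> (\<exists>y\<in>ball x r. P y)"
  obtain N where N: "{y \<in> space lborel. \<not> P y} \<subseteq> N" "N \<in> null_sets lborel"
    using assms(1) unfolding eventually_ae_filter by blast
  have "ball x r \<subseteq> N"
  proof
    fix y assume "y \<in> ball x r"
    with neg have "y \<in> {y \<in> space lborel. \<not> P y}" by simp
    with N(1) show "y \<in> N" by (rule subsetD)
  qed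
  moreover have "ball x r \<in> sets lborel" by simp
  ultimately have "ball x r \<in> null_sets lborel" using null_sets_subset[OF N(2)] by blast
  then have "measure lborel (ball x r) = 0" by (simp add: measure_eq_0_null_sets)
  then show False using content_ball_pos[OF r, of x] by simp
qed

definition ess_lim :: "('a::euclidean_space \<Rightarrow> real) \<Rightarrow> 'a \<Rightarrow> real \<Rightarrow> bool" where
  "ess_lim u x l \<longleftrightarrow> (\<forall>e>0. \<exists>r>0. AE y in lborel. y \<in> ball x r \<longrightarrow> \<bar>u y - l\<bar> \<le> e)"

text \<open>The constants for \<open>e = 1 / Suc n\<close> form a Cauchy sequence: a set of full
  measure meets every ball, so two of the balls about x share a point at which both estimates
  hold.\<close>

lemma ex_ess_lim:
  assumes osc: "\<And>e. 0 < e \<Longrightarrow> \<exists>r>0. \<exists>l. AE y in lborel. y \<in> ball x r \<longrightarrow> \<bar>u y - l\<bar> \<le> e"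
  shows "\<exists>l. ess_lim u x l"
proof -
  have "\<forall>n. \<exists>r l. 0 < r \<and> (AE y in lborel. y \<in> ball x r \<longrightarrow> \<bar>u y - l\<bar> \<le> 1 / Suc n)"
    using osc by (metis of_nat_0_less_iff zero_less_Suc zero_less_divide_1_iff)
  then obtain r l where r: "\<And>n. 0 < r n"
    and l: "\<And>n. AE y in lborel. y \<in> ball x (r n) \<longrightarrow> \<bar>u y - l n\<bar> \<le> 1 / Suc n"
    by metis
  have close: "\<bar>l m - l n\<bar> \<le> 1 / Suc m + 1 / Suc n" for m n
  proof -
    have "AE y in lborel. y \<in> ball x (min (r m) (r n)) \<longrightarrow> \<bar>l m - l n\<bar> \<le> 1 / Suc m + 1 / Suc n"
      using l[of m] l[of n] by eventually_elim auto
    from AE_lborel_ex_ball[OF this, of "min (r m) (r n)" x] r show ?thesis by auto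
  qed
  have "Cauchy l"
  proof (rule metric_CauchyI)
    fix e :: real assume "0 < e"
    then obtain k :: nat where k: "1 / Suc k < e / 2" using nat_approx_posE[of "e / 2"] by auto
    show "\<exists>k. \<forall>m\<ge>k. \<forall>n\<ge>k. dist (l m) (l n) < e"
    proof (intro exI allI impI)
      fix m n assume "k \<le> m" "k \<le> n"
      then have "1 / real (Suc m) \<le> 1 / Suc k" "1 / real (Suc n) \<le> 1 / Suc k" by (auto intro!: divide_left_mono)
      then show "dist (l m) (l n) < e" using close[of m n] k unfolding dist_real_def by linarith
    qed
  qed
  then obtain L where L: "l \<longlonglongrightarrow> L" using Cauchy_convergent by (auto simp: convergent_def)
  have "ess_lim u x L"
    unfolding ess_lim_def
  proof (intro allI impI)
    fix e :: real assume e: "0 < e"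
    obtain k :: nat where k: "1 / Suc k < e / 2" using nat_approx_posE[of "e / 2"] e by auto
    obtain k' where k': "\<And>n. k' \<le> n \<Longrightarrow> \<bar>l n - L\<bar> < e / 2"
      using LIMSEQ_D[OF L, of "e / 2"] e by auto
    define n where "n = max k k'"
    have "1 / real (Suc n) \<le> 1 / Suc k" by (auto intro!: divide_left_mono simp: n_def)
    moreover have "\<bar>l n - L\<bar> < e / 2" by (rule k') (simp add: n_def)
    ultimately have "\<bar>l n - L\<bar> + 1 / Suc n \<le> e" using k by linarith
    then have "AE y in lborel. y \<in> ball x (r n) \<longrightarrow> \<bar>u y - L\<bar> \<le> e"
      using l[of n]
    proof eventually_elim
      case (elim y)
      then have "\<bar>u y - l n\<bar> \<le> 1 / Suc n" by blast
      then show ?case using \<open>\<bar>l n - L\<bar> + 1 / Suc n \<le> e\<close> by linarith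
    qed
    then show "\<exists>r>0. AE y in lborel. y \<in> ball x r \<longrightarrow> \<bar>u y - L\<bar> \<le> e" using r by blast
  qed
  then show ?thesis by blast
qed

text \<open>A small ball about y lies in the ball about x, and a common good point compares
  \<open>v y\<close> with \<open>v x\<close> at the cost of \<open>e\<close> twice.\<close>

lemma ess_lim_near:
  assumes v: "\<And>y. y \<in> \<Omega> \<Longrightarrow> ess_lim u y (v y)" and \<Omega>: "open \<Omega>" and x: "x \<in> \<Omega>" and e: "0 < e"
  shows "\<exists>r>0. ball x r \<subseteq> \<Omega> \<and> (\<forall>y\<in>ball x r. \<bar>v y - v x\<bar> \<le> 2 * e) \<and>
    (AE y in lborel. y \<in> ball x r \<longrightarrow> \<bar>u y - v x\<bar> \<le> e)"
proof -
  obtain r0 where r0: "0 < r0" "AE y in lborel. y \<in> ball x r0 \<longrightarrow> \<bar>u y - v x\<bar> \<le> e"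
    using v[OF x] e unfolding ess_lim_def by blast
  obtain r1 where r1: "0 < r1" "ball x r1 \<subseteq> \<Omega>" using \<Omega> x by (auto simp: open_contains_ball)
  define r where "r = min r0 r1"
  have r: "0 < r" "ball x r \<subseteq> \<Omega>" using r0 r1 by (auto simp: r_def)
  have ae: "AE y in lborel. y \<in> ball x r \<longrightarrow> \<bar>u y - v x\<bar> \<le> e"
    using r0(2) by eventually_elim (auto simp: r_def)
  have "\<bar>v y - v x\<bar> \<le> 2 * e" if y: "y \<in> ball x r" for y
  proof -
    obtain q where q: "0 < q" "ball y q \<subseteq> ball x r" using y open_contains_ball by blast
    obtain q' where q': "0 < q'" "AE z in lborel. z \<in> ball y q' \<longrightarrow> \<bar>u z - v y\<bar> \<le> e"
      using v[of y] e y r unfolding ess_lim_def by blast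
    have "AE z in lborel. z \<in> ball y (min q q') \<longrightarrow> \<bar>v y - v x\<bar> \<le> 2 * e"
      using ae q'(2) by eventually_elim (use q in auto)
    from AE_lborel_ex_ball[OF this, of "min q q'" y] q q' show ?thesis by auto
  qed
  then show ?thesis using r ae by blast
qed

lemma ess_lim_continuous_on:
  assumes v: "\<And>y. y \<in> \<Omega> \<Longrightarrow> ess_lim u y (v y)" and \<Omega>: "open \<Omega>"
  shows "continuous_on \<Omega> v"
proof (rule continuous_onI)
  fix x e :: real and x' assume "x' \<in> \<Omega>" "0 < (e::real)"
  then obtain r where r: "0 < r" "\<forall>y\<in>ball x' r. \<bar>v y - v x'\<bar> \<le> 2 * (e / 2)"
    using ess_lim_near[OF v \<Omega>, where e="e / 2"] by (metis half_gt_zero)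
  have "dist (v y) (v x') \<le> e" if "dist y x' < r" for y
    using r(2) that by (simp add: dist_real_def dist_commute)
  then show "\<exists>d>0. \<forall>y\<in>\<Omega>. dist y x' < d \<longrightarrow> dist (v y) (v x') \<le> e" using r(1) by blast
qed

text \<open>The estimate holds almost everywhere on each small ball; the Lindelof property leaves
  countably many balls, so the union of the exceptional sets is still null.\<close>

lemma ess_lim_AE_eq:
  assumes v: "\<And>y. y \<in> \<Omega> \<Longrightarrow> ess_lim u y (v y)" and \<Omega>: "open \<Omega>"
  shows "AE y in lborel. y \<in> \<Omega> \<longrightarrow> v y = u y"
proof -
  have small: "AE y in lborel. y \<in> \<Omega> \<longrightarrow> \<bar>u y - v y\<bar> \<le> 3 * e" if e: "0 < e" for e
  proof -
    define F where "F = {B. open B \<and> B \<subseteq> \<Omega> \<and> (AE y in lborel. y \<in> B \<longrightarrow> \<bar>u y - v y\<bar> \<le> 3 * e)}"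
    have cover: "\<Union>F = \<Omega>"
    proof
      show "\<Omega> \<subseteq> \<Union>F"
      proof
        fix x assume x: "x \<in> \<Omega>"
        obtain r where r: "0 < r" "ball x r \<subseteq> \<Omega>" "\<forall>y\<in>ball x r. \<bar>v y - v x\<bar> \<le> 2 * e"
          "AE y in lborel. y \<in> ball x r \<longrightarrow> \<bar>u y - v x\<bar> \<le> e"
          using ess_lim_near[OF v \<Omega> x e] by blast
        have "AE y in lborel. y \<in> ball x r \<longrightarrow> \<bar>u y - v y\<bar> \<le> 3 * e"
          using r(4)
        proof eventually_elim
          case (elim y)
          then show ?case using r(3)[rule_format, of y] by (auto simp del: mem_ball)
        qed
        then have "ball x r \<in> F" using r by (simp add: F_def)
        then show "x \<in> \<Union>F" using r(1) by (auto intro: centre_in_ball[THEN iffD2])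
      qed
    qed (auto simp: F_def)
    obtain F' where F': "F' \<subseteq> F" "countable F'" "\<Union>F' = \<Union>F"
      using Lindelof[of F] by (auto simp: F_def)
    have "AE y in lborel. \<forall>B\<in>F'. y \<in> B \<longrightarrow> \<bar>u y - v y\<bar> \<le> 3 * e"
      using F' by (subst AE_ball_countable) (auto simp: F_def)
    then show ?thesis
    proof eventually_elim
      case (elim y)
      then show ?case using F'(3) cover by blast
    qed
  qed
  have "AE y in lborel. \<forall>n::nat. y \<in> \<Omega> \<longrightarrow> \<bar>u y - v y\<bar> \<le> 3 * (1 / Suc n)"
    unfolding AE_all_countable by (intro allI small) simp
  then show ?thesis
  proof eventually_elim
    case (elim y)
    show ?case
    proof
      assume y: "y \<in> \<Omega>"
      have "\<bar>u y - v y\<bar> \<le> 0"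
      proof (rule field_le_epsilon)
        fix e :: real assume "0 < e"
        then obtain n :: nat where "1 / Suc n < e / 3" using nat_approx_posE[of "e / 3"] by auto
        then show "\<bar>u y - v y\<bar> \<le> 0 + e" using elim[rule_format, OF y, of n] by simp
      qed
      then show "v y = u y" by simp
    qed
  qed
qed

context weak_problem
begin

text \<open>\<open>shift_le\<close> speaks of almost every x for each fixed d. Fubini exchanges the
  two, so a single point \<open>x1\<close> near \<open>x0\<close> is compared with almost all of its
  neighbours at once, and \<open>u x1\<close> serves as l.\<close>

lemma ess_oscillation:
  assumes x0: "x0 \<in> \<Omega>" and m: "0 < m"
  shows "\<exists>r>0. \<exists>l. AE y in lborel. y \<in> ball x0 r \<longrightarrow> \<bar>u y - l\<bar> \<le> m"
proof -
  obtain q where q: "0 < q" "ball x0 q \<subseteq> \<Omega>" using open_domain x0 by (auto simp: open_contains_ball)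
  define r where "r = q / 4"
  have r: "0 < r" "ball x0 (4 * r) \<subseteq> \<Omega>" using q by (auto simp: r_def)
  obtain \<eta>1 where \<eta>1: "0 < \<eta>1" "\<And>d. norm d < \<eta>1 \<Longrightarrow> AE x in lborel. x \<in> ball x0 r \<longrightarrow> u (x + d) - u x \<le> m"
    using shift_le[OF r(2,1) m] by blast
  obtain \<eta>2 where \<eta>2: "0 < \<eta>2" "\<And>d. norm d < \<eta>2 \<Longrightarrow> AE x in lborel. x \<in> ball x0 r \<longrightarrow> - u (x + d) - - u x \<le> m"
    using weak_problem.shift_le[OF weak_problem_minus[OF weak_problem_axioms] r(2,1) m] by blast
  define \<eta> where "\<eta> = min \<eta>1 \<eta>2"
  \<comment> \<open>Any two points of \<open>ball x0 \<rho>\<close> differ by less than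
    \<eta>.\<close>
  define \<rho> where "\<rho> = min r (\<eta> / 2)"
  have \<rho>: "0 < \<rho>" "\<rho> \<le> r" "2 * \<rho> \<le> \<eta>" using r \<eta>1 \<eta>2 by (auto simp: \<rho>_def \<eta>_def)
  have "AE d in lborel. AE x in lborel. norm d < \<eta> \<longrightarrow> x \<in> ball x0 r \<longrightarrow> \<bar>u (x + d) - u x\<bar> \<le> m"
  proof (rule AE_I2)
    fix d
    show "AE x in lborel. norm d < \<eta> \<longrightarrow> x \<in> ball x0 r \<longrightarrow> \<bar>u (x + d) - u x\<bar> \<le> m"
    proof (cases "norm d < \<eta>")
      case True
      then have "AE x in lborel. x \<in> ball x0 r \<longrightarrow> u (x + d) - u x \<le> m"
        "AE x in lborel. x \<in> ball x0 r \<longrightarrow> - u (x + d) - - u x \<le> m"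
        using \<eta>1(2)[of d] \<eta>2(2)[of d] by (auto simp: \<eta>_def)
      then show ?thesis by eventually_elim auto
    qed simp
  qed
  moreover have "{z \<in> space (lborel \<Otimes>\<^sub>M lborel). norm (fst z) < \<eta> \<longrightarrow> snd z \<in> ball x0 r \<longrightarrow>
      \<bar>u (snd z + fst z) - u (snd z)\<bar> \<le> m} \<in> sets (lborel \<Otimes>\<^sub>M lborel)"
    unfolding mem_ball by measurable
  ultimately have "AE x in lborel. AE d in lborel. norm d < \<eta> \<longrightarrow> x \<in> ball x0 r \<longrightarrow> \<bar>u (x + d) - u x\<bar> \<le> m"
    by (subst (asm) lborel_pair.AE_commute)
  from AE_lborel_ex_ball[OF this \<rho>(1), of x0] obtain x1 where x1: "x1 \<in> ball x0 \<rho>"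
    "AE d in lborel. norm d < \<eta> \<longrightarrow> x1 \<in> ball x0 r \<longrightarrow> \<bar>u (x1 + d) - u x1\<bar> \<le> m" by blast
  have "AE d in lborel. d + x1 \<in> ball x0 \<rho> \<longrightarrow> \<bar>u (d + x1) - u x1\<bar> \<le> m"
    using x1(2)
  proof eventually_elim
    case (elim d)
    show ?case
    proof
      assume d: "d + x1 \<in> ball x0 \<rho>"
      have "norm d \<le> dist x0 (d + x1) + dist x0 x1"
        using dist_triangle2[of "d + x1" x1 x0] by (simp add: dist_norm norm_minus_commute)
      then have "norm d < \<eta>" using d x1(1) \<rho>(3) by simp
      then show "\<bar>u (d + x1) - u x1\<bar> \<le> m" using elim x1(1) \<rho>(2) by (simp add: add.commute)
    qed
  qed
  from AE_lborel_translate[OF this] show ?thesis using \<rho>(1) by blast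
qed

text \<open>\<open>A\<close> depends on none of z, R' and s, so it serves all boundary points and
  all shrinkings. The gap s makes the barrier Lipschitz on \<Omega>, with a constant that does not
  reach the conclusion.\<close>

lemma exterior_ball_estimate:
  assumes \<tau>: "0 < \<tau>" "\<tau> < 1 / 2" and R: "0 < R"
  shows "\<exists>A>0. \<forall>z R' s. R \<le> R' \<longrightarrow> 0 < s \<longrightarrow> (\<forall>y\<in>\<Omega>. s \<le> norm (y - z) - R') \<longrightarrow>
    (AE y in lborel. y \<in> \<Omega> \<longrightarrow> u y \<le> A * log_profile \<tau> (norm (y - z) - R'))"
proof -
  obtain r0 t1 where r0: "0 < r0" "r0 \<le> 1" and t1: "0 < t1" and barrier: "\<And>(z::'a) R' x. R \<le> R' \<Longrightarrow>
      0 < norm (x - z) - R' \<Longrightarrow> norm (x - z) - R' < t1 \<Longrightarrow>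
      1 \<le> (\<integral>y. (log_profile \<tau> (norm (x - z) - R') - log_profile \<tau> (norm (y - z) - R')) *
              near_kernel (shell_kernel r0) (x - y) \<partial>lborel)"
    using log_profile_barrier[OF \<tau> R, where 'a='a] by blast
  define \<kappa> :: "'a \<Rightarrow> real" where "\<kappa> = shell_kernel r0"
  have \<kappa>: "far_kernel \<kappa>" unfolding \<kappa>_def by (rule far_kernel_shell_kernel[OF r0(1)])
  obtain B where B: "\<And>x. \<bar>rhs \<kappa> x\<bar> \<le> B" using rhs_bound[OF \<kappa>] by auto
  have B0: "0 \<le> B" using B[of 0] by linarith
  define Ft where "Ft = log_profile \<tau> t1"
  have Ft: "0 < Ft" using t1 by (simp add: Ft_def log_profile_def)
  \<comment> \<open>The first summand lifts the barrier to at least \<open>M\<close> at distance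
    \<open>t1\<close> or more from the ball, so \<open>u\<close> can exceed it only in the layer
    where \<open>barrier\<close> applies; the second makes \<open>c * A\<close> exceed
    \<open>B\<close>.\<close>
  define A where "A = M / Ft + (B + 1) / c"
  have "0 \<le> M / Ft" "0 < (B + 1) / c" using Ft M_nonneg c_pos B0 by auto
  then have "0 < A" "M / Ft \<le> A" "(B + 1) / c \<le> A" by (auto simp: A_def)
  then have A: "0 < A" "M \<le> A * Ft" "B < c * A"
    using Ft c_pos by (auto simp: pos_divide_le_eq mult.commute)
  have "AE y in lborel. y \<in> \<Omega> \<longrightarrow> u y \<le> A * log_profile \<tau> (norm (y - z) - R')"
    if R': "R \<le> R'" and s: "0 < s" "\<And>y. y \<in> \<Omega> \<Longrightarrow> s \<le> norm (y - z) - R'" for z R' s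
  proof -
    let ?W = "\<lambda>y. A * log_profile \<tau> (norm (y - z) - R')"
    have "AE y in lborel. u y \<le> ?W y"
    proof (rule barrier_comparison[where L="A * (2 / s)", OF _ _ _ _ \<kappa> B A(3)])
      show "0 \<le> ?W y" for y using A log_profile_nonneg by simp
      show "0 \<le> A * (2 / s)" using A s by simp
      fix x assume x: "x \<in> \<Omega>"
      have t: "s \<le> norm (x - z) - R'" by (rule s(2)[OF x])
      show "\<bar>?W x - ?W y\<bar> \<le> A * (2 / s) * norm (x - y)" for y
      proof -
        let ?t = "norm (x - z) - R'"
        have "\<bar>log_profile \<tau> ?t - log_profile \<tau> (norm (y - z) - R')\<bar> \<le> 2 / ?t * \<bar>?t - (norm (y - z) - R')\<bar>"
          using t s \<tau> by (intro log_profile_Lipschitz) auto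
        also have "\<dots> \<le> 2 / s * norm (x - y)"
          using t s norm_triangle_ineq3[of "x - z" "y - z"] by (intro mult_mono divide_left_mono) auto
        finally have "A * \<bar>log_profile \<tau> ?t - log_profile \<tau> (norm (y - z) - R')\<bar> \<le> A * (2 / s * norm (x - y))"
          using A by (intro mult_left_mono) auto
        then show ?thesis using A by (simp add: abs_mult right_diff_distrib[symmetric] mult.assoc)
      qed
      assume "?W x < u x"
      also have "u x \<le> M" using u_bound[of x] by linarith
      also note A(2)
      finally have "log_profile \<tau> (norm (x - z) - R') < log_profile \<tau> t1" using A by (simp add: Ft_def)
      then have "norm (x - z) - R' < t1" using log_profile_mono[of \<tau> t1 "norm (x - z) - R'"] \<tau> by force
      from barrier[OF R' _ this] t s
      have "A * 1 \<le> A * (\<integral>y. (log_profile \<tau> (norm (x - z) - R') - log_profile \<tau> (norm (y - z) - R')) *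
              near_kernel \<kappa> (x - y) \<partial>lborel)"
        unfolding \<kappa>_def using A by (intro mult_left_mono) auto
      then show "A \<le> (\<integral>y. (?W x - ?W y) * near_kernel \<kappa> (x - y) \<partial>lborel)"
        by (simp add: right_diff_distrib[symmetric] mult.assoc)
    qed measurable
    then show ?thesis by eventually_elim simp
  qed
  then show ?thesis using A(1) by blast
qed

end

section \<open>The Poisson problem\<close>

lemma AE_pair_fst_snd:
  assumes "AE x in lborel. P (x::'a::euclidean_space)"
  shows "AE z in lborel. P (fst z) \<and> P (snd (z::'a \<times> 'a))"
proof -
  obtain N where N: "{y \<in> space lborel. \<not> P y} \<subseteq> N" "N \<in> null_sets lborel"
    using assms(1) unfolding eventually_ae_filter by blast
  have "N \<times> UNIV \<in> null_sets (lborel \<Otimes>\<^sub>M lborel)" "UNIV \<times> N \<in> null_sets (lborel \<Otimes>\<^sub>M lborel)"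
    using N(2) by (auto simp: null_sets_def lborel.emeasure_pair_measure_Times)
  then have "(N \<times> UNIV) \<union> (UNIV \<times> N) \<in> null_sets (lborel \<Otimes>\<^sub>M lborel)" by auto
  moreover have "{z \<in> space (lborel \<Otimes>\<^sub>M lborel). \<not> (P (fst z) \<and> P (snd z))} \<subseteq> (N \<times> UNIV) \<union> (UNIV \<times> N)"
    using N(1) by (auto simp: subset_eq)
  ultimately show ?thesis unfolding lborel_prod[symmetric] by (rule AE_I')
qed

lemma measurable_completion_AE_eq:
  assumes h: "h \<in> borel_measurable M" and ae: "AE x in M. f x = h x"
  shows "f \<in> borel_measurable (completion M)"
proof (rule measurableI)
  fix A :: "'b set" assume A: "A \<in> sets borel"
  obtain N where N: "{x \<in> space M. f x \<noteq> h x} \<subseteq> N" "N \<in> null_sets M"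
    using ae unfolding eventually_ae_filter by blast
  have "f -` A \<inter> space (completion M) = (h -` A \<inter> space M - N) \<union> (f -` A \<inter> space M \<inter> N)"
    using N(1) by auto
  moreover have "h -` A \<inter> space M - N \<in> sets (completion M)"
    using measurable_sets[OF h A] N(2) by auto
  moreover have "f -` A \<inter> space M \<inter> N \<in> sets (completion M)"
    using N(2) by (intro null_sets_completion[of N]) auto
  ultimately show "f -` A \<inter> space (completion M) \<in> sets (completion M)" by (metis sets.Un)
qed auto

text \<open>\<open>lebesgue\<close> on pairs is the completion of \<open>lborel\<close>, which is
  the product measure; this moves each integral of the form to Borel representatives.\<close>

lemma integral_completion_AE_eq:
  fixes f h :: "'a \<Rightarrow> real"
  assumes h: "h \<in> borel_measurable M" and ae: "AE x in M. f x = h x"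
  shows "integral\<^sup>L (completion M) f = integral\<^sup>L M h"
proof -
  have "integral\<^sup>L (completion M) f = integral\<^sup>L (completion M) h"
    using AE_completion[OF ae] measurable_completion_AE_eq[OF h ae] measurable_completion[OF h]
    by (intro integral_cong_AE)
  then show ?thesis using integral_completion[OF h] by simp
qed

definition outer_riesz :: "'a::euclidean_space \<Rightarrow> real" where
  "outer_riesz h = (if 1 \<le> norm h then riesz h else 0)"

lemma outer_riesz_measurable [measurable]: "outer_riesz \<in> borel_measurable borel"
  unfolding outer_riesz_def by measurable

lemma outer_riesz_bounds: "0 \<le> outer_riesz h" "outer_riesz h \<le> 1"
  by (auto simp: outer_riesz_def riesz_def divide_le_eq_1 intro: one_le_power)

lemma finite_energy_iff_nn_integral:
  fixes u u' :: "'a::euclidean_space \<Rightarrow> real"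
  assumes [measurable]: "u' \<in> borel_measurable borel" and ae: "AE x in lborel. u x = u' x"
  shows "(\<integral>\<^sup>+ z\<in>{(x, y). norm (x - y) \<le> 1}.
        (case z of (x, y) \<Rightarrow> ennreal ((u x - u y)\<^sup>2 / norm (x - y) ^ DIM('a))) \<partial>lebesgue) < \<infinity>
     \<longleftrightarrow> finite_energy u'"
proof -
  have "(\<integral>\<^sup>+ z\<in>{(x, y). norm (x - y) \<le> 1}.
        (case z of (x, y) \<Rightarrow> ennreal ((u x - u y)\<^sup>2 / norm (x - y) ^ DIM('a))) \<partial>lebesgue)
    = (\<integral>\<^sup>+ z. ennreal ((u' (fst z) - u' (snd z))\<^sup>2 * trunc_riesz (fst z - snd z)) \<partial>lborel)"
    unfolding nn_integral_completion
  proof (rule nn_integral_cong_AE)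
    show "AE z in lborel. (case z of (x, y) \<Rightarrow> ennreal ((u x - u y)\<^sup>2 / norm (x - y) ^ DIM('a))) *
        indicator {(x, y). norm (x - y) \<le> 1} z =
        ennreal ((u' (fst z) - u' (snd z))\<^sup>2 * trunc_riesz (fst z - snd z))"
      using AE_pair_fst_snd[OF ae]
      by eventually_elim (auto simp: trunc_riesz_def riesz_def split: prod.split)
  qed
  moreover have "(\<lambda>z. (u' (fst z) - u' (snd z))\<^sup>2 * trunc_riesz (fst z - snd z)) \<in> borel_measurable (lborel \<Otimes>\<^sub>M lborel)"
    by measurable
  ultimately show ?thesis
    unfolding finite_energy_def by (simp add: integrable_iff_bounded lborel_prod)
qed

lemma test_function_log_space:
  assumes "test_function \<Omega> \<phi>"
  shows "\<phi> \<in> log_space \<Omega>"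
proof -
  have [measurable]: "\<phi> \<in> borel_measurable borel" using assms by (simp add: test_function_def)
  have "finite_energy \<phi>" using assms by (simp add: test_function_def)
  then show ?thesis
    using assms finite_energy_iff_nn_integral[of \<phi> \<phi>]
    unfolding log_space_def test_function_def by (auto intro: measurable_completion)
qed

text \<open>The long-range integral and the zero-order term join f on the right. Their sum is
  bounded because \<open>u'\<close> is bounded with bounded support and \<open>outer_riesz\<close>
  is at most 1.\<close>

lemma weak_solution_imp_weak_problem:
  fixes \<Omega> :: "'a::euclidean_space set"
  assumes \<Omega>: "open \<Omega>" "bounded \<Omega>" and f: "ess_bounded (lebesgue_on \<Omega>) f"
    and u: "ess_bounded lebesgue u" and sol: "weak_solution \<Omega> f u"
  shows "\<exists>u' g G M. (AE x in lborel. u x = u' x) \<and> weak_problem \<Omega> u' g (c_const DIM('a)) G M"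
proof -
  have u_space: "u \<in> log_space \<Omega>" using sol by (simp add: weak_solution_def)
  define c where "c = c_const DIM('a)"
  define \<rho> where "\<rho> = rho_const DIM('a)"
  have c: "0 < c" by (simp add: c_def c_const_def Gamma_real_pos)
  have [measurable]: "\<Omega> \<in> sets borel" using \<Omega> by simp
  obtain C where u_meas: "u \<in> borel_measurable lebesgue" and uC: "AE x in lborel. \<bar>u x\<bar> \<le> C"
    using u by (auto simp: ess_bounded_def AE_completion_iff)
  have u0: "AE x in lborel. x \<notin> \<Omega> \<longrightarrow> u x = 0"
    using u_space by (auto simp: log_space_def AE_completion_iff)
  define M where "M = max 0 C"
  obtain u1 where u1 [measurable]: "u1 \<in> borel_measurable borel" and uu1: "AE x in lborel. u x = u1 x"
    using completion_ex_borel_measurable_real[OF u_meas] by auto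
  \<comment> \<open>Clamping and cutting off turn bounds that hold almost everywhere into bounds at
    every point, as the locale requires.\<close>
  define u' where "u' x = (if x \<in> \<Omega> then max (- M) (min M (u1 x)) else 0)" for x
  have [measurable]: "u' \<in> borel_measurable borel" unfolding u'_def by measurable
  have uu': "AE x in lborel. u x = u' x"
    using uC u0 uu1 by eventually_elim (auto simp: u'_def M_def)
  have u'M: "\<bar>u' x\<bar> \<le> M" for x by (auto simp: u'_def M_def)
  obtain F where fm: "f \<in> borel_measurable (lebesgue_on \<Omega>)" and fF: "AE x in lebesgue_on \<Omega>. \<bar>f x\<bar> \<le> F"
    using f by (auto simp: ess_bounded_def)
  define f0 where "f0 x = (if x \<in> \<Omega> then f x else 0)" for x
  have f0m: "f0 \<in> borel_measurable lebesgue"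
    unfolding f0_def using fm by (intro borel_measurable_if_I) auto
  have f0F: "AE x in lborel. x \<in> \<Omega> \<longrightarrow> \<bar>f x\<bar> \<le> F"
    using fF by (subst (asm) AE_restrict_space_iff) (auto simp: AE_completion_iff)
  obtain f1 where f1 [measurable]: "f1 \<in> borel_measurable borel" and f01: "AE x in lborel. f0 x = f1 x"
    using completion_ex_borel_measurable_real[OF f0m] by auto
  define K where "K = max 0 F"
  define f' where "f' x = max (- K) (min K (f1 x))" for x
  have [measurable]: "f' \<in> borel_measurable borel" unfolding f'_def by measurable
  have ff': "AE x in lborel. f0 x = f' x"
    using f01 f0F by eventually_elim (auto simp: f'_def f0_def K_def split: if_splits)
  have f'K: "\<bar>f' x\<bar> \<le> K" for x by (auto simp: f'_def K_def)
  define h where "h x = (\<integral>y. outer_riesz (x - y) * u' y \<partial>lborel)" for x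
  have [measurable]: "h \<in> borel_measurable borel" unfolding h_def by measurable
  have ind: "integrable lborel (\<lambda>y. a * indicator \<Omega> y :: real)" for a
    using \<Omega>(2) by (intro integrable_indicator_bounded[where S=\<Omega> and B="\<bar>a\<bar>"]) (auto simp: indicator_def)
  have hu: "\<bar>outer_riesz w * u' y\<bar> \<le> M * indicator \<Omega> y" for w y
  proof (cases "y \<in> \<Omega>")
    case True
    have "outer_riesz w * \<bar>u' y\<bar> \<le> 1 * M" using outer_riesz_bounds[of w] u'M[of y] by (intro mult_mono) auto
    then show ?thesis using True outer_riesz_bounds[of w] by (simp add: abs_mult)
  qed (simp add: u'_def)
  have h_bound: "\<bar>h x\<bar> \<le> (\<integral>y. M * indicator \<Omega> y \<partial>lborel)" for x
    unfolding h_def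
  proof (rule integral_abs_bound_integral)
    show "integrable lborel (\<lambda>y. outer_riesz (x - y) * u' y)"
      by (rule Bochner_Integration.integrable_bound[OF ind[of M]])
        (use hu in \<open>auto intro!: AE_I2 intro: order_trans[OF _ abs_ge_self]\<close>)
  qed (use ind hu in auto)
  define g where "g x = f' x + c * h x - \<rho> * u' x" for x
  have [measurable]: "g \<in> borel_measurable borel" unfolding g_def by measurable
  define G where "G = K + c * (\<integral>y. M * indicator \<Omega> y \<partial>lborel) + \<bar>\<rho>\<bar> * M"
  have gG: "\<bar>g x\<bar> \<le> G" for x
  proof -
    have "\<bar>c * h x\<bar> \<le> c * (\<integral>y. M * indicator \<Omega> y \<partial>lborel)"
      unfolding abs_mult using c h_bound by (intro mult_mono) auto
    moreover have "\<bar>\<rho> * u' x\<bar> \<le> \<bar>\<rho>\<bar> * M" unfolding abs_mult by (intro mult_left_mono u'M) auto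
    ultimately show ?thesis using f'K[of x] unfolding g_def G_def by linarith
  qed
  have weak: "c / 2 * dbl_form trunc_riesz u' \<phi> = (\<integral>x. g x * \<phi> x \<partial>lborel)" if \<phi>: "test_function \<Omega> \<phi>" for \<phi>
  proof -
    have [measurable]: "\<phi> \<in> borel_measurable borel" and \<phi>0: "\<And>x. x \<notin> \<Omega> \<Longrightarrow> \<phi> x = 0"
      using \<phi> by (auto simp: test_function_def)
    obtain B where B: "\<And>x. \<bar>\<phi> x\<bar> \<le> B" using \<phi> by (auto simp: test_function_def)
    have int_\<phi>: "integrable lborel (\<lambda>x. q x * \<phi> x)" if [measurable]: "q \<in> borel_measurable borel" and "\<And>x. \<bar>q x\<bar> \<le> Q" for q Q
    proof (rule integrable_indicator_bounded[OF _ \<Omega>(2), where B="Q * B"])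
      show "\<bar>q x * \<phi> x\<bar> \<le> Q * B" for x using that(2)[of x] B[of x] by (simp add: abs_mult mult_mono')
    qed (use \<phi>0 in auto)
    let ?P = "\<lambda>z. \<phi> (fst z) * (outer_riesz (fst z - snd z) * u' (snd z))"
    \<comment> \<open>\<open>outer_riesz\<close> is not integrable over the whole space, but
      differences of points of \<Omega> stay in \<open>cball 0 (2 * R)\<close>.\<close>
    obtain R where R: "\<And>x. x \<in> \<Omega> \<Longrightarrow> norm x \<le> R" using \<Omega>(2) by (auto simp: bounded_iff)
    have P: "integrable (lborel \<Otimes>\<^sub>M lborel) ?P"
    proof (rule integrable_kernel_bound[OF _ ind[of B], where b="\<lambda>w. M * indicator (cball 0 (2 * R)) w"])
      show "integrable lborel (\<lambda>w::'a. M * indicator (cball 0 (2 * R)) w)"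
        using emeasure_lborel_cball_finite[of "0::'a" "2 * R"] by (intro integrable_mult_right integrable_real_indicator) auto
      fix x y :: 'a
      show "\<bar>?P (x, y)\<bar> \<le> B * indicator \<Omega> x * (M * indicator (cball 0 (2 * R)) (x - y))"
      proof (cases "x \<in> \<Omega> \<and> y \<in> \<Omega>")
        case True
        have "norm (x - y) \<le> 2 * R" using R[of x] R[of y] True norm_triangle_ineq4[of x y] by simp
        moreover have "\<bar>\<phi> x\<bar> * \<bar>outer_riesz (x - y) * u' y\<bar> \<le> B * M"
          using hu[of "x - y" y] B[of x] True by (intro mult_mono) auto
        ultimately show ?thesis using True by (simp add: abs_mult)
      next
        case False
        have "0 \<le> B" "0 \<le> M" using B[of x] u'M[of x] by linarith+
        then have "0 \<le> B * indicator \<Omega> x * (M * indicator (cball 0 (2 * R)) (x - y))" by simp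
        moreover have "?P (x, y) = 0" using False \<phi>0[of x] by (auto simp: u'_def)
        ultimately show ?thesis by (simp only: abs_zero)
      qed
    qed measurable
    have T1: "(LINT (x, y):{(x, y). norm (x - y) \<le> 1}|lebesgue.
          (u x - u y) * (\<phi> x - \<phi> y) / norm (x - y) ^ DIM('a)) = dbl_form trunc_riesz u' \<phi>"
      unfolding dbl_form_def lborel_prod set_lebesgue_integral_def
    proof (rule integral_completion_AE_eq)
      show "(\<lambda>z. (u' (fst z) - u' (snd z)) * (\<phi> (fst z) - \<phi> (snd z)) * trunc_riesz (fst z - snd z)) \<in> borel_measurable lborel"
        unfolding lborel_prod[symmetric] by measurable
      show "AE z in lborel. indicat_real {(x, y). norm (x - y) \<le> 1} z *\<^sub>R
          (case z of (x, y) \<Rightarrow> (u x - u y) * (\<phi> x - \<phi> y) / norm (x - y) ^ DIM('a)) =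
        (u' (fst z) - u' (snd z)) * (\<phi> (fst z) - \<phi> (snd z)) * trunc_riesz (fst z - snd z)"
        using AE_pair_fst_snd[OF uu'] by eventually_elim (auto simp: trunc_riesz_def riesz_def split: prod.split)
    qed
    have T2: "(LINT (x, y):{(x, y). norm (x - y) \<ge> 1}|lebesgue.
          u x * \<phi> y / norm (x - y) ^ DIM('a)) = (\<integral>x. h x * \<phi> x \<partial>lborel)"
    proof -
      have "(LINT (x, y):{(x, y). norm (x - y) \<ge> 1}|lebesgue. u x * \<phi> y / norm (x - y) ^ DIM('a))
        = (\<integral>z. ?P (snd z, fst z) \<partial>lborel)"
        unfolding set_lebesgue_integral_def
      proof (rule integral_completion_AE_eq)
        show "(\<lambda>z. ?P (snd z, fst z)) \<in> borel_measurable lborel"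
          unfolding lborel_prod[symmetric] by measurable
        show "AE z in lborel. indicat_real {(x, y). norm (x - y) \<ge> 1} z *\<^sub>R
            (case z of (x, y) \<Rightarrow> u x * \<phi> y / norm (x - y) ^ DIM('a)) = ?P (snd z, fst z)"
          using AE_pair_fst_snd[OF uu']
          by eventually_elim (auto simp: outer_riesz_def riesz_def norm_minus_commute split: prod.split)
      qed
      also have "\<dots> = (\<integral>z. ?P z \<partial>(lborel \<Otimes>\<^sub>M lborel))"
        unfolding lborel_prod[symmetric] by (rule pair_swap_integral[OF P])
      also have "\<dots> = (\<integral>x. (\<integral>y. ?P (x, y) \<partial>lborel) \<partial>lborel)"
        by (rule lborel_pair.integral_fst'[OF P, symmetric])
      also have "\<dots> = (\<integral>x. h x * \<phi> x \<partial>lborel)" by (simp add: h_def mult.commute)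
      finally show ?thesis .
    qed
    have T3: "(LINT x|lebesgue. u x * \<phi> x) = (\<integral>x. u' x * \<phi> x \<partial>lborel)"
      by (rule integral_completion_AE_eq) (use uu' in \<open>auto elim: eventually_mono\<close>)
    have T4: "(LINT x:\<Omega>|lebesgue. f x * \<phi> x) = (\<integral>x. f' x * \<phi> x \<partial>lborel)"
      unfolding set_lebesgue_integral_def
    proof (rule integral_completion_AE_eq)
      show "AE x in lborel. indicat_real \<Omega> x *\<^sub>R (f x * \<phi> x) = f' x * \<phi> x"
        using ff' by eventually_elim (use \<phi>0 in \<open>auto simp: f0_def indicator_def split: if_splits\<close>)
    qed measurable
    have "log_form u \<phi> = (LINT x:\<Omega>|lebesgue. f x * \<phi> x)"
      using sol test_function_log_space[OF \<phi>] by (simp add: weak_solution_def)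
    then have "c / 2 * dbl_form trunc_riesz u' \<phi> - c * (\<integral>x. h x * \<phi> x \<partial>lborel) + \<rho> * (\<integral>x. u' x * \<phi> x \<partial>lborel)
      = (\<integral>x. f' x * \<phi> x \<partial>lborel)"
      unfolding log_form_def T1 T2 T3 T4 c_def \<rho>_def .
    moreover have "(\<integral>x. g x * \<phi> x \<partial>lborel) = (\<integral>x. f' x * \<phi> x \<partial>lborel) + c * (\<integral>x. h x * \<phi> x \<partial>lborel) - \<rho> * (\<integral>x. u' x * \<phi> x \<partial>lborel)"
    proof -
      have i: "integrable lborel (\<lambda>x. f' x * \<phi> x)" "integrable lborel (\<lambda>x. h x * \<phi> x)" "integrable lborel (\<lambda>x. u' x * \<phi> x)"
        using int_\<phi>[OF _ f'K] int_\<phi>[OF _ h_bound] int_\<phi>[OF _ u'M] by auto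
      have "(\<integral>x. g x * \<phi> x \<partial>lborel) = (\<integral>x. f' x * \<phi> x + c * (h x * \<phi> x) - \<rho> * (u' x * \<phi> x) \<partial>lborel)"
        by (intro Bochner_Integration.integral_cong) (auto simp: g_def algebra_simps)
      also have "\<dots> = (\<integral>x. f' x * \<phi> x \<partial>lborel) + c * (\<integral>x. h x * \<phi> x \<partial>lborel) - \<rho> * (\<integral>x. u' x * \<phi> x \<partial>lborel)"
        using i by (simp add: Bochner_Integration.integral_diff Bochner_Integration.integral_add)
      finally show ?thesis .
    qed
    ultimately show ?thesis by simp
  qed
  have "finite_energy u'"
    using u_space finite_energy_iff_nn_integral[OF _ uu'] by (simp add: log_space_def)
  then have "weak_problem \<Omega> u' g c G M"
    using \<Omega> u'M gG c weak by unfold_locales (auto simp: u'_def[abs_def])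
  then show ?thesis using uu' unfolding c_def by blast
qed

section \<open>Decay rates near the boundary\<close>

lemma log_profile_small:
  assumes "0 < \<tau>" "0 < e"
  shows "\<exists>t>0. log_profile \<tau> t \<le> e"
proof (intro exI conjI)
  let ?S = "max 2 (e powr (- (1 / \<tau>)))"
  show "0 < exp (- ?S)" by simp
  have "log_profile \<tau> (exp (- ?S)) = ?S powr (- \<tau>)" by (simp add: log_profile_def)
  also have "\<dots> \<le> (e powr (- (1 / \<tau>))) powr (- \<tau>)" using assms by (intro powr_mono2') auto
  also have "\<dots> = e" using assms by (simp add: powr_powr)
  finally show "log_profile \<tau> (exp (- ?S)) \<le> e" .
qed

text \<open>For \<rho> at most 1/9, the square of 1/3, the factor 3 costs at most half of
  \<open>ln (1 / \<rho>)\<close>; the remaining half explains \<open>2 powr \<tau>\<close>.\<close>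

lemma log_profile_triple_le:
  assumes "0 < \<tau>" "0 < \<rho>" "\<rho> \<le> 1 / 9"
  shows "log_profile \<tau> (3 * \<rho>) \<le> 2 powr \<tau> * ln (1 / \<rho>) powr (- \<tau>)"
proof -
  have "ln \<rho> \<le> ln (1 / 9)" using assms by (intro ln_mono) auto
  also have "ln (1 / 9 :: real) = - (2 * ln 3)"
    using ln_realpow[of "3::real" 2] by (simp add: ln_div)
  finally have *: "2 * ln 3 \<le> - ln \<rho>" by simp
  have ln3: "0 < ln (3::real)" by simp
  have "ln (1 / \<rho>) / 2 \<le> max 2 (- ln (3 * \<rho>))" "0 < ln (1 / \<rho>)"
    using * ln3 assms(2,3) by (simp_all add: ln_div ln_mult)
  then have "log_profile \<tau> (3 * \<rho>) \<le> (ln (1 / \<rho>) / 2) powr (- \<tau>)"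
    using assms by (simp add: log_profile_def) (intro powr_mono2', auto)
  also have "\<dots> = 2 powr \<tau> * ln (1 / \<rho>) powr (- \<tau>)"
    using \<open>0 < ln (1 / \<rho>)\<close> by (simp add: powr_divide powr_minus field_simps)
  finally show ?thesis .
qed

text \<open>The bound passes to the essential limit by sampling \<open>u\<close> at points within
  \<open>d\<close> of x. For these the argument of the profile is at most \<open>2 * d + d\<close>,
  whence \<open>3 * d\<close>.\<close>

lemma (in weak_problem) ess_lim_le_exterior_ball:
  assumes x: "x \<in> \<Omega>" and lim: "ess_lim u x l" and \<tau>: "0 < \<tau>" and A: "0 < A"
    and est: "AE y in lborel. y \<in> \<Omega> \<longrightarrow> u y \<le> A * log_profile \<tau> (norm (y - z) - R')"
    and d: "0 < d" "norm (x - z) - R' \<le> 2 * d"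
  shows "l \<le> A * log_profile \<tau> (3 * d)"
proof (rule field_le_epsilon)
  fix e :: real assume "0 < e"
  then obtain r where r: "0 < r" "AE y in lborel. y \<in> ball x r \<longrightarrow> \<bar>u y - l\<bar> \<le> e"
    using lim unfolding ess_lim_def by blast
  obtain q where q: "0 < q" "ball x q \<subseteq> \<Omega>" using open_domain x by (auto simp: open_contains_ball)
  have "AE y in lborel. (y \<in> \<Omega> \<longrightarrow> u y \<le> A * log_profile \<tau> (norm (y - z) - R')) \<and> (y \<in> ball x r \<longrightarrow> \<bar>u y - l\<bar> \<le> e)"
    using est r(2) by eventually_elim blast
  from AE_lborel_ex_ball[OF this, of "Min {r, q, d}" x] obtain y where y: "y \<in> ball x (Min {r, q, d})"
    "y \<in> \<Omega> \<longrightarrow> u y \<le> A * log_profile \<tau> (norm (y - z) - R')" "y \<in> ball x r \<longrightarrow> \<bar>u y - l\<bar> \<le> e"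
    using r q d by auto
  then have y': "y \<in> ball x r" "y \<in> \<Omega>" "norm (y - x) < d" using q by (auto simp: dist_norm norm_minus_commute)
  have "norm (y - z) \<le> norm (y - x) + norm (x - z)" using norm_triangle_ineq[of "y - x" "x - z"] by simp
  then have "log_profile \<tau> (norm (y - z) - R') \<le> log_profile \<tau> (3 * d)"
    using y' d \<tau> by (intro log_profile_mono) auto
  then have "A * log_profile \<tau> (norm (y - z) - R') \<le> A * log_profile \<tau> (3 * d)" using A by (intro mult_left_mono) auto
  moreover have "u y \<le> A * log_profile \<tau> (norm (y - z) - R')" "\<bar>u y - l\<bar> \<le> e" using y y' by blast+
  ultimately show "l \<le> A * log_profile \<tau> (3 * d) + e" by linarith
qed

lemma ess_lim_minus: "ess_lim u x l \<Longrightarrow> ess_lim (\<lambda>y. - u y) x (- l)"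
  unfolding ess_lim_def by (simp add: abs_minus_commute)

theorem theorem1p11:
  fixes \<Omega> :: "'a::euclidean_space set" and f u :: "'a \<Rightarrow> real"
  assumes "Lipschitz_domain \<Omega>" and "bounded \<Omega>"
    and "uniform_exterior_sphere \<Omega>"
    and "ess_bounded (lebesgue_on \<Omega>) f"
    and "u \<in> log_space \<Omega>" and "ess_bounded lebesgue u"
    and "weak_solution \<Omega> f u"
  shows "\<exists>v. (AE x in lebesgue. v x = u x) \<and> (\<forall>x. x \<notin> \<Omega> \<longrightarrow> v x = 0) \<and>
           continuous_on (closure \<Omega>) v \<and>
           (\<forall>\<tau>\<in>{0<..<1/2}.
              (\<lambda>x. \<bar>v x\<bar>) \<in> O[to_boundary \<Omega>](\<lambda>x. ln (1 / bdist \<Omega> x) powr (- \<tau>)))"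
proof -
  have \<Omega>: "open \<Omega>" "\<Omega> \<noteq> {}" using assms(1) by (auto simp: Lipschitz_domain_def)
  obtain u' g G M where uu': "AE x in lborel. u x = u' x" and P: "weak_problem \<Omega> u' g (c_const DIM('a)) G M"
    using weak_solution_imp_weak_problem[OF \<Omega>(1) assms(2,4,6,7)] by blast
  interpret P: weak_problem \<Omega> u' g "c_const DIM('a)" G M by (rule P)
  interpret N: weak_problem \<Omega> "\<lambda>x. - u' x" "\<lambda>x. - g x" "c_const DIM('a)" G M
    by (rule weak_problem_minus[OF P])
  define v where "v x = (if x \<in> \<Omega> then SOME l. ess_lim u' x l else 0)" for x
  have lim: "ess_lim u' x (v x)" if "x \<in> \<Omega>" for x
    using someI_ex[OF ex_ess_lim[OF P.ess_oscillation[OF that]]] that by (simp add: v_def)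
  have v_out: "v x = 0" if "x \<notin> \<Omega>" for x using that by (simp add: v_def)
  have cont: "continuous_on \<Omega> v" by (rule ess_lim_continuous_on[OF _ \<Omega>(1)]) (rule lim)
  have ae: "AE x in lborel. v x = u x"
  proof -
    have "AE x in lborel. x \<in> \<Omega> \<longrightarrow> v x = u' x"
      by (rule ess_lim_AE_eq[OF _ \<Omega>(1)]) (rule lim)
    then show ?thesis
      using uu' by eventually_elim (use v_out P.u_outside in metis)
  qed
  \<comment> \<open>\<open>infdist\<close> to the empty set is 0 by convention, so positivity of
    \<open>bdist\<close> inside \<Omega> needs a boundary point.\<close>
  have front: "frontier \<Omega> \<noteq> {}" using \<Omega>(2) assms(2) not_bounded_UNIV by (auto simp: frontier_eq_empty)
  obtain R0 where R0: "0 < R0" "\<And>p. p \<in> frontier \<Omega> \<Longrightarrow> \<exists>z. ball z R0 \<subseteq> - closure \<Omega> \<and> p \<in> sphere z R0"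
    using assms(3) unfolding uniform_exterior_sphere_def by blast
  have dist_pos: "0 < bdist \<Omega> x" if "x \<in> \<Omega>" for x
  proof -
    have "x \<notin> frontier \<Omega>" using that \<Omega>(1) by (simp add: frontier_def interior_open)
    then show ?thesis
      unfolding bdist_def using infdist_pos_not_in_closed[OF frontier_closed front] by blast
  qed
  \<comment> \<open>One \<open>A\<close> for all x: while \<open>bdist \<Omega> x < R0 / 2\<close>,
    the radius \<open>R0 - d\<close> of the shrunken ball is still at least
    \<open>R0 / 2\<close>.\<close>
  have decay: "\<exists>A>0. \<forall>x\<in>\<Omega>. bdist \<Omega> x < R0 / 2 \<longrightarrow> \<bar>v x\<bar> \<le> A * log_profile \<tau> (3 * bdist \<Omega> x)"
    if \<tau>: "0 < \<tau>" "\<tau> < 1 / 2" for \<tau>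
  proof -
    have R: "0 < R0 / 2" using R0 by simp
    obtain A1 where A1: "0 < A1" "\<And>z R' s. R0 / 2 \<le> R' \<Longrightarrow> 0 < s \<Longrightarrow> \<forall>y\<in>\<Omega>. s \<le> norm (y - z) - R' \<Longrightarrow>
      AE y in lborel. y \<in> \<Omega> \<longrightarrow> u' y \<le> A1 * log_profile \<tau> (norm (y - z) - R')"
      using P.exterior_ball_estimate[OF \<tau> R] by blast
    obtain A2 where A2: "0 < A2" "\<And>z R' s. R0 / 2 \<le> R' \<Longrightarrow> 0 < s \<Longrightarrow> \<forall>y\<in>\<Omega>. s \<le> norm (y - z) - R' \<Longrightarrow>
      AE y in lborel. y \<in> \<Omega> \<longrightarrow> - u' y \<le> A2 * log_profile \<tau> (norm (y - z) - R')"
      using N.exterior_ball_estimate[OF \<tau> R] by blast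
    have "\<bar>v x\<bar> \<le> max A1 A2 * log_profile \<tau> (3 * bdist \<Omega> x)" if x: "x \<in> \<Omega>" "bdist \<Omega> x < R0 / 2" for x
    proof -
      \<comment> \<open>Shrinking the ball by \<open>d\<close> keeps \<open>\<Omega>\<close> away from the sphere where the barrier is singular,
        at the price of evaluating the profile at \<open>3 * d\<close>.\<close>
      define d where "d = bdist \<Omega> x"
      have d: "0 < d" "d < R0 / 2" using dist_pos x by (auto simp: d_def)
      obtain p where p: "p \<in> frontier \<Omega>" "d = dist x p"
        unfolding d_def bdist_def using infdist_attains_inf[OF frontier_closed front] by metis
      obtain z where z: "ball z R0 \<subseteq> - closure \<Omega>" "p \<in> sphere z R0" using R0(2)[OF p(1)] by blast
      have sep: "\<forall>y\<in>\<Omega>. d \<le> norm (y - z) - (R0 - d)"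
      proof
        fix y assume "y \<in> \<Omega>"
        then have "y \<notin> ball z R0" using z(1) closure_subset by blast
        then show "d \<le> norm (y - z) - (R0 - d)" by (simp add: dist_norm norm_minus_commute)
      qed
      have "norm (x - z) \<le> d + R0"
        using dist_triangle[of x z p] p(2) z(2) by (simp add: dist_norm norm_minus_commute)
      then have near: "norm (x - z) - (R0 - d) \<le> 2 * d" by simp
      have "v x \<le> A1 * log_profile \<tau> (3 * d)"
        using P.ess_lim_le_exterior_ball[OF x(1) lim[OF x(1)] \<tau>(1) A1(1) A1(2)[OF _ d(1) sep] d(1) near] d by simp
      moreover have "- v x \<le> A2 * log_profile \<tau> (3 * d)"
        using N.ess_lim_le_exterior_ball[OF x(1) ess_lim_minus[OF lim[OF x(1)]] \<tau>(1) A2(1) A2(2)[OF _ d(1) sep] d(1) near] d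
        by simp
      moreover have "A1 * log_profile \<tau> (3 * d) \<le> max A1 A2 * log_profile \<tau> (3 * d)"
        "A2 * log_profile \<tau> (3 * d) \<le> max A1 A2 * log_profile \<tau> (3 * d)"
        using log_profile_nonneg by (auto intro!: mult_right_mono)
      ultimately show ?thesis unfolding d_def by linarith
    qed
    then show ?thesis using A1(1) by (intro exI[of _ "max A1 A2"]) auto
  qed
  have "continuous_on (closure \<Omega>) v"
    unfolding continuous_on_eq_continuous_within
  proof
    fix x assume x: "x \<in> closure \<Omega>"
    show "continuous (at x within closure \<Omega>) v"
    proof (cases "x \<in> \<Omega>")
      case True
      then show ?thesis
        using cont \<Omega>(1) by (simp add: continuous_on_eq_continuous_at continuous_at_imp_continuous_within)
    next
      case False
      then have xf: "x \<in> frontier \<Omega>" using x \<Omega>(1) by (simp add: frontier_def interior_open)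
      \<comment> \<open>Continuity at the boundary needs only some exponent strictly between 0 and
        1/2.\<close>
      obtain A where A: "0 < A" "\<And>y. y \<in> \<Omega> \<Longrightarrow> bdist \<Omega> y < R0 / 2 \<Longrightarrow> \<bar>v y\<bar> \<le> A * log_profile (1 / 4) (3 * bdist \<Omega> y)"
        using decay[of "1 / 4"] by auto
      show ?thesis
        unfolding continuous_within_eps_delta
      proof (intro allI impI)
        fix e :: real assume e: "0 < e"
        obtain t where t: "0 < t" "log_profile (1 / 4) t \<le> e / (2 * A)"
          using log_profile_small[of "1 / 4" "e / (2 * A)"] e A by auto
        show "\<exists>d>0. \<forall>y\<in>closure \<Omega>. dist y x < d \<longrightarrow> dist (v y) (v x) < e"
        proof (intro exI[of _ "min (R0 / 2) (t / 3)"] conjI ballI impI)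
          show "0 < min (R0 / 2) (t / 3)" using t R0 by simp
          fix y assume y: "dist y x < min (R0 / 2) (t / 3)"
          show "dist (v y) (v x) < e"
          proof (cases "y \<in> \<Omega>")
            case True
            have "bdist \<Omega> y \<le> dist y x" unfolding bdist_def by (rule infdist_le[OF xf])
            then have b: "bdist \<Omega> y < R0 / 2" "3 * bdist \<Omega> y \<le> t" using y by auto
            have "\<bar>v y\<bar> \<le> A * log_profile (1 / 4) (3 * bdist \<Omega> y)" by (rule A(2)[OF True b(1)])
            also have "\<dots> \<le> A * (e / (2 * A))"
              using log_profile_mono[OF _ b(2), of "1 / 4"] t(2) A(1) by (intro mult_left_mono) auto
            also have "\<dots> < e" using A(1) e by simp
            finally show ?thesis using v_out[OF False] by simp
          qed (use v_out False e in auto)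
        qed
      qed
    qed
  qed
  moreover have "(\<lambda>x. \<bar>v x\<bar>) \<in> O[to_boundary \<Omega>](\<lambda>x. ln (1 / bdist \<Omega> x) powr (- \<tau>))"
    if "\<tau> \<in> {0<..<1/2}" for \<tau>
  proof -
    have \<tau>: "0 < \<tau>" "\<tau> < 1 / 2" using that by auto
    obtain A where A: "0 < A" "\<And>y. y \<in> \<Omega> \<Longrightarrow> bdist \<Omega> y < R0 / 2 \<Longrightarrow> \<bar>v y\<bar> \<le> A * log_profile \<tau> (3 * bdist \<Omega> y)"
      using decay[OF \<tau>] by auto
    have near: "\<bar>v x\<bar> \<le> A * 2 powr \<tau> * ln (1 / bdist \<Omega> x) powr (- \<tau>)"
      if "x \<in> \<Omega>" "bdist \<Omega> x < min (R0 / 2) (1 / 9)" for x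
    proof -
      have "\<bar>v x\<bar> \<le> A * log_profile \<tau> (3 * bdist \<Omega> x)" using A(2) that by simp
      also have "\<dots> \<le> A * (2 powr \<tau> * ln (1 / bdist \<Omega> x) powr (- \<tau>))"
        using that dist_pos A(1) \<tau> by (intro mult_left_mono log_profile_triple_le) auto
      finally show ?thesis by (simp add: mult.assoc)
    qed
    have "eventually (\<lambda>r. r < min (R0 / 2) (1 / 9)) (nhds (0::real))"
      using R0 by (intro order_tendstoD(2)[OF filterlim_ident]) auto
    then have "eventually (\<lambda>x. bdist \<Omega> x < min (R0 / 2) (1 / 9)) (filtercomap (bdist \<Omega>) (nhds 0))"
      by (rule eventually_filtercomapI)
    then have "eventually (\<lambda>x. norm \<bar>v x\<bar> \<le> A * 2 powr \<tau> * norm (ln (1 / bdist \<Omega> x) powr (- \<tau>))) (to_boundary \<Omega>)"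
      unfolding to_boundary_def eventually_inf_principal
      by eventually_elim (use near in auto)
    then show ?thesis by (rule bigoI)
  qed
  ultimately show ?thesis
    using ae v_out by (intro exI[of _ v]) (auto simp: AE_completion_iff)
qed

end
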